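(* Let $\tilde{L}$ be a locally conformal almost cosymplectic manifold with structure $(\Phi,\xi,\eta,g)$ and function $\beta$, and let $L=L_\nu\times_{\phi_1}L_T\times_{\phi_2}L_\perp$ be a bi-warped product submanifold of $\tilde{L}$, where $L_\nu$ is proper slant with slant angle $\nu$, $L_T$ is invariant, $L_\perp$ is anti-invariant, and $\xi$ is tangent to $L_\nu$. Assume that $L$ is $\mathfrak{D}^\perp$-$\mathfrak{D}^\nu$ mixed totally geodesic. Put $n_1=\dim L_T$ and $n_2=\dim L_\perp$. Then: (i) The squared norm of the second fundamental form $\Sigma$ of $L$ in $\tilde L$ satisfies $$\|\Sigma\|^2\ \ge\ n_1(1+\cot^2\nu)(1+\cos^2\nu)\big(\|\vec\nabla(\ln\phi_1)\|^2-\beta^2\big)+n_2(\csc^2\nu-1)\big(\|\vec\nabla(\ln\phi_2)\|^2-\beta^2\big).$$ (ii) If equality holds identically in (i), then $L_\nu$ is a totally geodesic submanifold of $\tilde L$, and $L_T$ and $L_\perp$ are totally umbilical submanifolds of $\tilde L$. In addition, $L$ is a $\mathfrak{D}^\nu$-totally geodesic submanifold of $\tilde L$.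
   Context: An almost contact metric manifold $(\tilde L,\Phi,\xi,\eta,g)$ of dimension $2m+1$ is a Riemannian manifold with a $(1,1)$-tensor $\Phi$, a vector field $\xi$ and a 1-form $\eta$ such that $\Phi^2=-I+\eta\otimes\xi$, $\eta(\xi)=1$, $\Phi\xi=0$, $\eta\circ\Phi=0$ and $g(\Phi X,\Phi Y)=g(X,Y)-\eta(X)\eta(Y)$. It is locally conformal almost cosymplectic, with smooth function $\beta$, if $(\tilde\nabla_X\Phi)Y=\beta\big(g(\Phi X,Y)\xi-\eta(Y)\Phi X\big)$ and $\tilde\nabla_X\xi=\beta(X-\eta(X)\xi)$ for all vector fields $X,Y$, where $\tilde\nabla$ is the Levi-Civita connection of $g$. For a submanifold $L$ of $\tilde L$ the second fundamental form $\Sigma$ is given by $\tilde\nabla_XY=\nabla_XY+\Sigma(X,Y)$ ($X,Y$ tangent to $L$, $\nabla$ the Levi-Civita connection of $L$), and $\|\Sigma\|^2=\sum_{i,j}g(\Sigma(e_i,e_j),\Sigma(e_i,e_j))$ for a local orthonormal frame $\{e_i\}$ of $TL$. Slant: a submanifold tangent to $\xi$ is $\nu$-slant if for every point $x$ and every tangent vector $X$ at $x$ linearly independent of $\xi$, the angle between $\Phi X$ and the tangent space is the constant $\nu\in[0,\pi/2]$. It is invariant if $\nu=0$, anti-invariant if $\nu=\pi/2$, proper slant if $0<\nu<\pi/2$. The same terms are used for submanifolds orthogonal to $\xi$, with the condition imposed on all nonzero tangent vectors. Bi-warped product: given Riemannian manifolds $L_1,L_2,L_3$ and smooth functions $f_2,f_3:L_1\to(0,\infty)$,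 the bi-warped product $L_1\times_{f_2}L_2\times_{f_3}L_3$ is $L_1\times L_2\times L_3$ with metric $\pi_1^*g_{1}+(f_2\circ\pi_1)^2\pi_2^*g_{2}+(f_3\circ\pi_1)^2\pi_3^*g_{3}$. Warping functions are non-constant. Here the base is $L_\nu$, so $\phi_1,\phi_2:L_\nu\to(0,\infty)$, and $L$ with this metric is isometrically immersed in $\tilde L$, the factors being identified with the corresponding leaves in $L$. Distributions: $\mathfrak{D}$, $\mathfrak{D}^\perp$ are the distributions on $L$ tangent to $L_T$, $L_\perp$, and $\mathfrak{D}^\nu\oplus\langle\xi\rangle$ (orthogonal sum) is the one tangent to $L_\nu$, so that $TL=\mathfrak{D}\oplus\mathfrak{D}^\perp\oplus\mathfrak{D}^\nu\oplus\langle\xi\rangle$. Write $\Phi X=TX+FX$ for $X$ tangent to $L$, with $TX$ tangent and $FX$ normal to $L$. One has $\Phi\mathfrak{D}\subseteq\mathfrak{D}$, $\Phi\mathfrak{D}^\perp\subset T^\perp L$, and $T^\perp L=\Phi\mathfrak{D}^\perp\oplus F\mathfrak{D}^\nu\oplus\mu$ (orthogonal) with $\mu$ a $\Phi$-invariant normal subbundle. $L$ is $\mathfrak{D}^\perp$-$\mathfrak{D}^\nu$ mixed totally geodesic if $\Sigma(Z,U)=0$ for all $Z\in\mathfrak{D}^\perp$, $U\in\mathfrak{D}^\nu$; it is $\mathfrak{D}^\nu$-totally geodesic if $\Sigma(U,V)=0$ for all $U,V\in\mathfrak{D}^\nu$. $\vec\nabla(\ln\phi_i)$ is the gradient of $\ln\phi_i$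 on $L$, with $\|\vec\nabla f\|^2=\sum_i(e_i f)^2$. *)

theory Defs
  imports "HOL-Analysis.Analysis"
begin

section \<open>Smooth manifolds\<close>

text \<open>For functions on an open set, \<open>Ck_on k\<close> says that all iterated directional derivatives
  of order at most \<open>k\<close> exist and are continuous.\<close>

primrec Ck_on :: "nat \<Rightarrow> 'a::euclidean_space set \<Rightarrow> ('a \<Rightarrow> 'b::real_normed_vector) \<Rightarrow> bool" where
  "Ck_on 0 S f \<longleftrightarrow> continuous_on S f"
| "Ck_on (Suc k) S f \<longleftrightarrow> (\<forall>x\<in>S. f differentiable (at x)) \<and>
     (\<forall>v. Ck_on k S (\<lambda>x. frechet_derivative f (at x) v))"

definition smooth_on :: "'a::euclidean_space set \<Rightarrow> ('a \<Rightarrow> 'b::real_normed_vector) \<Rightarrow> bool" where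
  "smooth_on S f \<longleftrightarrow> open S \<and> (\<forall>k. Ck_on k S f)"

text \<open>A manifold is given by an atlas indexed by its own points: \<open>chart M p\<close>, with domain
  \<open>cdom M p\<close>, is a chart around \<open>p\<close>. Every smooth structure has such an atlas, by choosing one
  chart around each point. The tangent space at \<open>p\<close> is the model space \<open>'e\<close>: a tangent vector at
  \<open>p\<close> is written by its components in the chart \<open>chart M p\<close>, and passing to the components in
  another chart is \<open>coord_change\<close>. The dimension is \<open>DIM('e)\<close>.\<close>

record ('m, 'e) manifold =
  cdom :: "'m \<Rightarrow> 'm set"
  chart :: "'m \<Rightarrow> 'm \<Rightarrow> 'e"

definition chart_inv :: "('m, 'e) manifold \<Rightarrow> 'm \<Rightarrow> 'e \<Rightarrow> 'm" where
  "chart_inv M p = inv_into (cdom M p) (chart M p)"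

definition smooth_manifold ::
  "('m::{t2_space, second_countable_topology}, 'e::euclidean_space) manifold \<Rightarrow> bool" where
  "smooth_manifold M \<longleftrightarrow>
    (\<forall>p. open (cdom M p) \<and> p \<in> cdom M p \<and> open (chart M p ` cdom M p) \<and>
         homeomorphism (cdom M p) (chart M p ` cdom M p) (chart M p) (chart_inv M p)) \<and>
    (\<forall>p q. smooth_on (chart M p ` (cdom M p \<inter> cdom M q)) (chart M q \<circ> chart_inv M p))"

definition prod_manifold ::
  "('m, 'e) manifold \<Rightarrow> ('n, 'f) manifold \<Rightarrow> ('m \<times> 'n, 'e \<times> 'f) manifold" where
  "prod_manifold M N =
    \<lparr>cdom = (\<lambda>(a, b). cdom M a \<times> cdom N b),
     chart = (\<lambda>(a, b). map_prod (chart M a) (chart N b))\<rparr>"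

definition smooth_map :: "('n::topological_space, 'f::euclidean_space) manifold \<Rightarrow>
    ('m::topological_space, 'e::euclidean_space) manifold \<Rightarrow> ('n \<Rightarrow> 'm) \<Rightarrow> bool" where
  "smooth_map N M f \<longleftrightarrow> continuous_on UNIV f \<and>
    (\<forall>p q. smooth_on (chart N p ` (cdom N p \<inter> f -` cdom M q)) (chart M q \<circ> f \<circ> chart_inv N p))"

definition smooth_function :: "('m, 'e::euclidean_space) manifold \<Rightarrow> ('m \<Rightarrow> real) \<Rightarrow> bool" where
  "smooth_function M f \<longleftrightarrow> (\<forall>p. smooth_on (chart M p ` cdom M p) (f \<circ> chart_inv M p))"

definition dmap :: "('n, 'f::euclidean_space) manifold \<Rightarrow> ('m, 'e::euclidean_space) manifold \<Rightarrow>
    ('n \<Rightarrow> 'm) \<Rightarrow> 'n \<Rightarrow> 'f \<Rightarrow> 'e" where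
  "dmap N M f x =
    frechet_derivative (chart M (f x) \<circ> f \<circ> chart_inv N x) (at (chart N x x))"

definition dfun :: "('m, 'e::euclidean_space) manifold \<Rightarrow> ('m \<Rightarrow> real) \<Rightarrow> 'm \<Rightarrow> 'e \<Rightarrow> real" where
  "dfun M f x = frechet_derivative (f \<circ> chart_inv M x) (at (chart M x x))"

text \<open>\<open>coord_change M p p' q\<close> turns the components at \<open>q\<close> in the chart of \<open>p\<close> into those in the
  chart of \<open>p'\<close>. So \<open>coord_change M q p q\<close> gives the components in the chart of \<open>p\<close> of a tangent
  vector at \<open>q\<close>, and \<open>coord_change M p q q\<close> is its inverse.\<close>

definition coord_change ::
  "('m, 'e::euclidean_space) manifold \<Rightarrow> 'm \<Rightarrow> 'm \<Rightarrow> 'm \<Rightarrow> 'e \<Rightarrow> 'e" where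
  "coord_change M p p' q =
    frechet_derivative (chart M p' \<circ> chart_inv M p) (at (chart M p q))"


section \<open>Tensor fields in charts\<close>

text \<open>Coordinate expressions in the chart of \<open>p\<close> of a vector field, a 1-form, a (1,1)-tensor and a
  (0,2)-tensor.\<close>

definition vf_rep :: "('m, 'e::euclidean_space) manifold \<Rightarrow> 'm \<Rightarrow> ('m \<Rightarrow> 'e) \<Rightarrow> 'e \<Rightarrow> 'e" where
  "vf_rep M p X y = (let q = chart_inv M p y in coord_change M q p q (X q))"

definition form_rep ::
  "('m, 'e::euclidean_space) manifold \<Rightarrow> 'm \<Rightarrow> ('m \<Rightarrow> 'e \<Rightarrow> real) \<Rightarrow> 'e \<Rightarrow> 'e \<Rightarrow> real" where
  "form_rep M p \<eta> v y = (let q = chart_inv M p y in \<eta> q (coord_change M p q q v))"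

definition endo_rep ::
  "('m, 'e::euclidean_space) manifold \<Rightarrow> 'm \<Rightarrow> ('m \<Rightarrow> 'e \<Rightarrow> 'e) \<Rightarrow> 'e \<Rightarrow> 'e \<Rightarrow> 'e" where
  "endo_rep M p \<Phi> v y =
    (let q = chart_inv M p y in coord_change M q p q (\<Phi> q (coord_change M p q q v)))"

definition metric_rep :: "('m, 'e::euclidean_space) manifold \<Rightarrow> 'm \<Rightarrow>
    ('m \<Rightarrow> 'e \<Rightarrow> 'e \<Rightarrow> real) \<Rightarrow> 'e \<Rightarrow> 'e \<Rightarrow> 'e \<Rightarrow> real" where
  "metric_rep M p g v w y =
    (let q = chart_inv M p y in g q (coord_change M p q q v) (coord_change M p q q w))"

definition smooth_vector_field :: "('m, 'e::euclidean_space) manifold \<Rightarrow> ('m \<Rightarrow> 'e) \<Rightarrow> bool" where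
  "smooth_vector_field M X \<longleftrightarrow> (\<forall>p. smooth_on (chart M p ` cdom M p) (vf_rep M p X))"

text \<open>\<open>X\<close> is a smooth vector field on some neighbourhood of \<open>p\<close>; its values elsewhere are
  irrelevant.\<close>

definition smooth_vf_near :: "('m, 'e::euclidean_space) manifold \<Rightarrow> 'm \<Rightarrow> ('m \<Rightarrow> 'e) \<Rightarrow> bool" where
  "smooth_vf_near M p X \<longleftrightarrow>
    (\<exists>S. chart M p p \<in> S \<and> S \<subseteq> chart M p ` cdom M p \<and> smooth_on S (vf_rep M p X))"

definition smooth_form :: "('m, 'e::euclidean_space) manifold \<Rightarrow> ('m \<Rightarrow> 'e \<Rightarrow> real) \<Rightarrow> bool" where
  "smooth_form M \<eta> \<longleftrightarrow> (\<forall>p. linear (\<eta> p)) \<and>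
    (\<forall>p v. smooth_on (chart M p ` cdom M p) (form_rep M p \<eta> v))"

definition smooth_endo :: "('m, 'e::euclidean_space) manifold \<Rightarrow> ('m \<Rightarrow> 'e \<Rightarrow> 'e) \<Rightarrow> bool" where
  "smooth_endo M \<Phi> \<longleftrightarrow> (\<forall>p. linear (\<Phi> p)) \<and>
    (\<forall>p v. smooth_on (chart M p ` cdom M p) (endo_rep M p \<Phi> v))"


section \<open>Riemannian metrics and the Levi-Civita connection\<close>

definition riemannian_metric ::
  "('m, 'e::euclidean_space) manifold \<Rightarrow> ('m \<Rightarrow> 'e \<Rightarrow> 'e \<Rightarrow> real) \<Rightarrow> bool" where
  "riemannian_metric M g \<longleftrightarrow>
    (\<forall>p. bilinear (g p) \<and> (\<forall>u v. g p u v = g p v u) \<and> (\<forall>u. u \<noteq> 0 \<longrightarrow> g p u u > 0)) \<and>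
    (\<forall>p v w. smooth_on (chart M p ` cdom M p) (metric_rep M p g v w))"

definition riemannian_manifold ::
  "('m::{t2_space, second_countable_topology}, 'e::euclidean_space) manifold \<Rightarrow>
    ('m \<Rightarrow> 'e \<Rightarrow> 'e \<Rightarrow> real) \<Rightarrow> bool" where
  "riemannian_manifold M g \<longleftrightarrow> smooth_manifold M \<and> riemannian_metric M g"

text \<open>An affine connection is \<open>D\<^sub>u Y + \<Gamma> u Y\<close> in a chart, with \<open>\<Gamma>\<close> bilinear at every point. It is
  torsion-free iff \<open>\<Gamma>\<close> is symmetric, and metric iff the last clause below holds. Thus
  \<open>christoffel M g p\<close> is the bilinear form of Christoffel symbols of the Levi-Civita connection at
  the point \<open>p\<close> in the chart of \<open>p\<close>.\<close>

definition christoffel :: "('m, 'e::euclidean_space) manifold \<Rightarrow> ('m \<Rightarrow> 'e \<Rightarrow> 'e \<Rightarrow> real) \<Rightarrow>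
    'm \<Rightarrow> 'e \<Rightarrow> 'e \<Rightarrow> 'e" where
  "christoffel M g p = (THE \<Gamma>. bilinear \<Gamma> \<and> (\<forall>u v. \<Gamma> u v = \<Gamma> v u) \<and>
    (\<forall>u v w. frechet_derivative (metric_rep M p g v w) (at (chart M p p)) u =
       g p (\<Gamma> u v) w + g p v (\<Gamma> u w)))"

text \<open>\<open>cov M g p u Y\<close> is the covariant derivative at \<open>p\<close> of \<open>Y\<close> in the direction \<open>u\<close>.\<close>

definition cov :: "('m, 'e::euclidean_space) manifold \<Rightarrow> ('m \<Rightarrow> 'e \<Rightarrow> 'e \<Rightarrow> real) \<Rightarrow>
    'm \<Rightarrow> 'e \<Rightarrow> ('m \<Rightarrow> 'e) \<Rightarrow> 'e" where
  "cov M g p u Y =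
    frechet_derivative (vf_rep M p Y) (at (chart M p p)) u + christoffel M g p u (Y p)"

text \<open>The Levi-Civita connection of the target acting on a vector field \<open>W\<close> along \<open>f\<close>, i.e. \<open>W q\<close>
  is a tangent vector at \<open>f q\<close>.\<close>

definition cov_along :: "('n, 'f::euclidean_space) manifold \<Rightarrow> ('m, 'e::euclidean_space) manifold \<Rightarrow>
    ('m \<Rightarrow> 'e \<Rightarrow> 'e \<Rightarrow> real) \<Rightarrow> ('n \<Rightarrow> 'm) \<Rightarrow> 'n \<Rightarrow> 'f \<Rightarrow> ('n \<Rightarrow> 'e) \<Rightarrow> 'e" where
  "cov_along N M g f x u W =
    frechet_derivative
      (\<lambda>y. let q = chart_inv N x y in coord_change M (f q) (f x) (f q) (W q)) (at (chart N x x)) u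
    + christoffel M g (f x) (dmap N M f x u) (W x)"

definition orthonormal_basis :: "('e::euclidean_space \<Rightarrow> 'e \<Rightarrow> real) \<Rightarrow> 'e set \<Rightarrow> bool" where
  "orthonormal_basis h B \<longleftrightarrow> finite B \<and> span B = UNIV \<and>
    (\<forall>u\<in>B. \<forall>v\<in>B. h u v = (if u = v then 1 else 0))"

definition some_onb :: "('e::euclidean_space \<Rightarrow> 'e \<Rightarrow> real) \<Rightarrow> 'e set" where
  "some_onb h = (SOME B. orthonormal_basis h B)"

definition grad_norm_sq :: "('m, 'e::euclidean_space) manifold \<Rightarrow> ('m \<Rightarrow> 'e \<Rightarrow> 'e \<Rightarrow> real) \<Rightarrow>
    ('m \<Rightarrow> real) \<Rightarrow> 'm \<Rightarrow> real" where
  "grad_norm_sq M g f x = (\<Sum>e\<in>some_onb (g x). (dfun M f x e)\<^sup>2)"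


section \<open>Immersed submanifolds\<close>

definition pullback_metric ::
  "('n, 'f::euclidean_space) manifold \<Rightarrow> ('m, 'e::euclidean_space) manifold \<Rightarrow>
    ('m \<Rightarrow> 'e \<Rightarrow> 'e \<Rightarrow> real) \<Rightarrow> ('n \<Rightarrow> 'm) \<Rightarrow> 'n \<Rightarrow> 'f \<Rightarrow> 'f \<Rightarrow> real" where
  "pullback_metric N M g f x u v = g (f x) (dmap N M f x u) (dmap N M f x v)"

definition isometric_immersion ::
  "('n::topological_space, 'f::euclidean_space) manifold \<Rightarrow> ('n \<Rightarrow> 'f \<Rightarrow> 'f \<Rightarrow> real) \<Rightarrow>
    ('m::topological_space, 'e::euclidean_space) manifold \<Rightarrow> ('m \<Rightarrow> 'e \<Rightarrow> 'e \<Rightarrow> real) \<Rightarrow>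
    ('n \<Rightarrow> 'm) \<Rightarrow> bool" where
  "isometric_immersion N h M g f \<longleftrightarrow> smooth_map N M f \<and>
    (\<forall>x. inj (dmap N M f x)) \<and> pullback_metric N M g f = h"

text \<open>Gauss formula: the second fundamental form of the immersion \<open>f\<close>, evaluated on tangent vectors
  \<open>u\<close>, \<open>v\<close> of \<open>N\<close> at \<open>x\<close>, is \<open>\<nabla>\<^sup>M\<^sub>u V - \<nabla>\<^sup>N\<^sub>u V\<close> for every local field \<open>V\<close> extending \<open>v\<close>, where
  \<open>\<nabla>\<^sup>N\<close> belongs to the induced metric.\<close>

definition second_ff :: "('n, 'f::euclidean_space) manifold \<Rightarrow> ('m, 'e::euclidean_space) manifold \<Rightarrow>
    ('m \<Rightarrow> 'e \<Rightarrow> 'e \<Rightarrow> real) \<Rightarrow> ('n \<Rightarrow> 'm) \<Rightarrow> 'n \<Rightarrow> 'f \<Rightarrow> 'f \<Rightarrow> 'e" where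
  "second_ff N M g f x u v =
    (THE s. \<forall>V. smooth_vf_near N x V \<and> V x = v \<longrightarrow>
       s = cov_along N M g f x u (\<lambda>q. dmap N M f q (V q))
           - dmap N M f x (cov N (pullback_metric N M g f) x u V))"

definition second_ff_norm_sq ::
  "('n, 'f::euclidean_space) manifold \<Rightarrow> ('m, 'e::euclidean_space) manifold \<Rightarrow>
    ('m \<Rightarrow> 'e \<Rightarrow> 'e \<Rightarrow> real) \<Rightarrow> ('n \<Rightarrow> 'm) \<Rightarrow> 'n \<Rightarrow> real" where
  "second_ff_norm_sq N M g f x =
    (\<Sum>u\<in>some_onb (pullback_metric N M g f x). \<Sum>v\<in>some_onb (pullback_metric N M g f x).
       g (f x) (second_ff N M g f x u v) (second_ff N M g f x u v))"

definition mean_curvature ::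
  "('n, 'f::euclidean_space) manifold \<Rightarrow> ('m, 'e::euclidean_space) manifold \<Rightarrow>
    ('m \<Rightarrow> 'e \<Rightarrow> 'e \<Rightarrow> real) \<Rightarrow> ('n \<Rightarrow> 'm) \<Rightarrow> 'n \<Rightarrow> 'e" where
  "mean_curvature N M g f x =
    (1 / real DIM('f)) *\<^sub>R (\<Sum>e\<in>some_onb (pullback_metric N M g f x). second_ff N M g f x e e)"

definition totally_geodesic ::
  "('n, 'f::euclidean_space) manifold \<Rightarrow> ('m, 'e::euclidean_space) manifold \<Rightarrow>
    ('m \<Rightarrow> 'e \<Rightarrow> 'e \<Rightarrow> real) \<Rightarrow> ('n \<Rightarrow> 'm) \<Rightarrow> bool" where
  "totally_geodesic N M g f \<longleftrightarrow> (\<forall>x u v. second_ff N M g f x u v = 0)"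

definition totally_umbilical ::
  "('n, 'f::euclidean_space) manifold \<Rightarrow> ('m, 'e::euclidean_space) manifold \<Rightarrow>
    ('m \<Rightarrow> 'e \<Rightarrow> 'e \<Rightarrow> real) \<Rightarrow> ('n \<Rightarrow> 'm) \<Rightarrow> bool" where
  "totally_umbilical N M g f \<longleftrightarrow>
    (\<forall>x u v. second_ff N M g f x u v =
       pullback_metric N M g f x u v *\<^sub>R mean_curvature N M g f x)"


section \<open>Locally conformal almost cosymplectic manifolds and slant submanifolds\<close>

definition almost_contact_metric ::
  "('m::{t2_space, second_countable_topology}, 'e::euclidean_space) manifold \<Rightarrow>
    ('m \<Rightarrow> 'e \<Rightarrow> 'e) \<Rightarrow> ('m \<Rightarrow> 'e) \<Rightarrow> ('m \<Rightarrow> 'e \<Rightarrow> real) \<Rightarrow> ('m \<Rightarrow> 'e \<Rightarrow> 'e \<Rightarrow> real) \<Rightarrow> bool" where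
  "almost_contact_metric M \<Phi> \<xi> \<eta> g \<longleftrightarrow>
    riemannian_manifold M g \<and> (\<exists>m. DIM('e) = 2 * m + 1) \<and>
    smooth_endo M \<Phi> \<and> smooth_vector_field M \<xi> \<and> smooth_form M \<eta> \<and>
    (\<forall>p X. \<Phi> p (\<Phi> p X) = - X + \<eta> p X *\<^sub>R \<xi> p) \<and>
    (\<forall>p. \<eta> p (\<xi> p) = 1) \<and>
    (\<forall>p. \<Phi> p (\<xi> p) = 0) \<and>
    (\<forall>p X. \<eta> p (\<Phi> p X) = 0) \<and>
    (\<forall>p X Y. g p (\<Phi> p X) (\<Phi> p Y) = g p X Y - \<eta> p X * \<eta> p Y)"

text \<open>The identities are imposed for fields \<open>Y\<close> on open sets. The field \<open>X\<close> enters only through its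
  value \<open>u\<close> at \<open>p\<close>, and \<open>(\<nabla>\<^sub>u \<Phi>) Y = \<nabla>\<^sub>u (\<Phi> Y) - \<Phi> (\<nabla>\<^sub>u Y)\<close>.\<close>

definition locally_conformal_almost_cosymplectic ::
  "('m::{t2_space, second_countable_topology}, 'e::euclidean_space) manifold \<Rightarrow>
    ('m \<Rightarrow> 'e \<Rightarrow> 'e) \<Rightarrow> ('m \<Rightarrow> 'e) \<Rightarrow> ('m \<Rightarrow> 'e \<Rightarrow> real) \<Rightarrow> ('m \<Rightarrow> 'e \<Rightarrow> 'e \<Rightarrow> real) \<Rightarrow>
    ('m \<Rightarrow> real) \<Rightarrow> bool" where
  "locally_conformal_almost_cosymplectic M \<Phi> \<xi> \<eta> g \<beta> \<longleftrightarrow>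
    almost_contact_metric M \<Phi> \<xi> \<eta> g \<and> smooth_function M \<beta> \<and>
    (\<forall>p u Y. smooth_vf_near M p Y \<longrightarrow>
       cov M g p u (\<lambda>q. \<Phi> q (Y q)) - \<Phi> p (cov M g p u Y) =
       \<beta> p *\<^sub>R (g p (\<Phi> p u) (Y p) *\<^sub>R \<xi> p - \<eta> p (Y p) *\<^sub>R \<Phi> p u)) \<and>
    (\<forall>p u. cov M g p u \<xi> = \<beta> p *\<^sub>R (u - \<eta> p u *\<^sub>R \<xi> p))"

definition orth_proj :: "('e::euclidean_space \<Rightarrow> 'e \<Rightarrow> real) \<Rightarrow> 'e set \<Rightarrow> 'e \<Rightarrow> 'e" where
  "orth_proj h S w = (THE t. t \<in> S \<and> (\<forall>s\<in>S. h (w - t) s = 0))"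

text \<open>The cosine of the angle between \<open>w\<close> and \<open>S\<close> is the ratio of the length of the orthogonal
  projection of \<open>w\<close> to the length of \<open>w\<close>.\<close>

definition angle_to_subspace :: "('e::euclidean_space \<Rightarrow> 'e \<Rightarrow> real) \<Rightarrow> 'e \<Rightarrow> 'e set \<Rightarrow> real" where
  "angle_to_subspace h w S =
    arccos (sqrt (h (orth_proj h S w) (orth_proj h S w)) / sqrt (h w w))"

definition tangent_image :: "('n, 'f::euclidean_space) manifold \<Rightarrow>
    ('m, 'e::euclidean_space) manifold \<Rightarrow> ('n \<Rightarrow> 'm) \<Rightarrow> 'n \<Rightarrow> 'e set" where
  "tangent_image N M f x = range (dmap N M f x)"

definition slant_tangent :: "('n, 'f::euclidean_space) manifold \<Rightarrow>
    ('m, 'e::euclidean_space) manifold \<Rightarrow> ('m \<Rightarrow> 'e \<Rightarrow> 'e) \<Rightarrow> ('m \<Rightarrow> 'e) \<Rightarrow>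
    ('m \<Rightarrow> 'e \<Rightarrow> 'e \<Rightarrow> real) \<Rightarrow> ('n \<Rightarrow> 'm) \<Rightarrow> real \<Rightarrow> bool" where
  "slant_tangent N M \<Phi> \<xi> g f \<nu> \<longleftrightarrow> 0 \<le> \<nu> \<and> \<nu> \<le> pi / 2 \<and>
    (\<forall>x. \<xi> (f x) \<in> tangent_image N M f x \<and>
      (\<forall>X\<in>tangent_image N M f x. X \<notin> span {\<xi> (f x)} \<longrightarrow>
         angle_to_subspace (g (f x)) (\<Phi> (f x) X) (tangent_image N M f x) = \<nu>))"

definition slant_orthogonal :: "('n, 'f::euclidean_space) manifold \<Rightarrow>
    ('m, 'e::euclidean_space) manifold \<Rightarrow> ('m \<Rightarrow> 'e \<Rightarrow> 'e) \<Rightarrow> ('m \<Rightarrow> 'e) \<Rightarrow>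
    ('m \<Rightarrow> 'e \<Rightarrow> 'e \<Rightarrow> real) \<Rightarrow> ('n \<Rightarrow> 'm) \<Rightarrow> real \<Rightarrow> bool" where
  "slant_orthogonal N M \<Phi> \<xi> g f \<nu> \<longleftrightarrow> 0 \<le> \<nu> \<and> \<nu> \<le> pi / 2 \<and>
    (\<forall>x. \<forall>X\<in>tangent_image N M f x. g (f x) X (\<xi> (f x)) = 0 \<and>
      (X \<noteq> 0 \<longrightarrow>
         angle_to_subspace (g (f x)) (\<Phi> (f x) X) (tangent_image N M f x) = \<nu>))"

definition proper_slant_tangent :: "('n, 'f::euclidean_space) manifold \<Rightarrow>
    ('m, 'e::euclidean_space) manifold \<Rightarrow> ('m \<Rightarrow> 'e \<Rightarrow> 'e) \<Rightarrow> ('m \<Rightarrow> 'e) \<Rightarrow>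
    ('m \<Rightarrow> 'e \<Rightarrow> 'e \<Rightarrow> real) \<Rightarrow> ('n \<Rightarrow> 'm) \<Rightarrow> real \<Rightarrow> bool" where
  "proper_slant_tangent N M \<Phi> \<xi> g f \<nu> \<longleftrightarrow>
    slant_tangent N M \<Phi> \<xi> g f \<nu> \<and> 0 < \<nu> \<and> \<nu> < pi / 2"

definition invariant_orthogonal :: "('n, 'f::euclidean_space) manifold \<Rightarrow>
    ('m, 'e::euclidean_space) manifold \<Rightarrow> ('m \<Rightarrow> 'e \<Rightarrow> 'e) \<Rightarrow> ('m \<Rightarrow> 'e) \<Rightarrow>
    ('m \<Rightarrow> 'e \<Rightarrow> 'e \<Rightarrow> real) \<Rightarrow> ('n \<Rightarrow> 'm) \<Rightarrow> bool" where
  "invariant_orthogonal N M \<Phi> \<xi> g f \<longleftrightarrow> slant_orthogonal N M \<Phi> \<xi> g f 0"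

definition anti_invariant_orthogonal :: "('n, 'f::euclidean_space) manifold \<Rightarrow>
    ('m, 'e::euclidean_space) manifold \<Rightarrow> ('m \<Rightarrow> 'e \<Rightarrow> 'e) \<Rightarrow> ('m \<Rightarrow> 'e) \<Rightarrow>
    ('m \<Rightarrow> 'e \<Rightarrow> 'e \<Rightarrow> real) \<Rightarrow> ('n \<Rightarrow> 'm) \<Rightarrow> bool" where
  "anti_invariant_orthogonal N M \<Phi> \<xi> g f \<longleftrightarrow> slant_orthogonal N M \<Phi> \<xi> g f (pi / 2)"


section \<open>Bi-warped product submanifolds\<close>

abbreviation prod_manifold3 :: "('a, 'e1) manifold \<Rightarrow> ('b, 'e2) manifold \<Rightarrow> ('c, 'e3) manifold \<Rightarrow>
    ('a \<times> 'b \<times> 'c, 'e1 \<times> 'e2 \<times> 'e3) manifold" where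
  "prod_manifold3 L1 L2 L3 \<equiv> prod_manifold L1 (prod_manifold L2 L3)"

definition biwarped_metric :: "('a \<Rightarrow> 'e1 \<Rightarrow> 'e1 \<Rightarrow> real) \<Rightarrow> ('b \<Rightarrow> 'e2 \<Rightarrow> 'e2 \<Rightarrow> real) \<Rightarrow>
    ('c \<Rightarrow> 'e3 \<Rightarrow> 'e3 \<Rightarrow> real) \<Rightarrow> ('a \<Rightarrow> real) \<Rightarrow> ('a \<Rightarrow> real) \<Rightarrow>
    'a \<times> 'b \<times> 'c \<Rightarrow> 'e1 \<times> 'e2 \<times> 'e3 \<Rightarrow> 'e1 \<times> 'e2 \<times> 'e3 \<Rightarrow> real" where
  "biwarped_metric g1 g2 g3 f2 f3 = (\<lambda>(a, b, c) (u1, u2, u3) (v1, v2, v3).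
     g1 a u1 v1 + (f2 a)\<^sup>2 * g2 b u2 v2 + (f3 a)\<^sup>2 * g3 c u3 v3)"

definition warping_function ::
  "('a, 'e::euclidean_space) manifold \<Rightarrow> ('a \<Rightarrow> real) \<Rightarrow> bool" where
  "warping_function N f \<longleftrightarrow>
    smooth_function N f \<and> (\<forall>a. f a > 0) \<and> \<not> f constant_on UNIV"

definition biwarped_product_submanifold ::
  "('a::{t2_space, second_countable_topology}, 'e1::euclidean_space) manifold \<Rightarrow>
    ('a \<Rightarrow> 'e1 \<Rightarrow> 'e1 \<Rightarrow> real) \<Rightarrow>
    ('b::{t2_space, second_countable_topology}, 'e2::euclidean_space) manifold \<Rightarrow>
    ('b \<Rightarrow> 'e2 \<Rightarrow> 'e2 \<Rightarrow> real) \<Rightarrow>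
    ('c::{t2_space, second_countable_topology}, 'e3::euclidean_space) manifold \<Rightarrow>
    ('c \<Rightarrow> 'e3 \<Rightarrow> 'e3 \<Rightarrow> real) \<Rightarrow>
    ('a \<Rightarrow> real) \<Rightarrow> ('a \<Rightarrow> real) \<Rightarrow>
    ('m::{t2_space, second_countable_topology}, 'e::euclidean_space) manifold \<Rightarrow>
    ('m \<Rightarrow> 'e \<Rightarrow> 'e \<Rightarrow> real) \<Rightarrow> ('a \<times> 'b \<times> 'c \<Rightarrow> 'm) \<Rightarrow> bool" where
  "biwarped_product_submanifold L1 g1 L2 g2 L3 g3 f2 f3 M g \<psi> \<longleftrightarrow>
    riemannian_manifold L1 g1 \<and> riemannian_manifold L2 g2 \<and> riemannian_manifold L3 g3 \<and>
    warping_function L1 f2 \<and> warping_function L1 f3 \<and>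
    isometric_immersion (prod_manifold3 L1 L2 L3) (biwarped_metric g1 g2 g3 f2 f3) M g \<psi>"

definition leaf1 :: "('a \<times> 'b \<times> 'c \<Rightarrow> 'm) \<Rightarrow> 'b \<Rightarrow> 'c \<Rightarrow> 'a \<Rightarrow> 'm" where
  "leaf1 \<psi> b c = (\<lambda>a. \<psi> (a, b, c))"

definition leaf2 :: "('a \<times> 'b \<times> 'c \<Rightarrow> 'm) \<Rightarrow> 'a \<Rightarrow> 'c \<Rightarrow> 'b \<Rightarrow> 'm" where
  "leaf2 \<psi> a c = (\<lambda>b. \<psi> (a, b, c))"

definition leaf3 :: "('a \<times> 'b \<times> 'c \<Rightarrow> 'm) \<Rightarrow> 'a \<Rightarrow> 'b \<Rightarrow> 'c \<Rightarrow> 'm" where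
  "leaf3 \<psi> a b = (\<lambda>c. \<psi> (a, b, c))"

text \<open>Product charts split a tangent vector of the product as a triple, so the tangent distribution
  of the third factor is the same subset of the model space at every point. \<open>D_slant\<close> is the
  orthogonal complement of \<open>\<xi>\<close> in the tangent distribution of the first factor.\<close>

definition D_perp :: "('e1::real_vector \<times> 'e2::real_vector \<times> 'e3::real_vector) set" where
  "D_perp = {0} \<times> {0} \<times> UNIV"

definition D_slant :: "('n, 'e1::euclidean_space \<times> 'e2::euclidean_space \<times> 'e3::euclidean_space)
    manifold \<Rightarrow> ('m, 'e::euclidean_space) manifold \<Rightarrow> ('m \<Rightarrow> 'e) \<Rightarrow>
    ('m \<Rightarrow> 'e \<Rightarrow> 'e \<Rightarrow> real) \<Rightarrow> ('n \<Rightarrow> 'm) \<Rightarrow> 'n \<Rightarrow> ('e1 \<times> 'e2 \<times> 'e3) set" where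
  "D_slant N M \<xi> g \<psi> x =
    {U \<in> UNIV \<times> {0} \<times> {0}. g (\<psi> x) (dmap N M \<psi> x U) (\<xi> (\<psi> x)) = 0}"

definition normal_space_at :: "('n, 'f::euclidean_space) manifold \<Rightarrow>
    ('m, 'e::euclidean_space) manifold \<Rightarrow> ('m \<Rightarrow> 'e \<Rightarrow> 'e \<Rightarrow> real) \<Rightarrow> ('n \<Rightarrow> 'm) \<Rightarrow>
    'n \<Rightarrow> 'e set" where
  "normal_space_at N M g f x = {w. \<forall>t\<in>tangent_image N M f x. g (f x) w t = 0}"

end

theory Submission
  imports Defs
begin

text \<open>Let \<open>X\<close>, \<open>Y\<close> be tangent to the invariant factor, \<open>Z\<close>, \<open>W\<close> to the anti-invariant one, and \<open>U\<close>
  to the slant factor, orthogonal to \<open>\<xi>\<close>. Differentiating \<open>g(\<Phi> Y, U) = 0\<close> in the direction \<open>X\<close>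
  expresses \<open>g(\<nabla>\<^sub>X Y, \<Phi> U)\<close>, which is symmetric in \<open>X\<close>, \<open>Y\<close>, as \<open>U(ln \<phi>1) g(X, \<Phi> Y)\<close>, which is
  skew. Hence \<open>grad (ln \<phi>1) = \<beta> \<xi>\<close>, and the first summand of the bound vanishes. Differentiating
  \<open>g(\<Phi> W, U) = 0\<close> in the direction \<open>Z\<close> and using mixed total geodesy gives
  \<open>g(\<Sigma>(Z, W), F U) = g(Z, W) (T U)(ln \<phi>2)\<close>. Since \<open>|T U| = cos \<nu> |U|\<close>, this identifies the
  component of \<open>\<Sigma>(Z, W)\<close> along one normal vector \<open>n\<close> as \<open>g(Z, W) n\<close>, where
  \<open>|n|\<^sup>2 = cot\<^sup>2 \<nu> (|grad (ln \<phi>2)|\<^sup>2 - \<beta>\<^sup>2)\<close>. Summing over an orthonormal basis proves the bound,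
  and equality forces \<open>\<Sigma>(Z, W) = g(Z, W) n\<close> and all other components of \<open>\<Sigma>\<close> to vanish. All
  derivatives are computed at the centre of a chart from the Koszul formula.\<close>

section \<open>Inner products on a Euclidean space\<close>

text \<open>The orthogonality relations are differentiated along coordinate fields of product
  charts. Such a field stays tangent to its factor, so the relations hold on a whole chart without
  extending U orthogonally to \<xi>. The tangential part of a derivative is read off from the warped
  metric; the normal part is reached only through \<Phi>.

  The constant csc^2 \<nu> - 1 = cot^2 \<nu> arises as follows. Let G be the component of grad (ln
  \<phi>2) orthogonal to \<xi>. As T is skew, (T U)(ln \<phi>2) = - g(T G, U), so F T G is the only
  direction among the vectors F U in which \<Sigma>(Z, W) has a component. Now |F T G|^2 = sin^2
  \<nu> cos^2 \<nu> |G|^2 and g(\<Sigma>(Z, W), F T G) = - g(Z, W) cos^2 \<nu> |G|^2, so the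
  projection to this direction has squared length g(Z, W)^2 cot^2 \<nu> |G|^2. A single vector thus
  replaces a frame of the slant part of the normal bundle.\<close>

locale inner_form =
  fixes h :: "'e::euclidean_space \<Rightarrow> 'e \<Rightarrow> real"
  assumes bilin: "bilinear h"
    and sym: "h u v = h v u"
    and pos: "u \<noteq> 0 \<Longrightarrow> h u u > 0"
begin

lemma linear_left: "linear (\<lambda>u. h u w)" and linear_right: "linear (h w)"
  using bilin by (auto simp: bilinear_def eta_contract_eq)

lemmas add_left = bilinear_ladd[OF bilin] and add_right = bilinear_radd[OF bilin]
  and diff_left = bilinear_lsub[OF bilin] and diff_right = bilinear_rsub[OF bilin]
  and minus_left = bilinear_lneg[OF bilin] and minus_right = bilinear_rneg[OF bilin]
  and scale_left = bilinear_lmul[OF bilin] and scale_right = bilinear_rmul[OF bilin]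
  and zero_left = bilinear_lzero[OF bilin] and zero_right = bilinear_rzero[OF bilin]

lemmas expand = add_left add_right diff_left diff_right minus_left minus_right
  scale_left scale_right zero_left zero_right

lemma nonneg: "h u u \<ge> 0"
  using pos[of u] by (cases "u = 0") (auto simp: zero_left)

lemma eq_zero_iff: "h u u = 0 \<longleftrightarrow> u = 0"
  using pos[of u] by (cases "u = 0") (auto simp: zero_left)

lemma eqI:
  assumes "\<And>w. h u w = h v w"
  shows "u = v"
  using assms[of "u - v"] eq_zero_iff[of "u - v"] by (simp add: expand)

text \<open>In the inner product \<open>\<bullet>\<close> the functional \<open>h n\<close> is
  represented by \<open>?A n\<close>. Definiteness of \<open>h\<close> makes \<open>?A\<close>
  injective, hence surjective in finite dimension. Gradients and Christoffel symbols are produced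
  this way.\<close>

lemma riesz:
  assumes "linear l"
  obtains n where "\<And>w. h n w = l w"
proof -
  let ?A = "\<lambda>n. \<Sum>b\<in>Basis. h n b *\<^sub>R b"
  interpret l: linear l by fact
  have lin: "linear ?A"
    by (rule linearI) (simp_all add: expand scaleR_add_left sum.distrib scaleR_sum_right)
  have repr: "?A n \<bullet> w = h n w" for n w
  proof -
    interpret r: linear "h n" by (rule linear_right)
    have "h n w = h n (\<Sum>b\<in>Basis. (w \<bullet> b) *\<^sub>R b)" by (simp add: euclidean_representation)
    also have "\<dots> = (\<Sum>b\<in>Basis. (w \<bullet> b) * h n b)" by (simp add: r.sum r.scaleR)
    finally show ?thesis by (simp add: inner_sum_left inner_commute[of w] mult.commute)
  qed
  have "inj ?A"
  proof (rule injI)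
    fix x y assume "?A x = ?A y"
    then have "h x w = h y w" for w using repr by metis
    then show "x = y" by (rule eqI)
  qed
  with lin have "surj ?A" by (rule linear_inj_imp_surj)
  obtain n where n: "?A n = (\<Sum>b\<in>Basis. l b *\<^sub>R b)" 
    using surjD[OF \<open>surj ?A\<close>, of "\<Sum>b\<in>Basis. l b *\<^sub>R b"] by auto
  have "h n w = l w" for w
  proof -
    have "l w = l (\<Sum>b\<in>Basis. (w \<bullet> b) *\<^sub>R b)" by (simp add: euclidean_representation)
    also have "\<dots> = (\<Sum>b\<in>Basis. (w \<bullet> b) * l b)" by (simp add: l.sum l.scaleR)
    also have "\<dots> = (\<Sum>b\<in>Basis. l b *\<^sub>R b) \<bullet> w"
      by (simp add: inner_sum_left inner_commute[of w] mult.commute)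
    finally show ?thesis using repr[of n w] n by simp
  qed
  then show ?thesis by (rule that)
qed

section \<open>Orthonormal bases and traces\<close>

lemma orthonormal_independent:
  assumes "finite B" "\<And>u v. u \<in> B \<Longrightarrow> v \<in> B \<Longrightarrow> h u v = (if u = v then 1 else 0)"
  shows "independent B"
proof (rule independent_if_scalars_zero[OF assms(1)])
  fix f x assume *: "(\<Sum>b\<in>B. f b *\<^sub>R b) = 0" "x \<in> B"
  interpret l: linear "\<lambda>u. h u x" by (rule linear_left)
  have "0 = h (\<Sum>b\<in>B. f b *\<^sub>R b) x" using * by (simp add: zero_left)
  also have "\<dots> = (\<Sum>b\<in>B. if b = x then f b else 0)"
    unfolding l.sum l.scaleR using assms(2)[OF _ \<open>x \<in> B\<close>] by (intro sum.cong) auto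
  also have "\<dots> = f x" using * assms(1) by simp
  finally show "f x = 0" by simp
qed

text \<open>An orthonormal set of maximal cardinality spans: otherwise the normalised Gram-Schmidt
  residual of a missed vector enlarges it. Independence bounds the cardinalities.\<close>

lemma ex_orthonormal_basis: "\<exists>B. orthonormal_basis h B"
proof -
  let ?P = "\<lambda>B. finite B \<and> (\<forall>u\<in>B. \<forall>v\<in>B. h u v = (if u = v then 1 else 0))"
  have "?P {}" by simp
  moreover have "\<forall>B. ?P B \<longrightarrow> card B < Suc DIM('e)"
  proof (intro allI impI)
    fix B assume "?P B"
    then have "independent B" by (intro orthonormal_independent) auto
    then show "card B < Suc DIM('e)" using independent_bound[of B] by simp
  qed
  ultimately have "\<exists>B. ?P B \<and> (\<forall>C. ?P C \<longrightarrow> card C \<le> card B)"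
    by (rule Lattices_Big.ex_has_greatest_nat)
  then obtain B where B: "?P B" and max: "\<And>C. ?P C \<Longrightarrow> card C \<le> card B" by blast
  have "span B = UNIV"
  proof (rule ccontr)
    assume "span B \<noteq> UNIV"
    then obtain w where w: "w \<notin> span B" by auto
    define p where "p = (\<Sum>b\<in>B. h w b *\<^sub>R b)"
    have "p \<in> span B" unfolding p_def by (intro span_sum span_scale span_base)
    then have "w - p \<noteq> 0" using w by auto
    then have pos': "h (w - p) (w - p) > 0" by (rule pos)
    define e where "e = (1 / sqrt (h (w - p) (w - p))) *\<^sub>R (w - p)"
    have "h (w - p) b = 0" if "b \<in> B" for b
    proof -
      interpret l: linear "\<lambda>u. h u b" by (rule linear_left)
      have "h p b = (\<Sum>c\<in>B. if c = b then h w c else 0)"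
        unfolding p_def l.sum l.scaleR using B that by (intro sum.cong) auto
      also have "\<dots> = h w b" using B that by simp
      finally show ?thesis by (simp add: diff_left)
    qed
    then have eb: "h e b = 0" "h b e = 0" if "b \<in> B" for b
      using that sym[of b e] by (simp_all add: e_def expand)
    have ee: "h e e = 1"
      unfolding e_def scale_left scale_right using pos' by simp
    have "e \<notin> B" using eb(1)[of e] ee by auto
    moreover have "?P (insert e B)" using B eb ee by auto
    ultimately show False using max[of "insert e B"] B by simp
  qed
  with B show ?thesis unfolding orthonormal_basis_def by blast
qed

lemma some_onb: "orthonormal_basis h (some_onb h)"
  unfolding some_onb_def using ex_orthonormal_basis by (rule someI_ex)

lemma onb_card:
  assumes "orthonormal_basis h B"
  shows "card B = DIM('e)"
  using assms orthonormal_independent[of B] dim_eq_card[of B UNIV]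
  unfolding orthonormal_basis_def by auto

lemma onb_expand:
  assumes "orthonormal_basis h B"
  shows "(\<Sum>b\<in>B. h u b *\<^sub>R b) = u"
proof -
  have B: "finite B" "span B = UNIV" "\<And>u v. u \<in> B \<Longrightarrow> v \<in> B \<Longrightarrow> h u v = (if u = v then 1 else 0)"
    using assms unfolding orthonormal_basis_def by auto
  let ?r = "u - (\<Sum>b\<in>B. h u b *\<^sub>R b)"
  have r0: "h ?r c = 0" if "c \<in> B" for c
  proof -
    interpret l: linear "\<lambda>u. h u c" by (rule linear_left)
    have "h (\<Sum>b\<in>B. h u b *\<^sub>R b) c = (\<Sum>b\<in>B. if b = c then h u b else 0)"
      unfolding l.sum l.scaleR using B that by (intro sum.cong) auto
    also have "\<dots> = h u c" using B that by simp
    finally show ?thesis by (simp add: diff_left)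
  qed
  have "h ?r w = 0" if "w \<in> span B" for w
    using that
  proof (induction rule: span_induct_alt)
    case base show ?case by (simp add: zero_right)
  next
    case (step c x y) then show ?case using r0[of x] by (simp add: add_right scale_right)
  qed
  then have "h ?r ?r = 0" using B by simp
  then show ?thesis using eq_zero_iff[of ?r] by simp
qed

lemma onb_parseval:
  assumes "orthonormal_basis h B"
  shows "(\<Sum>b\<in>B. h u b * h v b) = h u v"
proof -
  interpret l: linear "\<lambda>u. h u v" by (rule linear_left)
  have "h u v = h (\<Sum>b\<in>B. h u b *\<^sub>R b) v" using onb_expand[OF assms] by simp
  also have "\<dots> = (\<Sum>b\<in>B. h u b * h v b)" unfolding l.sum l.scaleR by (simp add: sym)
  finally show ?thesis by simp
qed

text \<open>Norms are defined with the arbitrary basis \<open>some_onb\<close> but evaluated in a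
  basis adapted to the factors. Parseval for \<open>B\<close> makes the trace independent of the
  choice.\<close>

lemma onb_trace_unique:
  assumes B: "orthonormal_basis h B" and C: "orthonormal_basis h C" and T: "bilinear T"
  shows "(\<Sum>b\<in>B. T b b :: real) = (\<Sum>c\<in>C. T c c)"
proof -
  have fin: "finite B" "finite C" using B C unfolding orthonormal_basis_def by auto
  have T_expand: "T u v = (\<Sum>c\<in>C. \<Sum>d\<in>C. h u c * h v d * T c d)" for u v
  proof -
    have "T u v = T (\<Sum>c\<in>C. h u c *\<^sub>R c) (\<Sum>d\<in>C. h v d *\<^sub>R d)"
      using onb_expand[OF C] by simp
    also have "\<dots> = (\<Sum>c\<in>C. \<Sum>d\<in>C. h u c * h v d * T c d)"
      unfolding bilinear_sum[OF T] bilinear_lmul[OF T] bilinear_rmul[OF T]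
      by (simp add: sum.cartesian_product mult.assoc mult.left_commute)
    finally show ?thesis .
  qed
  have "(\<Sum>b\<in>B. T b b) = (\<Sum>b\<in>B. \<Sum>c\<in>C. \<Sum>d\<in>C. h b c * h b d * T c d)"
    by (intro sum.cong refl T_expand)
  also have "\<dots> = (\<Sum>c\<in>C. \<Sum>d\<in>C. \<Sum>b\<in>B. h b c * h b d * T c d)"
    unfolding sum.swap[where A = B] ..
  also have "\<dots> = (\<Sum>c\<in>C. \<Sum>d\<in>C. h c d * T c d)"
  proof (intro sum.cong refl)
    fix c d
    show "(\<Sum>b\<in>B. h b c * h b d * T c d) = h c d * T c d"
      using onb_parseval[OF B, of c d] unfolding sum_distrib_right[symmetric] by (simp add: sym)
  qed
  also have "\<dots> = (\<Sum>c\<in>C. \<Sum>d\<in>C. if c = d then T c d else 0)"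
    using C unfolding orthonormal_basis_def by (intro sum.cong refl) auto
  also have "\<dots> = (\<Sum>c\<in>C. T c c)" using fin by simp
  finally show ?thesis .
qed

end

text \<open>The double sum is a trace in each of its two slots, so the bases are exchanged one slot
  at a time.\<close>

lemma onb_norm_sq_unique:
  assumes "inner_form h" "bilinear g" "bilinear S"
    and B: "orthonormal_basis h B" and C: "orthonormal_basis h C"
  shows "(\<Sum>u\<in>B. \<Sum>v\<in>B. g (S u v) (S u v) :: real) = (\<Sum>u\<in>C. \<Sum>v\<in>C. g (S u v) (S u v))"
proof -
  interpret inner_form h by fact
  have "bilinear (\<lambda>v v'. g (S u v) (S u v'))" for u
    using assms(2,3) by (simp add: bilinear_def linear_iff)
  then have "(\<Sum>u\<in>B. \<Sum>v\<in>B. g (S u v) (S u v)) = (\<Sum>u\<in>B. \<Sum>v\<in>C. g (S u v) (S u v))"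
    by (intro sum.cong refl onb_trace_unique[OF B C])
  also have "bilinear (\<lambda>u u'. \<Sum>v\<in>C. g (S u v) (S u' v))"
    using assms(2,3) by (simp add: bilinear_def linear_iff sum.distrib sum_distrib_left)
  then have "(\<Sum>u\<in>B. \<Sum>v\<in>C. g (S u v) (S u v)) = (\<Sum>u\<in>C. \<Sum>v\<in>C. g (S u v) (S u v))"
    by (rule onb_trace_unique[OF B C])
  finally show ?thesis .
qed

section \<open>Differential calculus in coordinates\<close>

text \<open>At a point of the open set \<open>S\<close> a derivative sees only values in
  \<open>S\<close>, so agreement on \<open>S\<close> passes to derivatives of every order.\<close>

lemma Ck_on_cong:
  assumes "open S" "Ck_on k S f" "\<And>x. x \<in> S \<Longrightarrow> f x = g x"
  shows "Ck_on k S g"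
  using assms(2,3)
proof (induction k arbitrary: f g)
  case 0
  then show ?case using continuous_on_cong[of S S f g] by auto
next
  case (Suc k)
  have fd: "(g has_derivative frechet_derivative f (at x)) (at x)" if "x \<in> S" for x
    using Suc.prems that assms(1)
    by (intro has_derivative_transform_within_open[of f _ x UNIV S g])
      (auto simp flip: frechet_derivative_works)
  have eq: "frechet_derivative f (at x) v = frechet_derivative g (at x) v" if "x \<in> S" for x v
    using frechet_derivative_at[OF fd[OF that]] by simp
  have "Ck_on k S (\<lambda>x. frechet_derivative g (at x) v)" for v
    by (rule Suc.IH[of "\<lambda>x. frechet_derivative f (at x) v"]) (use Suc.prems(1) eq in auto)
  moreover have "g differentiable (at x)" if "x \<in> S" for x
    using fd[OF that] by (auto simp: differentiable_def)
  ultimately show ?case by simp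
qed

text \<open>The inner derivative is the constant \<open>A\<close>, so a directional derivative of
  the composite is a derivative of \<open>f\<close> composed with the same affine map. The induction
  closes without a higher-order chain rule.\<close>

lemma Ck_on_compose_affine:
  fixes f :: "'a::euclidean_space \<Rightarrow> 'b::real_normed_vector" and A :: "'c::euclidean_space \<Rightarrow> 'a"
  assumes "open T" "linear A" "\<And>y. y \<in> T \<Longrightarrow> A y + c \<in> S" "Ck_on k S f"
  shows "Ck_on k T (\<lambda>y. f (A y + c))"
  using assms(4)
proof (induction k arbitrary: f)
  case 0
  have "continuous_on T (\<lambda>y. A y + c)"
    using assms(2) by (intro continuous_intros linear_continuous_on)
      (simp add: linear_conv_bounded_linear)
  then show ?case using 0 assms(3) by (auto intro: continuous_on_compose2[of S f])
next
  case (Suc k)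
  have D: "((\<lambda>y. f (A y + c)) has_derivative (\<lambda>v. frechet_derivative f (at (A y + c)) (A v))) (at y)"
    if "y \<in> T" for y
  proof -
    have "((\<lambda>y. A y + c) has_derivative A) (at y)"
      using assms(2) by (auto intro!: derivative_eq_intros bounded_linear_imp_has_derivative
          simp: linear_conv_bounded_linear)
    moreover have "(f has_derivative frechet_derivative f (at (A y + c))) (at (A y + c))"
      using Suc.prems assms(3)[OF that] frechet_derivative_works by auto
    ultimately show ?thesis by (rule has_derivative_compose)
  qed
  have "Ck_on k T (\<lambda>y. frechet_derivative (\<lambda>y. f (A y + c)) (at y) v)" for v
  proof (rule Ck_on_cong[OF assms(1)])
    show "Ck_on k T (\<lambda>y. frechet_derivative f (at (A y + c)) (A v))"
      using Suc.IH[of "\<lambda>x. frechet_derivative f (at x) (A v)"] Suc.prems by simp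
  qed (use frechet_derivative_at[OF D] in metis)
  then show ?case using D by (auto simp: differentiable_def)
qed

section \<open>Symmetry of second derivatives\<close>

lemma second_difference_mvt:
  fixes f :: "'a::real_normed_vector \<Rightarrow> real"
  assumes "r > 0"
    and in_S: "\<And>s t. 0 \<le> s \<Longrightarrow> s \<le> r \<Longrightarrow> 0 \<le> t \<Longrightarrow> t \<le> r \<Longrightarrow> x + s *\<^sub>R u + t *\<^sub>R v \<in> S"
    and f: "\<And>y. y \<in> S \<Longrightarrow> f differentiable (at y)"
    and fu: "\<And>y. y \<in> S \<Longrightarrow> (\<lambda>z. frechet_derivative f (at z) u) differentiable (at y)"
  obtains s t where "0 < s" "s < r" "0 < t" "t < r"
    "f (x + r *\<^sub>R u + r *\<^sub>R v) - f (x + r *\<^sub>R u) - f (x + r *\<^sub>R v) + f x =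
      r * r * frechet_derivative (\<lambda>z. frechet_derivative f (at z) u)
        (at (x + s *\<^sub>R u + t *\<^sub>R v)) v"
proof -
  have along: "((\<lambda>s. k (z + s *\<^sub>R w)) has_real_derivative
      frechet_derivative k (at (z + s *\<^sub>R w)) w) (at s)"
    if "k differentiable (at (z + s *\<^sub>R w))" for k :: "'a \<Rightarrow> real" and z w s
  proof -
    have k: "(k has_derivative frechet_derivative k (at (z + s *\<^sub>R w))) (at (z + s *\<^sub>R w))"
      using that frechet_derivative_works by blast
    have l: "((\<lambda>s. z + s *\<^sub>R w) has_derivative (\<lambda>h. h *\<^sub>R w)) (at s)"
      by (auto intro!: derivative_eq_intros)
    have "(\<lambda>h. frechet_derivative k (at (z + s *\<^sub>R w)) (h *\<^sub>R w)) =
        (*) (frechet_derivative k (at (z + s *\<^sub>R w)) w)"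
      using linear.scaleR[OF has_derivative_linear[OF k]] by auto
    with has_derivative_compose[of "\<lambda>s. z + s *\<^sub>R w" _ s UNIV k, OF l k] show ?thesis
      by (simp add: has_field_derivative_def)
  qed
  let ?fu = "\<lambda>z. frechet_derivative f (at z) u"
  let ?a = "\<lambda>s. f (x + r *\<^sub>R v + s *\<^sub>R u) - f (x + s *\<^sub>R u)"
  have 1: "x + r *\<^sub>R v + s *\<^sub>R u \<in> S" "x + s *\<^sub>R u \<in> S" if "0 \<le> s" "s \<le> r" for s
    using in_S[of s r] in_S[of s 0] that \<open>r > 0\<close> by (auto simp: algebra_simps)
  \<comment> \<open>The mean value theorem in direction \<open>u\<close>, for the difference of
    \<open>f\<close> along two parallel segments offset by \<open>r\<close> times \<open>v\<close>;
    a second application in direction \<open>v\<close> acts on the resulting difference of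
    \<open>?fu\<close>.\<close>
  have "(?a has_real_derivative (?fu (x + r *\<^sub>R v + s *\<^sub>R u) - ?fu (x + s *\<^sub>R u))) (at s)"
    if "0 \<le> s" "s \<le> r" for s
    using 1[OF that] f by (intro DERIV_diff along) auto
  from MVT2[OF \<open>r > 0\<close> this] obtain s where s: "0 < s" "s < r"
    "?a r - ?a 0 = r * (?fu (x + r *\<^sub>R v + s *\<^sub>R u) - ?fu (x + s *\<^sub>R u))"
    by auto
  let ?b = "\<lambda>t. ?fu (x + s *\<^sub>R u + t *\<^sub>R v)"
  have "(?b has_real_derivative frechet_derivative ?fu (at (x + s *\<^sub>R u + t *\<^sub>R v)) v) (at t)"
    if "0 \<le> t" "t \<le> r" for t
    using in_S[of s t] s that fu by (intro along) auto
  from MVT2[OF \<open>r > 0\<close> this] obtain t where t: "0 < t" "t < r"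
    "?b r - ?b 0 = r * frechet_derivative ?fu (at (x + s *\<^sub>R u + t *\<^sub>R v)) v"
    by auto
  show ?thesis
    by (rule that[OF s(1,2) t(1,2)]) (use s(3) t(3) in \<open>simp add: algebra_simps\<close>)
qed

text \<open>The second difference over a small parallelogram is its squared scale times a mixed
  derivative at a nearby point, in either order of \<open>u\<close> and \<open>v\<close>. By
  continuity both mixed derivatives approach their values at \<open>x\<close>.\<close>

lemma second_derivative_symmetric_real:
  fixes f :: "'a::euclidean_space \<Rightarrow> real"
  assumes "open S" "x \<in> S" "Ck_on 2 S f"
  shows "frechet_derivative (\<lambda>z. frechet_derivative f (at z) u) (at x) v =
    frechet_derivative (\<lambda>z. frechet_derivative f (at z) v) (at x) u"
proof -
  let ?P = "\<lambda>u v x. frechet_derivative (\<lambda>z. frechet_derivative f (at z) u) (at x) v"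
  have f: "\<And>y. y \<in> S \<Longrightarrow> f differentiable (at y)"
    "\<And>y w. y \<in> S \<Longrightarrow> (\<lambda>z. frechet_derivative f (at z) w) differentiable (at y)"
    and cont: "\<And>u v. continuous_on S (?P u v)"
    using assms(3) by (auto simp: numeral_2_eq_2)
  have "dist (?P u v x) (?P v u x) < e" if "e > 0" for e
  proof -
    have "\<forall>\<^sub>F y in nhds x. y \<in> S \<and> dist (?P u v y) (?P u v x) < e / 2 \<and>
        dist (?P v u y) (?P v u x) < e / 2"
    proof (intro eventually_conj)
      have "(?P a b \<longlongrightarrow> ?P a b x) (nhds x)" for a b
        using cont assms(1,2) continuous_on_eq_continuous_at[of S] isCont_def tendsto_at_iff_tendsto_nhds
        by metis
      then show "\<forall>\<^sub>F y in nhds x. dist (?P u v y) (?P u v x) < e / 2"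
        "\<forall>\<^sub>F y in nhds x. dist (?P v u y) (?P v u x) < e / 2"
        using tendstoD half_gt_zero[OF that] by blast+
      show "\<forall>\<^sub>F y in nhds x. y \<in> S" using assms(1,2) by (rule eventually_nhds_in_open)
    qed
    then obtain d where "d > 0" and d: "\<And>y. dist y x < d \<Longrightarrow> y \<in> S"
      "\<And>y. dist y x < d \<Longrightarrow> dist (?P u v y) (?P u v x) < e / 2"
      "\<And>y. dist y x < d \<Longrightarrow> dist (?P v u y) (?P v u x) < e / 2"
      unfolding eventually_nhds_metric by blast
    \<comment> \<open>The factor 2 keeps the parallelogram strictly inside the ball of radius
      \<open>d\<close>; the 1 keeps the denominator positive when \<open>u\<close> and
      \<open>v\<close> vanish.\<close>
    define r where "r = d / (2 * (norm u + norm v + 1))"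
    have N: "norm u + norm v + 1 > 0" by (smt (verit) norm_ge_zero)
    then have "r > 0" using \<open>d > 0\<close> by (simp add: r_def)
    have near: "dist (x + s *\<^sub>R a + t *\<^sub>R b) x < d"
      if "0 \<le> s" "s \<le> r" "0 \<le> t" "t \<le> r" "norm a + norm b = norm u + norm v" for s t a b
    proof -
      have "dist (x + s *\<^sub>R a + t *\<^sub>R b) x = norm (s *\<^sub>R a + t *\<^sub>R b)"
        by (simp add: dist_norm add.assoc)
      also have "\<dots> \<le> norm (s *\<^sub>R a) + norm (t *\<^sub>R b)" by (rule norm_triangle_ineq)
      also have "\<dots> = s * norm a + t * norm b" using that by simp
      also have "\<dots> \<le> r * norm a + r * norm b"
        using that by (intro add_mono mult_right_mono) auto
      also have "\<dots> = r * (norm u + norm v)" using that(5) by (simp flip: distrib_left)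
      also have "\<dots> \<le> r * (norm u + norm v + 1)" using \<open>r > 0\<close> by (intro mult_left_mono) auto
      also have "\<dots> = d / 2" using N by (simp add: r_def field_simps)
      finally show ?thesis using \<open>d > 0\<close> by simp
    qed
    obtain s t where st: "0 < s" "s < r" "0 < t" "t < r"
      "f (x + r *\<^sub>R u + r *\<^sub>R v) - f (x + r *\<^sub>R u) - f (x + r *\<^sub>R v) + f x =
        r * r * ?P u v (x + s *\<^sub>R u + t *\<^sub>R v)"
      by (rule second_difference_mvt[OF \<open>r > 0\<close> _ f, where x = x and u = u and v = v])
        (use near d in auto)
    obtain s' t' where st': "0 < s'" "s' < r" "0 < t'" "t' < r"
      "f (x + r *\<^sub>R v + r *\<^sub>R u) - f (x + r *\<^sub>R v) - f (x + r *\<^sub>R u) + f x =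
        r * r * ?P v u (x + s' *\<^sub>R v + t' *\<^sub>R u)"
      by (rule second_difference_mvt[OF \<open>r > 0\<close> _ f, where x = x and u = v and v = u])
        (use near d in auto)
    have "r * r * ?P u v (x + s *\<^sub>R u + t *\<^sub>R v) = r * r * ?P v u (x + s' *\<^sub>R v + t' *\<^sub>R u)"
      using st(5) st'(5) unfolding add.assoc add.commute[of "r *\<^sub>R u"] by linarith
    then have eq: "?P u v (x + s *\<^sub>R u + t *\<^sub>R v) = ?P v u (x + s' *\<^sub>R v + t' *\<^sub>R u)"
      using \<open>r > 0\<close> by simp
    have "dist (?P u v (x + s *\<^sub>R u + t *\<^sub>R v)) (?P u v x) < e / 2"
      by (rule d(2), rule near) (use st in auto)
    moreover have "dist (?P v u (x + s' *\<^sub>R v + t' *\<^sub>R u)) (?P v u x) < e / 2"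
      by (rule d(3), rule near) (use st' in auto)
    ultimately show ?thesis using eq by (simp add: dist_real_def abs_if split: if_splits)
  qed
  then show ?thesis by (metis dist_eq_0_iff less_irrefl zero_less_dist_iff)
qed

lemma Ck_on_inner:
  assumes "open S" "Ck_on k S f"
  shows "Ck_on k S (\<lambda>x. f x \<bullet> b)"
  using assms(2)
proof (induction k arbitrary: f)
  case 0 then show ?case by (auto intro!: continuous_intros)
next
  case (Suc k)
  have D: "((\<lambda>x. f x \<bullet> b) has_derivative (\<lambda>v. frechet_derivative f (at x) v \<bullet> b)) (at x)"
    if "x \<in> S" for x
    using Suc.prems that frechet_derivative_works
    by (intro has_derivative_inner_left) auto
  have "Ck_on k S (\<lambda>x. frechet_derivative (\<lambda>x. f x \<bullet> b) (at x) v)" for v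
    by (rule Ck_on_cong[OF assms(1) Suc.IH[of "\<lambda>x. frechet_derivative f (at x) v"]])
      (use Suc.prems frechet_derivative_at[OF D] in \<open>auto dest!: fun_cong[where x = v]\<close>)
  then show ?case using D by (auto simp: differentiable_def)
qed

text \<open>The mean value argument concerns real functions, so symmetry is proved for each
  component against a basis vector.\<close>

lemma second_derivative_symmetric:
  fixes f :: "'a::euclidean_space \<Rightarrow> 'b::euclidean_space"
  assumes "open S" "x \<in> S" "Ck_on 2 S f"
  shows "frechet_derivative (\<lambda>z. frechet_derivative f (at z) u) (at x) v =
    frechet_derivative (\<lambda>z. frechet_derivative f (at z) v) (at x) u"
proof (rule euclidean_eqI)
  fix b :: 'b
  have f: "\<And>y. y \<in> S \<Longrightarrow> f differentiable (at y)"
    "\<And>w. (\<lambda>z. frechet_derivative f (at z) w) differentiable (at x)"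
    using assms by (auto simp: numeral_2_eq_2)
  have D: "((\<lambda>x. k x \<bullet> b) has_derivative (\<lambda>v. frechet_derivative k (at y) v \<bullet> b)) (at y)"
    if "k differentiable (at y)" for y and k :: "'a \<Rightarrow> 'b"
    using that frechet_derivative_works by (intro has_derivative_inner_left) auto
  have "frechet_derivative (\<lambda>z. frechet_derivative f (at z) w) (at x) w' \<bullet> b =
      frechet_derivative (\<lambda>z. frechet_derivative (\<lambda>z. f z \<bullet> b) (at z) w) (at x) w'" for w w'
  proof -
    have "((\<lambda>z. frechet_derivative (\<lambda>z. f z \<bullet> b) (at z) w) has_derivative
        (\<lambda>v. frechet_derivative (\<lambda>z. frechet_derivative f (at z) w) (at x) v \<bullet> b)) (at x)"
      by (rule has_derivative_transform_within_open[OF D[OF f(2)] assms(1,2)])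
        (simp flip: frechet_derivative_at[OF D[OF f(1)]])
    from frechet_derivative_at[OF this] show ?thesis by metis
  qed
  then show "frechet_derivative (\<lambda>z. frechet_derivative f (at z) u) (at x) v \<bullet> b =
    frechet_derivative (\<lambda>z. frechet_derivative f (at z) v) (at x) u \<bullet> b"
    using second_derivative_symmetric_real[OF assms(1,2) Ck_on_inner[OF assms(1,3)]] by simp
qed

text \<open>The partial derivatives of \<open>(z, v) \<mapsto> A z v\<close> determine its total derivative because \<open>A\<close> is
  linear in \<open>v\<close>.\<close>

lemma has_derivative_linear_family:
  fixes A :: "'z::real_normed_vector \<Rightarrow> 'v::euclidean_space \<Rightarrow> 'w::real_normed_vector"
    and y :: "'y::real_normed_vector"
  assumes F: "(F has_derivative F') (at y)" and V: "(V has_derivative V') (at y)"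
    and A: "\<And>v. ((\<lambda>z. A z v) has_derivative (\<lambda>u. A' u v)) (at (F y))"
    and lin: "\<forall>\<^sub>F z in nhds (F y). linear (A z)"
  shows "((\<lambda>t. A (F t) (V t)) has_derivative (\<lambda>u. A' (F' u) (V y) + A (F y) (V' u))) (at y)"
proof -
  have sum_repr: "A z v = (\<Sum>b\<in>Basis. (v \<bullet> b) *\<^sub>R A z b)" if "linear (A z)" for z v
  proof -
    interpret linear "A z" by fact
    have "A z v = A z (\<Sum>b\<in>Basis. (v \<bullet> b) *\<^sub>R b)" by (simp add: euclidean_representation)
    then show ?thesis by (simp add: sum scaleR)
  qed
  \<comment> \<open>Linearity of \<open>A'\<close> in its second argument follows from uniqueness of
    the derivative: near \<open>F y\<close> the vector \<open>A z v\<close> is a fixed combination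
    of the vectors \<open>A z b\<close>.\<close>
  have A'_repr: "A' u v = (\<Sum>b\<in>Basis. (v \<bullet> b) *\<^sub>R A' u b)" for u v
  proof -
    have "((\<lambda>z. \<Sum>b\<in>Basis. (v \<bullet> b) *\<^sub>R A z b) has_derivative
        (\<lambda>u. \<Sum>b\<in>Basis. (v \<bullet> b) *\<^sub>R A' u b)) (at (F y))"
      by (intro has_derivative_sum has_derivative_scaleR_right A)
    moreover have "((\<lambda>z. \<Sum>b\<in>Basis. (v \<bullet> b) *\<^sub>R A z b) has_derivative (\<lambda>u. A' u v)) (at (F y))"
    proof (rule has_derivative_transform_eventually[OF A])
      show "\<forall>\<^sub>F z in at (F y). A z v = (\<Sum>b\<in>Basis. (v \<bullet> b) *\<^sub>R A z b)"
        using lin unfolding eventually_at_filter by (rule eventually_mono) (blast intro: sum_repr)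
    qed (auto intro: sum_repr eventually_nhds_x_imp_x[OF lin])
    ultimately show ?thesis using has_derivative_unique[THEN fun_cong] by blast
  qed
  have F_lim: "filterlim F (nhds (F y)) (nhds y)"
    using has_derivative_continuous[OF F] by (simp add: continuous_within tendsto_at_iff_tendsto_nhds)
  have ev: "\<forall>\<^sub>F t in nhds y. (\<Sum>b\<in>Basis. (V t \<bullet> b) *\<^sub>R A (F t) b) = A (F t) (V t)"
    using filterlim_iff[THEN iffD1, OF F_lim, rule_format, OF lin]
    by (rule eventually_mono) (rule sum_repr[symmetric])
  have "((\<lambda>t. \<Sum>b\<in>Basis. (V t \<bullet> b) *\<^sub>R A (F t) b) has_derivative
      (\<lambda>u. \<Sum>b\<in>Basis. (V y \<bullet> b) *\<^sub>R A' (F' u) b + (V' u \<bullet> b) *\<^sub>R A (F y) b)) (at y)"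
    by (intro has_derivative_sum has_derivative_scaleR has_derivative_inner_left V
        has_derivative_compose[OF F A])
  then have "((\<lambda>t. A (F t) (V t)) has_derivative
      (\<lambda>u. \<Sum>b\<in>Basis. (V y \<bullet> b) *\<^sub>R A' (F' u) b + (V' u \<bullet> b) *\<^sub>R A (F y) b)) (at y)"
  proof (rule has_derivative_transform_eventually)
    show "\<forall>\<^sub>F t in at y. (\<Sum>b\<in>Basis. (V t \<bullet> b) *\<^sub>R A (F t) b) = A (F t) (V t)"
      using ev unfolding eventually_at_filter by (rule eventually_mono) simp
  qed (auto intro: eventually_nhds_x_imp_x[OF ev])
  moreover have "(\<lambda>u. \<Sum>b\<in>Basis. (V y \<bullet> b) *\<^sub>R A' (F' u) b + (V' u \<bullet> b) *\<^sub>R A (F y) b) =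
      (\<lambda>u. A' (F' u) (V y) + A (F y) (V' u))"
    unfolding sum.distrib A'_repr[of _ "V y", symmetric]
      sum_repr[OF eventually_nhds_x_imp_x[OF lin], symmetric] ..
  ultimately show ?thesis by simp
qed

section \<open>Charts and second fundamental forms\<close>

text \<open>The part of \<open>smooth_manifold\<close> used in charts: homeomorphic charts and once
  differentiable transitions, over any topological space. In this form it passes directly to
  products.\<close>

locale charted =
  fixes N :: "('n::topological_space, 'f::euclidean_space) manifold"
  assumes open_cdom: "open (cdom N p)"
    and centre: "p \<in> cdom N p"
    and open_image: "open (chart N p ` cdom N p)"
    and homeo: "homeomorphism (cdom N p) (chart N p ` cdom N p) (chart N p) (chart_inv N p)"
    and transition: "y \<in> chart N p ` (cdom N p \<inter> cdom N q) \<Longrightarrow>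
      (chart N q \<circ> chart_inv N p) differentiable (at y)"
begin

lemma inv_chart: "q \<in> cdom N p \<Longrightarrow> chart_inv N p (chart N p q) = q"
  using homeo unfolding homeomorphism_def by blast

lemma chart_inv_mem: "y \<in> chart N p ` cdom N p \<Longrightarrow> chart_inv N p y \<in> cdom N p"
  using inv_chart by auto

lemma chart_inv: "y \<in> chart N p ` cdom N p \<Longrightarrow> chart N p (chart_inv N p y) = y"
  using inv_chart by auto

lemma open_chart_image:
  assumes "open U"
  shows "open (chart N p ` (cdom N p \<inter> U))"
proof -
  have "chart N p ` (cdom N p \<inter> U) = chart N p ` cdom N p \<inter> chart_inv N p -` U"
    using inv_chart by auto
  then show ?thesis
    using homeo continuous_open_preimage[OF _ open_image assms] unfolding homeomorphism_def by simp
qed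

lemma coord_change_has_derivative:
  assumes "q \<in> cdom N p" "q \<in> cdom N p'"
  shows "(chart N p' \<circ> chart_inv N p has_derivative coord_change N p p' q) (at (chart N p q))"
  unfolding coord_change_def using transition[of "chart N p q" p p'] assms
  by (auto simp flip: frechet_derivative_works)

lemma linear_coord_change:
  "q \<in> cdom N p \<Longrightarrow> q \<in> cdom N p' \<Longrightarrow> linear (coord_change N p p' q)"
  using coord_change_has_derivative has_derivative_linear by blast

text \<open>The chain rule for transition maps. The composite agrees with the direct transition on
  the overlap with the middle chart, which is open.\<close>

lemma coord_change_comp:
  assumes "q \<in> cdom N p" "q \<in> cdom N p'" "q \<in> cdom N p''"
  shows "coord_change N p' p'' q (coord_change N p p' q v) = coord_change N p p'' q v"
proof -
  have "((\<lambda>y. (chart N p'' \<circ> chart_inv N p') ((chart N p' \<circ> chart_inv N p) y)) has_derivative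
      (\<lambda>v. coord_change N p' p'' q (coord_change N p p' q v))) (at (chart N p q))"
    by (rule has_derivative_compose[OF coord_change_has_derivative[OF assms(1,2)]])
      (use coord_change_has_derivative[OF assms(2,3)] assms(1) in \<open>simp add: inv_chart o_def\<close>)
  then have "(chart N p'' \<circ> chart_inv N p has_derivative
      (\<lambda>v. coord_change N p' p'' q (coord_change N p p' q v))) (at (chart N p q))"
    by (rule has_derivative_transform_within_open[OF _ open_chart_image[OF open_cdom[of p']]])
      (use assms inv_chart in auto)
  then show ?thesis
    using coord_change_has_derivative[OF assms(1,3)] has_derivative_unique[THEN fun_cong] by blast
qed

lemma coord_change_same:
  assumes "q \<in> cdom N p"
  shows "coord_change N p p q v = v"
proof -
  have "(chart N p \<circ> chart_inv N p has_derivative (\<lambda>v. v)) (at (chart N p q))"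
    by (rule has_derivative_transform_within_open[OF has_derivative_ident open_image])
      (use assms inv_chart in auto)
  then show ?thesis
    using coord_change_has_derivative[OF assms assms] has_derivative_unique[THEN fun_cong] by blast
qed

text \<open>The field \<open>\<lambda>q. coord_change N x q q v\<close> is the coordinate field with
  constant components \<open>v\<close> in the chart of \<open>x\<close>; it is the standard test
  field below.\<close>

lemma vf_rep_const:
  assumes "y \<in> chart N x ` cdom N x"
  shows "vf_rep N x (\<lambda>q. coord_change N x q q v) y = v"
  using chart_inv_mem[OF assms] coord_change_comp coord_change_same centre
  unfolding vf_rep_def Let_def by simp

lemma smooth_vf_near_const: "smooth_vf_near N x (\<lambda>q. coord_change N x q q v)"
proof -
  let ?S = "chart N x ` cdom N x"
  have const: "Ck_on k ?S (\<lambda>_. c)" for k and c :: 'f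
    by (induction k arbitrary: c) auto
  have "Ck_on k ?S (vf_rep N x (\<lambda>q. coord_change N x q q v))" for k
    by (rule Ck_on_cong[OF open_image const[of k v]]) (simp only: vf_rep_const)
  then have "smooth_on ?S (vf_rep N x (\<lambda>q. coord_change N x q q v))"
    unfolding smooth_on_def using open_image by simp
  moreover have "chart N x x \<in> ?S" using centre by simp
  ultimately show ?thesis unfolding smooth_vf_near_def by (intro exI[of _ ?S]) simp
qed

end

lemma charted_smooth_manifold: "smooth_manifold M \<Longrightarrow> charted M"
proof
  assume M: "smooth_manifold M"
  show "(chart M q \<circ> chart_inv M p) differentiable (at y)"
    if "y \<in> chart M p ` (cdom M p \<inter> cdom M q)" for y p q
  proof -
    have "Ck_on (Suc 0) (chart M p ` (cdom M p \<inter> cdom M q)) (chart M q \<circ> chart_inv M p)"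
      using M unfolding smooth_manifold_def smooth_on_def by blast
    then show ?thesis using that unfolding Ck_on.simps by blast
  qed
qed (auto simp: smooth_manifold_def)

section \<open>Products of charts\<close>

lemma chart_inv_prod:
  assumes "charted M" "charted N" "y \<in> chart M a ` cdom M a" "z \<in> chart N b ` cdom N b"
  shows "chart_inv (prod_manifold M N) (a, b) (y, z) = (chart_inv M a y, chart_inv N b z)"
proof -
  interpret M: charted M by fact
  interpret N: charted N by fact
  \<comment> \<open>\<open>chart_inv\<close> is an \<open>inv_into\<close>, so its value is pinned
    down by injectivity of the product chart on its domain.\<close>
  have "inj_on (map_prod (chart M a) (chart N b)) (cdom M a \<times> cdom N b)"
    by (intro map_prod_inj_on inj_onI) (metis M.inv_chart N.inv_chart)+
  moreover have "map_prod (chart M a) (chart N b) (chart_inv M a y, chart_inv N b z) = (y, z)"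
    using assms by (simp add: M.chart_inv N.chart_inv)
  moreover have "(chart_inv M a y, chart_inv N b z) \<in> cdom M a \<times> cdom N b"
    using assms by (simp add: M.chart_inv_mem N.chart_inv_mem)
  ultimately have "inv_into (cdom M a \<times> cdom N b) (map_prod (chart M a) (chart N b)) (y, z) =
      (chart_inv M a y, chart_inv N b z)"
    using inv_into_f_f[of "map_prod (chart M a) (chart N b)" "cdom M a \<times> cdom N b"
        "(chart_inv M a y, chart_inv N b z)"] by simp
  then show ?thesis by (simp add: chart_inv_def prod_manifold_def)
qed

lemma prod_transition_has_derivative:
  assumes "charted M" "charted N" "p \<in> cdom M a" "p \<in> cdom M a'" "q \<in> cdom N b" "q \<in> cdom N b'"
  shows "(chart (prod_manifold M N) (a', b') \<circ> chart_inv (prod_manifold M N) (a, b) has_derivative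
    (\<lambda>(v, w). (coord_change M a a' p v, coord_change N b b' q w))) (at (chart M a p, chart N b q))"
proof -
  interpret M: charted M by fact
  interpret N: charted N by fact
  have "((\<lambda>x. ((chart M a' \<circ> chart_inv M a) (fst x), (chart N b' \<circ> chart_inv N b) (snd x)))
      has_derivative (\<lambda>x. (coord_change M a a' p (fst x), coord_change N b b' q (snd x))))
      (at (chart M a p, chart N b q))"
    using assms
    by (intro has_derivative_Pair
        has_derivative_compose[OF has_derivative_fst[OF has_derivative_ident], of "chart M a' \<circ> chart_inv M a"]
        has_derivative_compose[OF has_derivative_snd[OF has_derivative_ident], of "chart N b' \<circ> chart_inv N b"])
      (auto intro: M.coord_change_has_derivative N.coord_change_has_derivative)
  then have "(chart (prod_manifold M N) (a', b') \<circ> chart_inv (prod_manifold M N) (a, b) has_derivative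
    (\<lambda>x. (coord_change M a a' p (fst x), coord_change N b b' q (snd x))))
      (at (chart M a p, chart N b q))"
  proof (rule has_derivative_transform_within_open)
    show "open (chart M a ` cdom M a \<times> chart N b ` cdom N b)"
      by (intro open_Times M.open_image N.open_image)
    fix x assume "x \<in> chart M a ` cdom M a \<times> chart N b ` cdom N b"
    then show "((chart M a' \<circ> chart_inv M a) (fst x), (chart N b' \<circ> chart_inv N b) (snd x)) =
        (chart (prod_manifold M N) (a', b') \<circ> chart_inv (prod_manifold M N) (a, b)) x"
      using chart_inv_prod[OF assms(1,2), of "fst x" a "snd x" b]
      by (simp add: prod_manifold_def mem_Times_iff)
  qed (use assms in auto)
  then show ?thesis by (simp add: case_prod_unfold)
qed

lemma coord_change_prod:
  assumes "charted M" "charted N" "p \<in> cdom M a" "p \<in> cdom M a'" "q \<in> cdom N b" "q \<in> cdom N b'"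
  shows "coord_change (prod_manifold M N) (a, b) (a', b') (p, q) (v, w) =
    (coord_change M a a' p v, coord_change N b b' q w)"
  unfolding coord_change_def[of "prod_manifold M N"]
  using frechet_derivative_at[OF prod_transition_has_derivative[OF assms]]
  by (simp add: prod_manifold_def) (metis (no_types, lifting) case_prod_conv)

lemma charted_prod:
  assumes "charted M" "charted N"
  shows "charted (prod_manifold M N)"
proof -
  interpret M: charted M by fact
  interpret N: charted N by fact
  let ?P = "prod_manifold M N"
  have cdom: "cdom ?P (a, b) = cdom M a \<times> cdom N b"
    and chart: "chart ?P (a, b) (c, d) = (chart M a c, chart N b d)" for a b c d
    by (simp_all add: prod_manifold_def)
  have image: "chart ?P (a, b) ` cdom ?P (a, b) = chart M a ` cdom M a \<times> chart N b ` cdom N b" for a b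
    by (auto simp: prod_manifold_def)
  show ?thesis
  proof (unfold_locales, goal_cases)
    case (1 p) then show ?case by (cases p) (simp add: cdom open_Times M.open_cdom N.open_cdom)
  next
    case (2 p) then show ?case by (cases p) (simp add: cdom M.centre N.centre)
  next
    case (3 p) then show ?case by (cases p) (simp add: image open_Times M.open_image N.open_image)
  next
    case (4 p)
    obtain a b where p: "p = (a, b)" by (cases p)
    have cM: "continuous_on (cdom M a) (chart M a)" "continuous_on (chart M a ` cdom M a) (chart_inv M a)"
      and cN: "continuous_on (cdom N b) (chart N b)" "continuous_on (chart N b ` cdom N b) (chart_inv N b)"
      using M.homeo N.homeo unfolding homeomorphism_def by auto
    show ?case unfolding p
    proof (rule homeomorphismI)
      have "continuous_on (cdom M a \<times> cdom N b) (\<lambda>x. (chart M a (fst x), chart N b (snd x)))"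
        by (intro continuous_on_Pair continuous_on_compose2[OF cM(1)] continuous_on_compose2[OF cN(1)]
            continuous_on_fst continuous_on_snd continuous_on_id) auto
      then show "continuous_on (cdom ?P (a, b)) (chart ?P (a, b))"
        by (simp add: prod_manifold_def map_prod_def case_prod_unfold)
      have "continuous_on (chart M a ` cdom M a \<times> chart N b ` cdom N b)
          (\<lambda>x. (chart_inv M a (fst x), chart_inv N b (snd x)))"
        by (intro continuous_on_Pair continuous_on_compose2[OF cM(2)] continuous_on_compose2[OF cN(2)]
            continuous_on_fst continuous_on_snd continuous_on_id) auto
      then show "continuous_on (chart ?P (a, b) ` cdom ?P (a, b)) (chart_inv ?P (a, b))"
        unfolding image
        by (rule continuous_on_cong[THEN iffD1, rotated 2]) (auto simp: chart_inv_prod[OF assms])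
    qed (auto simp: cdom chart chart_inv_prod[OF assms] M.inv_chart N.inv_chart)
  next
    case (5 y p q)
    obtain a b a' b' where pq: "p = (a, b)" "q = (a', b')" by (cases p, cases q)
    with 5 obtain c d where "c \<in> cdom M a" "c \<in> cdom M a'" "d \<in> cdom N b" "d \<in> cdom N b'"
      "y = (chart M a c, chart N b d)" by (auto simp: cdom chart)
    then show ?case
      using prod_transition_has_derivative[OF assms] unfolding pq differentiable_def by blast
  qed
qed

section \<open>Maps in local coordinates\<close>

locale charted_map = N: charted N + M: charted M
  for N :: "('n::topological_space, 'f::euclidean_space) manifold"
    and M :: "('m::topological_space, 'e::euclidean_space) manifold" +
  fixes f :: "'n \<Rightarrow> 'm"
  assumes cont: "continuous_on UNIV f"
    and C2: "Ck_on 2 (chart N x ` (cdom N x \<inter> f -` cdom M (f x)))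
      (chart M (f x) \<circ> f \<circ> chart_inv N x)"
begin

definition dom_at :: "'n \<Rightarrow> 'f set" where
  "dom_at x = chart N x ` (cdom N x \<inter> f -` cdom M (f x))"

definition rep :: "'n \<Rightarrow> 'f \<Rightarrow> 'e" where
  "rep x = chart M (f x) \<circ> f \<circ> chart_inv N x"

text \<open>Away from the centre the derivative is kept in the fixed charts of \<open>x\<close> and
  \<open>f x\<close>, whereas \<open>dmap\<close> uses the charts of the moving point. Only a fixed
  pair of charts permits a second derivative.\<close>

definition drep :: "'n \<Rightarrow> 'f \<Rightarrow> 'f \<Rightarrow> 'e" where
  "drep x y = frechet_derivative (rep x) (at y)"

definition hess :: "'n \<Rightarrow> 'f \<Rightarrow> 'f \<Rightarrow> 'e" where
  "hess x u v = frechet_derivative (\<lambda>y. drep x y v) (at (chart N x x)) u"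

abbreviation df :: "'n \<Rightarrow> 'f \<Rightarrow> 'e" where
  "df \<equiv> dmap N M f"

lemma open_vimage_f: "open U \<Longrightarrow> open (f -` U)"
  using cont by (simp add: continuous_on_open_vimage)

lemma open_dom_at: "open (dom_at x)"
  unfolding dom_at_def by (intro N.open_chart_image open_vimage_f M.open_cdom)

lemma centre_dom_at: "chart N x x \<in> dom_at x"
  unfolding dom_at_def using N.centre M.centre by auto

lemma dom_atD:
  assumes "y \<in> dom_at x"
  shows "chart_inv N x y \<in> cdom N x" "f (chart_inv N x y) \<in> cdom M (f x)"
    "chart N x (chart_inv N x y) = y" "rep x y = chart M (f x) (f (chart_inv N x y))"
  using assms N.inv_chart unfolding dom_at_def rep_def by auto

lemma rep_has_derivative: "y \<in> dom_at x \<Longrightarrow> (rep x has_derivative drep x y) (at y)"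
  using C2[of x] unfolding drep_def
  by (auto simp: numeral_2_eq_2 dom_at_def rep_def simp flip: frechet_derivative_works)

lemma linear_drep: "y \<in> dom_at x \<Longrightarrow> linear (drep x y)"
  using rep_has_derivative has_derivative_linear by blast

lemma drep_centre: "drep x (chart N x x) = df x"
  unfolding drep_def dmap_def rep_def ..

lemma linear_df: "linear (df x)"
  using linear_drep[OF centre_dom_at] drep_centre by metis

lemma rep_centre: "rep x (chart N x x) = chart M (f x) (f x)"
  using dom_atD(4)[OF centre_dom_at] by (simp add: N.inv_chart N.centre)

lemma rep_has_derivative_centre: "(rep x has_derivative df x) (at (chart N x x))"
  using rep_has_derivative[OF centre_dom_at] drep_centre by metis

lemma drep_has_derivative:
  "((\<lambda>y. drep x y v) has_derivative (\<lambda>u. hess x u v)) (at (chart N x x))"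
proof -
  have "(\<lambda>y. drep x y v) differentiable (at (chart N x x))"
    using C2[of x] centre_dom_at[of x]
    unfolding drep_def[abs_def] by (auto simp: numeral_2_eq_2 dom_at_def rep_def)
  then show ?thesis unfolding hess_def by (simp flip: frechet_derivative_works)
qed

lemma hess_sym: "hess x u v = hess x v u"
  unfolding hess_def drep_def
  using second_derivative_symmetric[OF open_dom_at centre_dom_at, of x "rep x"] C2[of x]
  unfolding dom_at_def rep_def by blast

lemma bilinear_hess: "bilinear (hess x)"
proof -
  have "linear (\<lambda>u. hess x u v)" for v
    using drep_has_derivative has_derivative_linear by blast
  moreover have "hess x u = (\<lambda>v. hess x v u)" for u by (rule ext) (rule hess_sym)
  ultimately show ?thesis unfolding bilinear_def by (metis (no_types, lifting))
qed

text \<open>The chain rule through the charts: pass to the chart of \<open>q\<close>, apply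
  \<open>df q\<close>, return to the chart of \<open>f x\<close>. Near \<open>y\<close> this
  composite is \<open>rep x\<close>.\<close>

lemma df_in_chart:
  assumes "y \<in> dom_at x"
  defines "q \<equiv> chart_inv N x y"
  shows "coord_change M (f q) (f x) (f q) (df q (coord_change N x q q v)) = drep x y v"
proof -
  note D = dom_atD[OF assms(1), folded q_def]
  have 1: "(chart N q \<circ> chart_inv N x has_derivative coord_change N x q q) (at y)"
    using N.coord_change_has_derivative[OF D(1) N.centre] D(3) by simp
  have 2: "(rep q has_derivative df q) (at ((chart N q \<circ> chart_inv N x) y))"
    using rep_has_derivative_centre by (simp flip: q_def)
  have 3: "(chart M (f x) \<circ> chart_inv M (f q) has_derivative coord_change M (f q) (f x) (f q))
      (at (rep q ((chart N q \<circ> chart_inv N x) y)))"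
    using M.coord_change_has_derivative[OF M.centre D(2)] by (simp add: rep_centre flip: q_def)
  have "((\<lambda>t. (chart M (f x) \<circ> chart_inv M (f q)) (rep q ((chart N q \<circ> chart_inv N x) t)))
      has_derivative (\<lambda>v. coord_change M (f q) (f x) (f q) (df q (coord_change N x q q v)))) (at y)"
    by (rule has_derivative_compose[OF has_derivative_compose[OF 1 2] 3])
  then have "(rep x has_derivative
      (\<lambda>v. coord_change M (f q) (f x) (f q) (df q (coord_change N x q q v)))) (at y)"
  proof (rule has_derivative_transform_within_open)
    let ?U = "chart N x ` (cdom N x \<inter> (cdom N q \<inter> f -` cdom M (f x) \<inter> f -` cdom M (f q)))"
    show "open ?U"
      by (intro N.open_chart_image open_Int N.open_cdom open_vimage_f M.open_cdom)
    show "y \<in> ?U"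
      using D N.centre M.centre by (intro image_eqI[of _ _ q]) auto
    show "\<And>t. t \<in> ?U \<Longrightarrow>
        (chart M (f x) \<circ> chart_inv M (f q)) (rep q ((chart N q \<circ> chart_inv N x) t)) = rep x t"
      unfolding rep_def by (auto simp: N.inv_chart M.inv_chart)
  qed
  then show ?thesis
    using rep_has_derivative[OF assms(1)] has_derivative_unique[THEN fun_cong] by blast
qed

lemma in_chart:
  assumes "y \<in> dom_at x"
  defines "q \<equiv> chart_inv N x y"
  shows "chart_inv M (f x) (rep x y) = f q" "f q \<in> cdom M (f x)" "q \<in> cdom N x"
    "coord_change M (f x) (f q) (f q) (drep x y v) = df q (coord_change N x q q v)"
proof -
  note D = dom_atD[OF assms(1), folded q_def]
  show "chart_inv M (f x) (rep x y) = f q" by (simp add: D M.inv_chart)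
  show "coord_change M (f x) (f q) (f q) (drep x y v) = df q (coord_change N x q q v)"
    unfolding df_in_chart[OF assms(1), folded q_def, symmetric]
    using D M.coord_change_comp M.coord_change_same M.centre by simp
qed (fact dom_atD[OF assms(1), folded q_def])+

text \<open>The derivative of the extension \<open>V\<close> contributes the same vector to both covariant
  derivatives, so only its value at \<open>x\<close> matters.\<close>

lemma second_ff_eq:
  "second_ff N M g f x u v = hess x u v + christoffel M g (f x) (df x u) (df x v)
    - df x (christoffel N (pullback_metric N M g f) x u v)" (is "_ = ?rhs")
proof -
  interpret d: linear "df x" by (rule linear_df)
  let ?z = "chart N x x"
  have eq: "cov_along N M g f x u (\<lambda>q. df q (V q)) - df x (cov N (pullback_metric N M g f) x u V)
      = ?rhs" if V: "smooth_vf_near N x V" "V x = v" for V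
  proof -
    obtain S where S: "?z \<in> S" "S \<subseteq> chart N x ` cdom N x" "smooth_on S (vf_rep N x V)"
      using V(1) unfolding smooth_vf_near_def by blast
    then have "open S" and "Ck_on (Suc 0) S (vf_rep N x V)" unfolding smooth_on_def by auto
    then have V': "(vf_rep N x V has_derivative frechet_derivative (vf_rep N x V) (at ?z)) (at ?z)"
      using S(1) by (auto simp flip: frechet_derivative_works)
    have Vx: "vf_rep N x V ?z = v"
      using V(2) unfolding vf_rep_def by (simp add: N.inv_chart N.centre N.coord_change_same)
    have "((\<lambda>y. drep x y (vf_rep N x V y)) has_derivative
        (\<lambda>u. hess x u (vf_rep N x V ?z) + drep x ?z (frechet_derivative (vf_rep N x V) (at ?z) u))) (at ?z)"
      using eventually_mono[OF eventually_nhds_in_open[OF open_dom_at centre_dom_at] linear_drep]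
      by (rule has_derivative_linear_family[OF has_derivative_ident V' drep_has_derivative])
    then have "((\<lambda>y. let q = chart_inv N x y in coord_change M (f q) (f x) (f q) (df q (V q)))
        has_derivative
        (\<lambda>u. hess x u (vf_rep N x V ?z) + drep x ?z (frechet_derivative (vf_rep N x V) (at ?z) u))) (at ?z)"
    proof (rule has_derivative_transform_within_open)
      show "open (S \<inter> dom_at x)" using \<open>open S\<close> open_dom_at by blast
      show "?z \<in> S \<inter> dom_at x" using S(1) centre_dom_at by blast
      fix y assume y: "y \<in> S \<inter> dom_at x"
      then have q: "chart_inv N x y \<in> cdom N x" by (auto dest: dom_atD)
      have "coord_change N x (chart_inv N x y) (chart_inv N x y) (vf_rep N x V y) = V (chart_inv N x y)"
        unfolding vf_rep_def Let_def
        using q N.coord_change_comp N.coord_change_same N.centre by simp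
      then show "drep x y (vf_rep N x V y) = (let q = chart_inv N x y in
          coord_change M (f q) (f x) (f q) (df q (V q)))"
        unfolding Let_def using df_in_chart[of y x "vf_rep N x V y"] y by simp
    qed
    from frechet_derivative_at[OF this, symmetric] show ?thesis
      unfolding cov_along_def cov_def by (simp add: Vx drep_centre d.add V(2))
  qed
  \<comment> \<open>One admissible extension of \<open>v\<close> has to exist; otherwise every
    \<open>s\<close> would meet the description.\<close>
  have ex: "smooth_vf_near N x (\<lambda>q. coord_change N x q q v)" "coord_change N x x x v = v"
    using N.smooth_vf_near_const N.coord_change_same N.centre by auto
  show ?thesis unfolding second_ff_def
  proof (rule the_equality)
    show "\<forall>V. smooth_vf_near N x V \<and> V x = v \<longrightarrow> ?rhs =
        cov_along N M g f x u (\<lambda>q. df q (V q)) - df x (cov N (pullback_metric N M g f) x u V)"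
      using eq by simp
    fix s assume "\<forall>V. smooth_vf_near N x V \<and> V x = v \<longrightarrow> s =
        cov_along N M g f x u (\<lambda>q. df q (V q)) - df x (cov N (pullback_metric N M g f) x u V)"
    then show "s = ?rhs" using eq[OF ex] ex by blast
  qed
qed

end

section \<open>The Koszul formula and the Levi-Civita connection at a point\<close>

lemma koszul_formula:
  assumes "\<And>u v w. S u v w = K u v w + K u w v" "\<And>u v w. K u v w = (K v u w :: real)"
  shows "K u v w = (S u v w + S v u w - S w u v) / 2"
  \<comment> \<open>\<open>S\<close> stands for the derivative of the metric and
    \<open>K u v w\<close> for the product of the derivative of \<open>v\<close> along
    \<open>u\<close> with \<open>w\<close>. In the signed sum of the three metric identities,
    symmetry cancels everything except \<open>2 * K u v w\<close>.\<close>
  using assms(1)[of u v w] assms(1)[of v u w] assms(1)[of w u v]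
    assms(2)[of u v w] assms(2)[of u w v] assms(2)[of v w u] by simp

text \<open>The pointwise fundamental theorem of Riemannian geometry. The Koszul expression is
  linear in \<open>w\<close>, so \<open>riesz\<close> turns it into a vector; uniqueness is the
  Koszul formula itself.\<close>

lemma (in inner_form) koszul_ex1:
  assumes lin: "\<And>v w. linear (\<lambda>u. S u v w)" "\<And>u w. linear (\<lambda>v. S u v w)"
    and sym_S: "\<And>u v w. S u v w = S u w v"
  shows "\<exists>!\<Gamma>. bilinear \<Gamma> \<and> (\<forall>u v. \<Gamma> u v = \<Gamma> v u) \<and>
    (\<forall>u v w. S u v w = h (\<Gamma> u v) w + h v (\<Gamma> u w))"
proof -
  define K where "K u v w = (S u v w + S v u w - S w u v) / 2" for u v w
  have lin3: "linear (\<lambda>w. S u v w)" for u v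
    using lin(2)[of u v] by (simp add: sym_S[of u v])
  note S_lin = lin[THEN linear_add] lin[THEN linear_cmul] lin3[THEN linear_add] lin3[THEN linear_cmul]
  have "linear (K u v)" for u v
    unfolding K_def by (rule linearI) (simp_all add: S_lin field_simps)
  then have "\<exists>n. \<forall>w. h n w = K u v w" for u v using riesz by metis
  then obtain \<Gamma> where \<Gamma>: "\<And>u v w. h (\<Gamma> u v) w = K u v w" by metis
  have "linear (\<lambda>u. \<Gamma> u v)" "linear (\<Gamma> u)" for u v
    by (rule linearI; rule eqI; simp add: expand \<Gamma>; simp add: K_def S_lin field_simps)+
  then have "bilinear \<Gamma>" unfolding bilinear_def by (simp add: eta_contract_eq)
  moreover have "\<Gamma> u v = \<Gamma> v u" for u v
    by (rule eqI) (simp add: \<Gamma> K_def sym_S[of _ u v])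
  moreover have "S u v w = h (\<Gamma> u v) w + h v (\<Gamma> u w)" for u v w
    unfolding sym[of v] by (simp add: \<Gamma> K_def sym_S[of u w v] sym_S[of v w u] sym_S[of w v u] field_simps)
  moreover have "\<Delta> = \<Gamma>" if "\<forall>u v. \<Delta> u v = \<Delta> v u"
    "\<forall>u v w. S u v w = h (\<Delta> u v) w + h v (\<Delta> u w)" for \<Delta>
  proof (intro ext eqI)
    fix u v w
    have "h (\<Delta> u v) w = (S u v w + S v u w - S w u v) / 2"
      by (rule koszul_formula[where K = "\<lambda>u v w. h (\<Delta> u v) w"]) (use that sym in auto)
    then show "h (\<Delta> u v) w = h (\<Gamma> u v) w" by (simp add: \<Gamma> K_def)
  qed
  ultimately show ?thesis by (intro ex1I[of _ \<Gamma>]) blast+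
qed

context charted
begin

lemma metric_rep_centre: "metric_rep N p g v w (chart N p p) = g p v w"
  unfolding metric_rep_def Let_def by (simp add: inv_chart centre coord_change_same)

lemma bilinear_metric_rep:
  assumes "\<And>p. bilinear (g p)" "y \<in> chart N p ` cdom N p"
  shows "bilinear (\<lambda>v w. metric_rep N p g v w y)"
  unfolding metric_rep_def Let_def bilinear_def
  using assms(1) linear_coord_change[OF chart_inv_mem[OF assms(2)] centre]
  by (auto simp: bilinear_def intro: linear_compose[unfolded o_def])

text \<open>Discharges the definite description in \<open>christoffel\<close>, for an arbitrary
  field of inner products, so that it serves both the ambient and the induced metric.\<close>

lemma christoffel:
  assumes g: "\<And>p. inner_form (g p)"
    and diff: "\<And>v w. metric_rep N p g v w differentiable (at (chart N p p))"
  shows "bilinear (christoffel N g p)" "christoffel N g p u v = christoffel N g p v u"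
    "frechet_derivative (metric_rep N p g v w) (at (chart N p p)) u =
      g p (christoffel N g p u v) w + g p v (christoffel N g p u w)"
proof -
  let ?z = "chart N p p"
  let ?S = "\<lambda>u v w. frechet_derivative (metric_rep N p g v w) (at ?z) u"
  have D: "(metric_rep N p g v w has_derivative (\<lambda>u. ?S u v w)) (at ?z)" for v w
    using diff frechet_derivative_works by blast
  have bil: "bilinear (\<lambda>v w. metric_rep N p g v w y)" if "y \<in> chart N p ` cdom N p" for y
    using bilinear_metric_rep[OF inner_form.bilin[OF g] that] .
  \<comment> \<open>Bilinearity of \<open>metric_rep\<close> is available over the chart image,
    where coordinate changes are linear; this open set suffices for derivatives at the
    centre.\<close>
  have local: "?S u v w = k' u" if "(k has_derivative k') (at ?z)"
    "\<And>y. y \<in> chart N p ` cdom N p \<Longrightarrow> metric_rep N p g v w y = k y" for k k' u v w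
  proof -
    have "(metric_rep N p g v w has_derivative k') (at ?z)"
      by (rule has_derivative_transform_within_open[OF that(1) open_image]) (use centre that(2) in auto)
    then show ?thesis by (simp flip: frechet_derivative_at)
  qed
  have lin: "linear (\<lambda>v. ?S u v w)" for u w
  proof (rule linearI)
    fix a b c
    show "?S u (a + b) w = ?S u a w + ?S u b w"
      by (rule local[OF has_derivative_add[OF D D]]) (rule bilinear_ladd[OF bil])
    show "?S u (c *\<^sub>R a) w = c *\<^sub>R ?S u a w"
      by (rule local[OF has_derivative_scaleR_right[OF D]]) (rule bilinear_lmul[OF bil])
  qed
  have lin': "linear (\<lambda>u. ?S u v w)" for v w using D has_derivative_linear by blast
  have sym: "?S u v w = ?S u w v" for u v w
    by (rule local[OF D]) (simp add: metric_rep_def Let_def inner_form.sym[OF g])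
  have "\<exists>!\<Gamma>. bilinear \<Gamma> \<and> (\<forall>u v. \<Gamma> u v = \<Gamma> v u) \<and>
    (\<forall>u v w. ?S u v w = g p (\<Gamma> u v) w + g p v (\<Gamma> u w))"
    by (rule inner_form.koszul_ex1[OF g lin' lin sym])
  from theI'[OF this, folded christoffel_def]
  show "bilinear (christoffel N g p)" "christoffel N g p u v = christoffel N g p v u"
    "?S u v w = g p (christoffel N g p u v) w + g p v (christoffel N g p u w)"
    by blast+
qed

end

locale riemannian = charted M
  for M :: "('m::topological_space, 'e::euclidean_space) manifold" +
  fixes g :: "'m \<Rightarrow> 'e \<Rightarrow> 'e \<Rightarrow> real"
  assumes metric: "riemannian_metric M g"
begin

lemma inner: "inner_form (g p)"
  using metric unfolding riemannian_metric_def by unfold_locales auto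

abbreviation \<Gamma> where "\<Gamma> \<equiv> christoffel M g"

lemma metric_rep_differentiable: "metric_rep M p g v w differentiable (at (chart M p p))"
proof -
  have "Ck_on (Suc 0) (chart M p ` cdom M p) (metric_rep M p g v w)"
    using metric unfolding riemannian_metric_def smooth_on_def by blast
  then show ?thesis using centre unfolding Ck_on.simps by blast
qed

lemmas bilinear_christoffel = christoffel(1)[OF inner metric_rep_differentiable]
  and christoffel_sym = christoffel(2)[OF inner metric_rep_differentiable]
  and christoffel_metric = christoffel(3)[OF inner metric_rep_differentiable]

lemma metric_rep_has_derivative:
  "(metric_rep M p g v w has_derivative (\<lambda>u. g p (\<Gamma> p u v) w + g p v (\<Gamma> p u w))) (at (chart M p p))"
  using metric_rep_differentiable[of p v w] unfolding frechet_derivative_works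
  by (simp add: christoffel_metric[abs_def])

end

section \<open>Induced metric and Gauss formula\<close>

locale immersed = charted_map N M f + riemannian M g
  for N :: "('n::topological_space, 'f::euclidean_space) manifold"
    and M :: "('m::topological_space, 'e::euclidean_space) manifold"
    and g :: "'m \<Rightarrow> 'e \<Rightarrow> 'e \<Rightarrow> real" and f :: "'n \<Rightarrow> 'm" +
  assumes inj_df: "inj (dmap N M f x)"
begin

abbreviation pb :: "'n \<Rightarrow> 'f \<Rightarrow> 'f \<Rightarrow> real" where
  "pb \<equiv> pullback_metric N M g f"

text \<open>The covariant derivative of \<open>df v\<close> along \<open>f\<close> in the direction \<open>u\<close>, for \<open>v\<close> constant in the
  chart.\<close>

definition hess_cov :: "'n \<Rightarrow> 'f \<Rightarrow> 'f \<Rightarrow> 'e" where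
  "hess_cov x u v = hess x u v + \<Gamma> (f x) (df x u) (df x v)"

lemma hess_cov_sym: "hess_cov x u v = hess_cov x v u"
  unfolding hess_cov_def using hess_sym christoffel_sym by metis

lemma bilinear_hess_cov: "bilinear (hess_cov x)"
  using bilinear_hess[of x] bilinear_christoffel[of "f x"] linear_df[of x]
  unfolding hess_cov_def[abs_def] bilinear_def
  by (auto intro!: linear_compose_add intro: linear_compose[unfolded o_def])

lemma inner_pb: "inner_form (pb x)"
proof -
  interpret g: inner_form "g (f x)" by (rule inner)
  interpret d: linear "df x" by (rule linear_df)
  show ?thesis
  proof
    show "bilinear (pb x)"
      unfolding bilinear_def pullback_metric_def
      by (auto intro!: linearI simp: d.add d.scaleR g.expand)
    show "pb x u v = pb x v u" for u v unfolding pullback_metric_def by (rule g.sym)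
    show "pb x u u > 0" if "u \<noteq> 0" for u
      unfolding pullback_metric_def using inj_df[of x] that d.zero
      by (intro g.pos) (metis injD)
  qed
qed

lemma pb_in_chart:
  assumes "y \<in> dom_at x"
  shows "metric_rep N x pb v w y = metric_rep M (f x) g (drep x y v) (drep x y w) (rep x y)"
  unfolding metric_rep_def[of M] Let_def in_chart[OF assms]
  by (simp add: metric_rep_def Let_def pullback_metric_def)

text \<open>The Leibniz rule for two fields along \<open>f\<close>. The metric is linear in each
  slot, so \<open>has_derivative_linear_family\<close> applies once per slot; the Christoffel terms
  are the derivative of the metric coefficients.\<close>

lemma metric_along_has_derivative:
  assumes V: "(V has_derivative V') (at (chart N x x))" and W: "(W has_derivative W') (at (chart N x x))"
  shows "((\<lambda>y. metric_rep M (f x) g (V y) (W y) (rep x y)) has_derivative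
    (\<lambda>u. g (f x) (V' u + \<Gamma> (f x) (df x u) (V (chart N x x))) (W (chart N x x)) +
      g (f x) (V (chart N x x)) (W' u + \<Gamma> (f x) (df x u) (W (chart N x x))))) (at (chart N x x))"
    (is "(_ has_derivative ?D) (at ?z)")
proof -
  interpret g: inner_form "g (f x)" by (rule inner)
  have bil: "bilinear (\<lambda>v w. metric_rep M (f x) g v w z)" if "z \<in> chart M (f x) ` cdom M (f x)" for z
    using M.bilinear_metric_rep[OF inner_form.bilin[OF inner] that] .
  have ev: "\<forall>\<^sub>F z in nhds (rep x ?z). z \<in> chart M (f x) ` cdom M (f x)"
    by (intro eventually_nhds_in_open M.open_image) (simp add: rep_centre M.centre)
  have 1: "((\<lambda>y. metric_rep M (f x) g v (W y) (rep x y)) has_derivative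
      (\<lambda>u. (g (f x) (\<Gamma> (f x) (df x u) v) (W ?z) + g (f x) v (\<Gamma> (f x) (df x u) (W ?z))) +
        metric_rep M (f x) g v (W' u) (rep x ?z))) (at ?z)" for v
  proof (rule has_derivative_linear_family[OF rep_has_derivative_centre W])
    show "\<forall>\<^sub>F z in nhds (rep x ?z). linear (\<lambda>w. metric_rep M (f x) g v w z)"
      using ev by (rule eventually_mono) (use bil in \<open>simp add: bilinear_def\<close>)
  qed (use metric_rep_has_derivative in \<open>simp add: rep_centre\<close>)
  have "((\<lambda>y. metric_rep M (f x) g (V y) (W y) (rep x y)) has_derivative
      (\<lambda>u. ((g (f x) (\<Gamma> (f x) (df x u) (V ?z)) (W ?z) + g (f x) (V ?z) (\<Gamma> (f x) (df x u) (W ?z))) +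
        metric_rep M (f x) g (V ?z) (W' u) (rep x ?z)) +
        metric_rep M (f x) g (V' u) (W ?z) (rep x ?z))) (at ?z)"
  proof (rule has_derivative_linear_family[OF has_derivative_ident V 1])
    have "filterlim (rep x) (nhds (rep x ?z)) (nhds ?z)"
      using has_derivative_continuous[OF rep_has_derivative_centre]
      by (simp add: continuous_within tendsto_at_iff_tendsto_nhds)
    from filterlim_iff[THEN iffD1, OF this, rule_format, OF ev]
    show "\<forall>\<^sub>F y in nhds ?z. linear (\<lambda>v. metric_rep M (f x) g v (W y) (rep x y))"
      by (rule eventually_mono) (use bil in \<open>simp add: bilinear_def\<close>)
  qed
  then show ?thesis
    by (simp add: rep_centre M.metric_rep_centre g.expand algebra_simps)
qed

lemma pb_has_derivative:
  "(metric_rep N x pb v w has_derivative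
    (\<lambda>u. g (f x) (hess_cov x u v) (df x w) + g (f x) (df x v) (hess_cov x u w))) (at (chart N x x))"
proof (rule has_derivative_transform_within_open[OF _ open_dom_at centre_dom_at])
  show "((\<lambda>y. metric_rep M (f x) g (drep x y v) (drep x y w) (rep x y)) has_derivative
    (\<lambda>u. g (f x) (hess_cov x u v) (df x w) + g (f x) (df x v) (hess_cov x u w))) (at (chart N x x))"
    using metric_along_has_derivative[OF drep_has_derivative drep_has_derivative]
    by (simp add: hess_cov_def drep_centre)
qed (simp add: pb_in_chart)

lemma pb_derivative:
  "frechet_derivative (metric_rep N x pb v w) (at (chart N x x)) u =
    g (f x) (hess_cov x u v) (df x w) + g (f x) (df x v) (hess_cov x u w)"
  unfolding frechet_derivative_at[OF pb_has_derivative, symmetric] ..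

text \<open>\<open>hess_cov\<close> is symmetric and compatible with the metric, so its tangential
  part is determined by the induced metric alone. For the warped product this makes it
  computable.\<close>

lemma hess_cov_koszul:
  fixes x u v w
  defines "S \<equiv> \<lambda>u v w. frechet_derivative (metric_rep N x pb v w) (at (chart N x x)) u"
  shows "g (f x) (hess_cov x u v) (df x w) = (S u v w + S v u w - S w u v) / 2"
  by (rule koszul_formula[where K = "\<lambda>u v w. g (f x) (hess_cov x u v) (df x w)"])
    (simp_all add: S_def pb_derivative hess_cov_sym inner_form.sym[OF inner, of _ "df x _"])

text \<open>The tangential part of \<open>hess_cov\<close> obeys the same Koszul formula as the
  Levi-Civita connection of the induced metric, so the two agree.\<close>

lemma
  shows bilinear_christoffel_pb: "bilinear (christoffel N pb x)"
    and christoffel_pb_sym: "christoffel N pb x u v = christoffel N pb x v u"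
    and christoffel_pb: "pb x (christoffel N pb x u v) w = g (f x) (hess_cov x u v) (df x w)"
proof -
  have "metric_rep N x pb v w differentiable (at (chart N x x))" for v w
    using pb_has_derivative unfolding differentiable_def by blast
  note C = N.christoffel[of pb x, OF inner_pb this]
  interpret p: inner_form "pb x" by (rule inner_pb)
  show "bilinear (christoffel N pb x)" and sym: "christoffel N pb x u v = christoffel N pb x v u" for u v
    by (fact C)+
  let ?S = "\<lambda>u v w. frechet_derivative (metric_rep N x pb v w) (at (chart N x x)) u"
  have "pb x (christoffel N pb x u v) w = (?S u v w + ?S v u w - ?S w u v) / 2"
  proof (rule koszul_formula[where K = "\<lambda>u v w. pb x (christoffel N pb x u v) w"])
    show "?S u v w = pb x (christoffel N pb x u v) w + pb x (christoffel N pb x u w) v" for u v w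
      unfolding C(3) p.sym[of v "christoffel N pb x u w"] ..
    show "pb x (christoffel N pb x u v) w = pb x (christoffel N pb x v u) w" for u v w
      unfolding sym[of u v] ..
  qed
  then show "pb x (christoffel N pb x u v) w = g (f x) (hess_cov x u v) (df x w)"
    by (simp add: hess_cov_koszul)
qed

abbreviation \<Sigma> :: "'n \<Rightarrow> 'f \<Rightarrow> 'f \<Rightarrow> 'e" where
  "\<Sigma> \<equiv> second_ff N M g f"

lemma \<Sigma>_eq: "\<Sigma> x u v = hess_cov x u v - df x (christoffel N pb x u v)"
  by (simp add: second_ff_eq hess_cov_def)

lemma bilinear_\<Sigma>: "bilinear (\<Sigma> x)"
  using bilinear_hess_cov[of x] bilinear_christoffel_pb[of x] linear_df[of x]
  unfolding \<Sigma>_eq[abs_def] bilinear_def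
  by (auto intro!: linear_compose_sub intro: linear_compose[unfolded o_def])

lemma \<Sigma>_normal: "g (f x) (\<Sigma> x u v) (df x w) = 0"
proof -
  interpret g: inner_form "g (f x)" by (rule inner)
  show ?thesis
    using christoffel_pb[of x u v w] by (simp add: \<Sigma>_eq g.diff_left pullback_metric_def)
qed

text \<open>The discrepancy would be both tangent and normal. A second fundamental form is therefore
  found by exhibiting any splitting into a normal and a tangent vector, as is done for the
  leaves.\<close>

lemma \<Sigma>_unique:
  assumes "\<And>w. g (f x) s (df x w) = 0" "hess_cov x u v - s = df x t"
  shows "\<Sigma> x u v = s"
proof -
  interpret g: inner_form "g (f x)" by (rule inner)
  interpret d: linear "df x" by (rule linear_df)
  have "\<Sigma> x u v - s = df x (t - christoffel N pb x u v)"
    using assms(2) by (simp add: \<Sigma>_eq d.diff algebra_simps)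
  moreover from this have "g (f x) (\<Sigma> x u v - s) (\<Sigma> x u v - s) = 0"
    using assms(1) \<Sigma>_normal by (metis g.diff_left diff_self)
  ultimately show ?thesis using g.eq_zero_iff by simp
qed

text \<open>\<open>\<iota>\<close> is affine in charts, as are the inclusions of the leaves of a product.\<close>

lemma slice:
  fixes N' :: "('k::topological_space, 'l::euclidean_space) manifold" and \<iota> :: "'k \<Rightarrow> 'n"
  assumes N': "charted N'" and \<iota>: "continuous_on UNIV \<iota>" and J: "linear J" "inj J"
    and cdom: "\<And>x y. y \<in> cdom N' x \<Longrightarrow> \<iota> y \<in> cdom N (\<iota> x)"
    and chart: "\<And>x y. y \<in> cdom N' x \<Longrightarrow> chart N (\<iota> x) (\<iota> y) = J (chart N' x y) + c x"
  defines "f' \<equiv> \<lambda>x. f (\<iota> x)"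
  shows "immersed N' M g f'"
    and "dmap N' M f' x u = df (\<iota> x) (J u)"
    and "immersed.hess_cov N' M g f' x u v = hess_cov (\<iota> x) (J u) (J v)"
proof -
  interpret N': charted N' by fact
  let ?T = "\<lambda>x. chart N' x ` (cdom N' x \<inter> f' -` cdom M (f' x))"
  let ?r = "\<lambda>x. chart M (f' x) \<circ> f' \<circ> chart_inv N' x"
  have cont': "continuous_on UNIV f'"
    unfolding f'_def using continuous_on_compose2[OF cont \<iota>] by simp
  have open_T: "open (?T x)" for x
    by (intro N'.open_chart_image) (use cont' M.open_cdom in \<open>simp add: continuous_on_open_vimage\<close>)
  have T: "J y + c x \<in> dom_at (\<iota> x)" "rep (\<iota> x) (J y + c x) = ?r x y" if "y \<in> ?T x" for x y
  proof -
    obtain q where q: "q \<in> cdom N' x" "f' q \<in> cdom M (f' x)" "y = chart N' x q" using \<open>y \<in> ?T x\<close> by blast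
    then have eq: "J y + c x = chart N (\<iota> x) (\<iota> q)" and mem: "\<iota> q \<in> cdom N (\<iota> x)"
      using chart cdom by auto
    show "J y + c x \<in> dom_at (\<iota> x)"
      unfolding eq dom_at_def using mem q(2) by (auto simp: f'_def)
    show "rep (\<iota> x) (J y + c x) = ?r x y"
      unfolding eq rep_def using mem q by (simp add: N.inv_chart N'.inv_chart f'_def)
  qed
  have "Ck_on 2 (?T x) (?r x)" for x
  proof (rule Ck_on_cong[OF open_T])
    show "Ck_on 2 (?T x) (\<lambda>y. rep (\<iota> x) (J y + c x))"
    proof (rule Ck_on_compose_affine[OF open_T J(1)])
      show "Ck_on 2 (dom_at (\<iota> x)) (rep (\<iota> x))" using C2 unfolding dom_at_def rep_def .
    qed (rule T)
  qed (rule T)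
  then interpret f': charted_map N' M f'
    by unfold_locales (use cont' in auto)
  have J_deriv: "((\<lambda>y. J y + c x) has_derivative J) (at y)" for x y
    using J(1) by (auto intro!: derivative_eq_intros bounded_linear_imp_has_derivative
        simp: linear_conv_bounded_linear)
  have drep: "f'.drep x y v = drep (\<iota> x) (J y + c x) (J v)" if "y \<in> f'.dom_at x" for x y v
  proof -
    have "((\<lambda>y. rep (\<iota> x) (J y + c x)) has_derivative (\<lambda>v. drep (\<iota> x) (J y + c x) (J v))) (at y)"
      using that T(1)[of y x] unfolding f'.dom_at_def
      by (intro has_derivative_compose[OF J_deriv] rep_has_derivative) auto
    then have "(f'.rep x has_derivative (\<lambda>v. drep (\<iota> x) (J y + c x) (J v))) (at y)"
      by (rule has_derivative_transform_within_open[OF _ f'.open_dom_at that])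
        (use T(2) in \<open>simp add: f'.dom_at_def f'.rep_def\<close>)
    then show ?thesis using f'.rep_has_derivative[OF that] has_derivative_unique[THEN fun_cong] by blast
  qed
  have centre: "J (chart N' x x) + c x = chart N (\<iota> x) (\<iota> x)" for x
    using chart N'.centre by simp
  show df': "dmap N' M f' x u = df (\<iota> x) (J u)" for x u
    unfolding f'.drep_centre[symmetric] drep[OF f'.centre_dom_at] centre drep_centre ..
  \<comment> \<open>The inclusion has constant derivative \<open>J\<close>, so it contributes no
    second-order term.\<close>
  have hess': "f'.hess x u v = hess (\<iota> x) (J u) (J v)" for x u v
  proof -
    have "((\<lambda>y. drep (\<iota> x) (J y + c x) (J v)) has_derivative (\<lambda>u. hess (\<iota> x) (J u) (J v)))
        (at (chart N' x x))"
      using drep_has_derivative[of "\<iota> x" "J v", folded centre] by (rule has_derivative_compose[OF J_deriv])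
    then have "((\<lambda>y. f'.drep x y v) has_derivative (\<lambda>u. hess (\<iota> x) (J u) (J v))) (at (chart N' x x))"
      by (rule has_derivative_transform_within_open[OF _ f'.open_dom_at f'.centre_dom_at])
        (simp add: drep)
    then show ?thesis using f'.drep_has_derivative has_derivative_unique[THEN fun_cong] by blast
  qed
  show imm: "immersed N' M g f'"
  proof unfold_locales
    show "inj (dmap N' M f' x)" for x
      using inj_compose[OF inj_df[of "\<iota> x"] J(2)] by (simp add: df' o_def fun_eq_iff inj_def)
  qed
  show "immersed.hess_cov N' M g f' x u v = hess_cov (\<iota> x) (J u) (J v)"
    unfolding immersed.hess_cov_def[OF imm] hess_cov_def hess' df' by (simp add: f'_def)
qed

end

section \<open>Immersions into locally conformal almost cosymplectic manifolds\<close>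

locale lcac_immersion = immersed N M g f
  for N :: "('n::topological_space, 'f::euclidean_space) manifold"
    and M :: "('m::{t2_space, second_countable_topology}, 'e::euclidean_space) manifold"
    and g :: "'m \<Rightarrow> 'e \<Rightarrow> 'e \<Rightarrow> real" and f :: "'n \<Rightarrow> 'm" +
  fixes \<Phi> :: "'m \<Rightarrow> 'e \<Rightarrow> 'e" and \<xi> :: "'m \<Rightarrow> 'e" and \<eta> :: "'m \<Rightarrow> 'e \<Rightarrow> real" and \<beta> :: "'m \<Rightarrow> real"
  assumes lcac: "locally_conformal_almost_cosymplectic M \<Phi> \<xi> \<eta> g \<beta>"
begin

lemma acm: "almost_contact_metric M \<Phi> \<xi> \<eta> g"
  using lcac unfolding locally_conformal_almost_cosymplectic_def by blast

lemma \<Phi>_smooth: "smooth_endo M \<Phi>" and \<xi>_smooth: "smooth_vector_field M \<xi>"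
  and \<Phi>_\<Phi>: "\<Phi> p (\<Phi> p X) = - X + \<eta> p X *\<^sub>R \<xi> p"
  and \<eta>_\<xi>: "\<eta> p (\<xi> p) = 1" and \<Phi>_\<xi>: "\<Phi> p (\<xi> p) = 0" and \<eta>_\<Phi>: "\<eta> p (\<Phi> p X) = 0"
  and g_\<Phi>_\<Phi>: "g p (\<Phi> p X) (\<Phi> p Y) = g p X Y - \<eta> p X * \<eta> p Y"
  using acm unfolding almost_contact_metric_def by blast+

lemma linear_\<Phi>: "linear (\<Phi> p)"
  using \<Phi>_smooth unfolding smooth_endo_def by blast

text \<open>With \<open>\<xi> p\<close> as second argument the left side of
  \<open>g_\<Phi>_\<Phi>\<close> vanishes.\<close>

lemma \<eta>_eq: "\<eta> p X = g p X (\<xi> p)"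
proof -
  interpret G: inner_form "g p" by (rule inner)
  show ?thesis using g_\<Phi>_\<Phi>[of p X "\<xi> p"] by (simp add: \<Phi>_\<xi> \<eta>_\<xi> G.zero_right)
qed

lemma g_\<xi>_\<xi>: "g p (\<xi> p) (\<xi> p) = 1"
  using \<eta>_eq[of p "\<xi> p"] \<eta>_\<xi> by simp

text \<open>Compatibility for the pair \<open>\<Phi> p X\<close>, \<open>Y\<close>; the term along
  \<open>\<xi> p\<close> drops out because \<eta> annihilates the image of \<Phi>.\<close>

lemma \<Phi>_skew: "g p (\<Phi> p X) Y = - g p X (\<Phi> p Y)"
proof -
  interpret G: inner_form "g p" by (rule inner)
  have "g p (\<Phi> p X) Y = g p (- X + \<eta> p X *\<^sub>R \<xi> p) (\<Phi> p Y)"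
    using g_\<Phi>_\<Phi>[of p "\<Phi> p X" Y] by (simp add: \<Phi>_\<Phi> \<eta>_\<Phi>)
  also have "g p (\<xi> p) (\<Phi> p Y) = 0" using \<eta>_\<Phi>[of p Y] by (simp add: \<eta>_eq G.sym)
  then have "g p (- X + \<eta> p X *\<^sub>R \<xi> p) (\<Phi> p Y) = - g p X (\<Phi> p Y)" by (simp add: G.expand)
  finally show ?thesis .
qed

text \<open>The condition on the covariant derivative of \<Phi> is tested on the coordinate field of
  \<open>v\<close>, whose own covariant derivative at the centre is \<open>\<Gamma> p u v\<close>.
  This gives the ordinary derivative of the components of \<Phi>.\<close>

lemma endo_rep_has_derivative:
  "(endo_rep M p \<Phi> v has_derivative (\<lambda>u. \<Phi> p (\<Gamma> p u v) - \<Gamma> p u (\<Phi> p v) +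
    \<beta> p *\<^sub>R (g p (\<Phi> p u) v *\<^sub>R \<xi> p - \<eta> p v *\<^sub>R \<Phi> p u))) (at (chart M p p))"
proof -
  let ?Y = "\<lambda>q. coord_change M p q q v"
  have "Ck_on (Suc 0) (chart M p ` cdom M p) (endo_rep M p \<Phi> v)"
    using \<Phi>_smooth unfolding smooth_endo_def smooth_on_def by blast
  then have "endo_rep M p \<Phi> v differentiable (at (chart M p p))"
    using M.centre unfolding Ck_on.simps by blast
  then have D: "(endo_rep M p \<Phi> v has_derivative frechet_derivative (endo_rep M p \<Phi> v) (at (chart M p p)))
      (at (chart M p p))"
    unfolding frechet_derivative_works .
  have "(vf_rep M p ?Y has_derivative (\<lambda>_. 0)) (at (chart M p p))"
    by (rule has_derivative_transform_within_open[OF has_derivative_const[of v] M.open_image])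
      (use M.centre M.vf_rep_const in auto)
  then have Y: "cov M g p u ?Y = \<Gamma> p u v" for u
    unfolding cov_def by (simp add: M.coord_change_same M.centre flip: frechet_derivative_at)
  have rep: "vf_rep M p (\<lambda>q. \<Phi> q (?Y q)) = endo_rep M p \<Phi> v"
    by (rule ext) (simp add: vf_rep_def endo_rep_def)
  have "cov M g p u (\<lambda>q. \<Phi> q (?Y q)) - \<Phi> p (cov M g p u ?Y) =
      \<beta> p *\<^sub>R (g p (\<Phi> p u) (?Y p) *\<^sub>R \<xi> p - \<eta> p (?Y p) *\<^sub>R \<Phi> p u)" for u
    using lcac M.smooth_vf_near_const[of p v]
    unfolding locally_conformal_almost_cosymplectic_def by blast
  then have "frechet_derivative (endo_rep M p \<Phi> v) (at (chart M p p)) u =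
      \<Phi> p (\<Gamma> p u v) - \<Gamma> p u (\<Phi> p v) + \<beta> p *\<^sub>R (g p (\<Phi> p u) v *\<^sub>R \<xi> p - \<eta> p v *\<^sub>R \<Phi> p u)" for u
    unfolding Y by (simp add: cov_def rep M.coord_change_same M.centre algebra_simps)
  then have "frechet_derivative (endo_rep M p \<Phi> v) (at (chart M p p)) = (\<lambda>u.
      \<Phi> p (\<Gamma> p u v) - \<Gamma> p u (\<Phi> p v) + \<beta> p *\<^sub>R (g p (\<Phi> p u) v *\<^sub>R \<xi> p - \<eta> p v *\<^sub>R \<Phi> p u))"
    by (rule ext)
  then show ?thesis using D by simp
qed

lemma \<xi>_rep_has_derivative:
  "(vf_rep M p \<xi> has_derivative (\<lambda>u. \<beta> p *\<^sub>R (u - \<eta> p u *\<^sub>R \<xi> p) - \<Gamma> p u (\<xi> p))) (at (chart M p p))"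
proof -
  have "Ck_on (Suc 0) (chart M p ` cdom M p) (vf_rep M p \<xi>)"
    using \<xi>_smooth unfolding smooth_vector_field_def smooth_on_def by blast
  then have "vf_rep M p \<xi> differentiable (at (chart M p p))"
    using M.centre unfolding Ck_on.simps by blast
  moreover have "cov M g p u \<xi> = \<beta> p *\<^sub>R (u - \<eta> p u *\<^sub>R \<xi> p)" for u
    using lcac unfolding locally_conformal_almost_cosymplectic_def by blast
  then have "frechet_derivative (vf_rep M p \<xi>) (at (chart M p p)) u =
      \<beta> p *\<^sub>R (u - \<eta> p u *\<^sub>R \<xi> p) - \<Gamma> p u (\<xi> p)" for u
    unfolding cov_def eq_diff_eq .
  then have "frechet_derivative (vf_rep M p \<xi>) (at (chart M p p)) =
      (\<lambda>u. \<beta> p *\<^sub>R (u - \<eta> p u *\<^sub>R \<xi> p) - \<Gamma> p u (\<xi> p))"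
    by (rule ext)
  ultimately show ?thesis unfolding frechet_derivative_works by simp
qed

text \<open>The Leibniz rule for \<open>g(\<Phi> v, w) = 0\<close> along \<open>f\<close>, with \<open>\<nabla>\<Phi>\<close> replaced by its value.\<close>

lemma \<Phi>_orthogonal_derivative:
  assumes perp: "\<And>q. q \<in> cdom N x \<Longrightarrow> g (f q) (\<Phi> (f q) (df q (coord_change N x q q v)))
    (df q (coord_change N x q q w)) = 0"
  shows "g (f x) (\<Phi> (f x) (hess_cov x u v) +
      \<beta> (f x) *\<^sub>R (g (f x) (\<Phi> (f x) (df x u)) (df x v) *\<^sub>R \<xi> (f x) - \<eta> (f x) (df x v) *\<^sub>R \<Phi> (f x) (df x u)))
      (df x w) + g (f x) (\<Phi> (f x) (df x v)) (hess_cov x u w) = 0"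
proof -
  let ?z = "chart N x x" and ?p = "f x"
  interpret \<Phi>: linear "\<Phi> ?p" by (rule linear_\<Phi>)
  \<comment> \<open>The image under \<Phi> of \<open>df\<close> of the coordinate field of
    \<open>v\<close>, read in the chart of \<open>f x\<close>. Its product with the field of
    \<open>w\<close> is identically zero by \<open>perp\<close>.\<close>
  define A where "A y = endo_rep M ?p \<Phi> (drep x y v) (rep x y)" for y
  have ev: "\<forall>\<^sub>F z in nhds (rep x ?z). z \<in> chart M ?p ` cdom M ?p"
    by (intro eventually_nhds_in_open M.open_image) (simp add: rep_centre M.centre)
  have centre: "endo_rep M ?p \<Phi> w (chart M ?p ?p) = \<Phi> ?p w" for w
    unfolding endo_rep_def Let_def by (simp add: M.inv_chart M.centre M.coord_change_same)
  have lin: "linear (\<lambda>v. endo_rep M ?p \<Phi> v z)" if "z \<in> chart M ?p ` cdom M ?p" for z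
    unfolding endo_rep_def Let_def
    using M.linear_coord_change M.chart_inv_mem[OF that] M.centre
    by (intro linear_compose[unfolded o_def, OF _ M.linear_coord_change]
        linear_compose[unfolded o_def, OF M.linear_coord_change linear_\<Phi>]) auto
  have "(A has_derivative (\<lambda>u. (\<Phi> ?p (\<Gamma> ?p (df x u) (drep x ?z v)) - \<Gamma> ?p (df x u) (\<Phi> ?p (drep x ?z v)) +
      \<beta> ?p *\<^sub>R (g ?p (\<Phi> ?p (df x u)) (drep x ?z v) *\<^sub>R \<xi> ?p - \<eta> ?p (drep x ?z v) *\<^sub>R \<Phi> ?p (df x u))) +
      endo_rep M ?p \<Phi> (hess x u v) (rep x ?z))) (at ?z)"
    unfolding A_def
  proof (rule has_derivative_linear_family[OF rep_has_derivative_centre drep_has_derivative])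
    show "\<forall>\<^sub>F z in nhds (rep x ?z). linear (\<lambda>v. endo_rep M ?p \<Phi> v z)"
      using ev by (rule eventually_mono) (rule lin)
  qed (use endo_rep_has_derivative in \<open>simp add: rep_centre\<close>)
  note D = metric_along_has_derivative[OF this drep_has_derivative, of w]
  have "((\<lambda>y. metric_rep M ?p g (A y) (drep x y w) (rep x y)) has_derivative (\<lambda>_. 0)) (at ?z)"
  proof (rule has_derivative_transform_within_open[OF has_derivative_const[of 0] open_dom_at centre_dom_at])
    fix y assume y: "y \<in> dom_at x"
    let ?q = "chart_inv N x y"
    note C = in_chart[OF y]
    have "coord_change M ?p (f ?q) (f ?q) (A y) = \<Phi> (f ?q) (df ?q (coord_change N x ?q ?q v))"
      unfolding A_def endo_rep_def Let_def C(1,4)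
      using M.coord_change_comp[of "f ?q" "f ?q" ?p "f ?q"] M.coord_change_same M.centre C(2) by simp
    then show "0 = metric_rep M ?p g (A y) (drep x y w) (rep x y)"
      unfolding metric_rep_def Let_def C(1,4) using perp[OF C(3)] by simp
  qed
  from fun_cong[OF has_derivative_unique[OF this D], of u] show ?thesis
    by (simp add: A_def rep_centre drep_centre centre hess_cov_def \<Phi>.add algebra_simps)
qed

text \<open>The Leibniz rule with \<xi> as first field. Its covariant derivative is \<beta> times
  the part of \<open>u\<close> orthogonal to \<xi>; the term along \<xi> is killed by
  \<open>perp\<close> at the centre.\<close>

lemma \<xi>_orthogonal_derivative:
  assumes perp: "\<And>q. q \<in> cdom N x \<Longrightarrow> g (f q) (\<xi> (f q)) (df q (coord_change N x q q v)) = 0"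
  shows "\<beta> (f x) * g (f x) (df x u) (df x v) + g (f x) (\<xi> (f x)) (hess_cov x u v) = 0"
proof -
  let ?z = "chart N x x" and ?p = "f x"
  interpret G: inner_form "g ?p" by (rule inner)
  define A where "A y = vf_rep M ?p \<xi> (rep x y)" for y
  have A0: "A ?z = \<xi> ?p"
    unfolding A_def vf_rep_def Let_def by (simp add: rep_centre M.inv_chart M.centre M.coord_change_same)
  have "(vf_rep M ?p \<xi> has_derivative
      (\<lambda>u. \<beta> ?p *\<^sub>R (u - \<eta> ?p u *\<^sub>R \<xi> ?p) - \<Gamma> ?p u (\<xi> ?p))) (at (rep x ?z))"
    using \<xi>_rep_has_derivative by (simp add: rep_centre)
  from has_derivative_compose[OF rep_has_derivative_centre this]
  have "(A has_derivative (\<lambda>u. \<beta> ?p *\<^sub>R (df x u - \<eta> ?p (df x u) *\<^sub>R \<xi> ?p) - \<Gamma> ?p (df x u) (\<xi> ?p))) (at ?z)"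
    by (simp add: A_def[abs_def])
  note D = metric_along_has_derivative[OF this drep_has_derivative, of v]
  have "((\<lambda>y. metric_rep M ?p g (A y) (drep x y v) (rep x y)) has_derivative (\<lambda>_. 0)) (at ?z)"
  proof (rule has_derivative_transform_within_open[OF has_derivative_const[of 0] open_dom_at centre_dom_at])
    fix y assume y: "y \<in> dom_at x"
    let ?q = "chart_inv N x y"
    note C = in_chart[OF y]
    have "coord_change M ?p (f ?q) (f ?q) (A y) = \<xi> (f ?q)"
      unfolding A_def vf_rep_def Let_def C(1)
      using M.coord_change_comp[of "f ?q" "f ?q" ?p "f ?q"] M.coord_change_same M.centre C(2) by simp
    then show "0 = metric_rep M ?p g (A y) (drep x y v) (rep x y)"
      unfolding metric_rep_def Let_def C(1,4) using perp[OF C(3)] by simp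
  qed
  from fun_cong[OF has_derivative_unique[OF this D], of u] show ?thesis
    using perp[OF N.centre] by (simp add: A0 drep_centre hess_cov_def G.expand N.coord_change_same N.centre)
qed

end

section \<open>Orthogonal projections and angles\<close>

context inner_form
begin

text \<open>Pulled back by the injective \<open>d\<close>, the form \<open>h\<close> stays definite,
  so the functional \<open>h w\<close> has a Riesz vector. Its image meets the description in
  \<open>orth_proj\<close>.\<close>

lemma orth_proj_range:
  fixes d :: "'f::euclidean_space \<Rightarrow> 'e"
  assumes "linear d" "inj d"
  obtains v where "orth_proj h (range d) w = d v" "\<And>v'. h (w - d v) (d v') = 0"
proof -
  interpret d: linear d by fact
  have "inner_form (\<lambda>u v. h (d u) (d v))"
  proof
    show "bilinear (\<lambda>u v. h (d u) (d v))"
      unfolding bilinear_def by (auto intro!: linearI simp: d.add d.scaleR expand)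
    show "h (d u) (d v) = h (d v) (d u)" for u v by (rule sym)
    show "h (d u) (d u) > 0" if "u \<noteq> 0" for u
      using that injD[OF assms(2), of u 0] d.zero by (intro pos) auto
  qed
  moreover have "linear (\<lambda>v. h w (d v))"
    by (auto intro!: linearI simp: d.add d.scaleR expand)
  ultimately obtain v where v: "\<And>v'. h (d v) (d v') = h w (d v')"
    by (rule inner_form.riesz) blast
  have "orth_proj h (range d) w = d v"
    unfolding orth_proj_def
  proof (rule the_equality)
    show "d v \<in> range d \<and> (\<forall>s\<in>range d. h (w - d v) s = 0)"
      using v by (auto simp: diff_left)
    fix t assume t: "t \<in> range d \<and> (\<forall>s\<in>range d. h (w - t) s = 0)"
    then obtain s where "t = d s" by blast
    then have "h (t - d v) (d (s - v)) = 0"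
      using t v by (auto simp: diff_left)
    then show "t = d v" using \<open>t = d s\<close> eq_zero_iff[of "t - d v"] by (simp add: d.diff)
  qed
  then show ?thesis by (rule that) (simp add: diff_left v)
qed

text \<open>Pythagoras puts the quotient of lengths between 0 and 1, where \<open>cos\<close> undoes
  \<open>arccos\<close>. The squared form also covers \<open>w = 0\<close>, where the projection
  vanishes too.\<close>

lemma angle_to_range:
  fixes d :: "'f::euclidean_space \<Rightarrow> 'e"
  assumes "linear d" "inj d" and angle: "angle_to_subspace h w (range d) = \<nu>"
  obtains v where "\<And>v'. h (w - d v) (d v') = 0" "h (d v) (d v) = (cos \<nu>)\<^sup>2 * h w w"
proof -
  obtain v where v: "orth_proj h (range d) w = d v" "\<And>v'. h (w - d v) (d v') = 0"
    by (rule orth_proj_range[OF assms(1,2)]) blast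
  have pyth: "h w w = h (w - d v) (w - d v) + h (d v) (d v)"
    using v(2)[of v] sym[of w "d v"] by (simp add: expand)
  have "h (d v) (d v) = (cos \<nu>)\<^sup>2 * h w w"
  proof (cases "w = 0")
    case True
    with pyth nonneg[of "w - d v"] nonneg[of "d v"] show ?thesis by (simp add: zero_left)
  next
    case False
    let ?r = "sqrt (h (d v) (d v)) / sqrt (h w w)"
    have "h w w > 0" using False by (rule pos)
    moreover have "h (d v) (d v) \<le> h w w" using pyth nonneg[of "w - d v"] by simp
    ultimately have "0 \<le> ?r" "?r \<le> 1" using nonneg[of "d v"] by auto
    then have "cos \<nu> = ?r"
      using angle unfolding angle_to_subspace_def v(1) by (metis cos_arccos neg_le_0_iff_le order_trans zero_le_one)
    then show ?thesis using \<open>h w w > 0\<close> nonneg[of "d v"] by (simp add: power_divide)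
  qed
  with v(2) show ?thesis by (rule that)
qed

end

section \<open>Bi-warped product submanifolds\<close>

locale biwarped_slant =
  fixes M :: "('m::{t2_space, second_countable_topology}, 'e::euclidean_space) manifold"
    and \<Phi> :: "'m \<Rightarrow> 'e \<Rightarrow> 'e" and \<xi> :: "'m \<Rightarrow> 'e" and \<eta> :: "'m \<Rightarrow> 'e \<Rightarrow> real"
    and g :: "'m \<Rightarrow> 'e \<Rightarrow> 'e \<Rightarrow> real" and \<beta> :: "'m \<Rightarrow> real"
    and L1 :: "('a::{t2_space, second_countable_topology}, 'e1::euclidean_space) manifold"
    and L2 :: "('b::{t2_space, second_countable_topology}, 'e2::euclidean_space) manifold"
    and L3 :: "('c::{t2_space, second_countable_topology}, 'e3::euclidean_space) manifold"
    and g1 :: "'a \<Rightarrow> 'e1 \<Rightarrow> 'e1 \<Rightarrow> real"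
    and g2 :: "'b \<Rightarrow> 'e2 \<Rightarrow> 'e2 \<Rightarrow> real"
    and g3 :: "'c \<Rightarrow> 'e3 \<Rightarrow> 'e3 \<Rightarrow> real"
    and \<phi>1 \<phi>2 :: "'a \<Rightarrow> real" and \<psi> :: "'a \<times> 'b \<times> 'c \<Rightarrow> 'm" and \<nu> :: real
  assumes ambient: "locally_conformal_almost_cosymplectic M \<Phi> \<xi> \<eta> g \<beta>"
    and biwarped: "biwarped_product_submanifold L1 g1 L2 g2 L3 g3 \<phi>1 \<phi>2 M g \<psi>"
    and slant: "proper_slant_tangent L1 M \<Phi> \<xi> g (leaf1 \<psi> b c) \<nu>"
    and invar: "invariant_orthogonal L2 M \<Phi> \<xi> g (leaf2 \<psi> a c)"
    and anti: "anti_invariant_orthogonal L3 M \<Phi> \<xi> g (leaf3 \<psi> a b)"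
    and normal: "Z \<in> D_perp \<Longrightarrow> \<Phi> (\<psi> x) (dmap (prod_manifold3 L1 L2 L3) M \<psi> x Z) \<in>
      normal_space_at (prod_manifold3 L1 L2 L3) M g \<psi> x"
    and mixed: "Z \<in> D_perp \<Longrightarrow> U \<in> D_slant (prod_manifold3 L1 L2 L3) M \<xi> g \<psi> x \<Longrightarrow>
      second_ff (prod_manifold3 L1 L2 L3) M g \<psi> x Z U = 0"
begin

abbreviation L where "L \<equiv> prod_manifold3 L1 L2 L3"

lemma riemannian_factors:
  "riemannian L1 g1" "riemannian L2 g2" "riemannian L3 g3"
  using biwarped unfolding biwarped_product_submanifold_def riemannian_manifold_def
  by (auto simp: riemannian_def riemannian_axioms_def intro: charted_smooth_manifold)

sublocale A: riemannian L1 g1 by (rule riemannian_factors)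
sublocale B: riemannian L2 g2 by (rule riemannian_factors)
sublocale C: riemannian L3 g3 by (rule riemannian_factors)

sublocale lcac_immersion L M g \<psi> \<Phi> \<xi> \<eta> \<beta>
proof -
  have iso: "isometric_immersion L (biwarped_metric g1 g2 g3 \<phi>1 \<phi>2) M g \<psi>"
    using biwarped unfolding biwarped_product_submanifold_def by blast
  have M: "riemannian_manifold M g"
    using ambient unfolding locally_conformal_almost_cosymplectic_def almost_contact_metric_def by blast
  interpret L: charted L
    by (intro charted_prod A.charted_axioms B.charted_axioms C.charted_axioms)
  interpret M: riemannian M g
    using M unfolding riemannian_manifold_def
    by (auto simp: riemannian_def riemannian_axioms_def intro: charted_smooth_manifold)
  show "lcac_immersion L M g \<psi> \<Phi> \<xi> \<eta> \<beta>"
  proof unfold_locales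
    show "Ck_on 2 (chart L x ` (cdom L x \<inter> \<psi> -` cdom M (\<psi> x))) (chart M (\<psi> x) \<circ> \<psi> \<circ> chart_inv L x)"
      for x using iso unfolding isometric_immersion_def smooth_map_def smooth_on_def by blast
  qed (use iso ambient in \<open>auto simp: isometric_immersion_def smooth_map_def\<close>)
qed

lemma pb_eq: "pb (a, b, c) (u1, u2, u3) (v1, v2, v3) =
    g1 a u1 v1 + (\<phi>1 a)\<^sup>2 * g2 b u2 v2 + (\<phi>2 a)\<^sup>2 * g3 c u3 v3"
  using biwarped
  unfolding biwarped_product_submanifold_def isometric_immersion_def biwarped_metric_def by simp

lemma cdom_L: "q \<in> cdom L (a, b, c) \<longleftrightarrow>
    (\<exists>a' b' c'. q = (a', b', c') \<and> a' \<in> cdom L1 a \<and> b' \<in> cdom L2 b \<and> c' \<in> cdom L3 c)"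
  by (cases q) (auto simp: prod_manifold_def)

lemma chart_L: "chart L (a, b, c) (a', b', c') = (chart L1 a a', chart L2 b b', chart L3 c c')"
  by (simp add: prod_manifold_def)

lemma coord_change_L:
  assumes "a' \<in> cdom L1 a" "b' \<in> cdom L2 b" "c' \<in> cdom L3 c"
  shows "coord_change L (a, b, c) (a', b', c') (a', b', c') (u, v, w) =
    (coord_change L1 a a' a' u, coord_change L2 b b' b' v, coord_change L3 c c' c' w)"
proof -
  have "(b', c') \<in> cdom (prod_manifold L2 L3) (b, c)" "(b', c') \<in> cdom (prod_manifold L2 L3) (b', c')"
    using assms B.centre C.centre by (auto simp: prod_manifold_def)
  then show ?thesis
    using assms A.centre B.centre C.centre
    by (simp add: coord_change_prod A.charted_axioms B.charted_axioms C.charted_axioms charted_prod)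
qed

lemma chart_inv_L:
  assumes "x \<in> chart L1 a ` cdom L1 a" "y \<in> chart L2 b ` cdom L2 b" "z \<in> chart L3 c ` cdom L3 c"
  shows "chart_inv L (a, b, c) (x, y, z) = (chart_inv L1 a x, chart_inv L2 b y, chart_inv L3 c z)"
proof -
  have "(y, z) \<in> chart (prod_manifold L2 L3) (b, c) ` cdom (prod_manifold L2 L3) (b, c)"
    using assms by (auto simp: prod_manifold_def)
  then show ?thesis
    using assms by (simp add: chart_inv_prod A.charted_axioms B.charted_axioms C.charted_axioms charted_prod)
qed

lemma warping:
  "smooth_function L1 \<phi>1" "smooth_function L1 \<phi>2" "\<phi>1 a > 0" "\<phi>2 a > 0"
  using biwarped unfolding biwarped_product_submanifold_def warping_function_def by auto

section \<open>Derivatives of the warped metric\<close>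

definition dln1 :: "'a \<Rightarrow> 'e1 \<Rightarrow> real" where "dln1 = dfun L1 (\<lambda>a. ln (\<phi>1 a))"
definition dln2 :: "'a \<Rightarrow> 'e1 \<Rightarrow> real" where "dln2 = dfun L1 (\<lambda>a. ln (\<phi>2 a))"

text \<open>The square is differentiated as twice itself times the logarithmic derivative, the form
  in which the warping enters the Koszul formula.\<close>

lemma warping_has_derivative:
  assumes "smooth_function L1 \<phi>" "\<And>a. \<phi> a > 0"
  shows "((\<lambda>y. ln (\<phi> (chart_inv L1 a y))) has_derivative dfun L1 (\<lambda>a. ln (\<phi> a)) a) (at (chart L1 a a))"
    and "((\<lambda>y. (\<phi> (chart_inv L1 a y))\<^sup>2) has_derivative
      (\<lambda>u. 2 * (\<phi> a)\<^sup>2 * dfun L1 (\<lambda>a. ln (\<phi> a)) a u)) (at (chart L1 a a))"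
proof -
  have "Ck_on (Suc 0) (chart L1 a ` cdom L1 a) (\<phi> \<circ> chart_inv L1 a)"
    using assms(1) unfolding smooth_function_def smooth_on_def by blast
  then have "(\<phi> \<circ> chart_inv L1 a) differentiable (at (chart L1 a a))"
    using A.centre unfolding Ck_on.simps by blast
  then obtain D where D: "((\<lambda>y. \<phi> (chart_inv L1 a y)) has_derivative D) (at (chart L1 a a))"
    unfolding differentiable_def o_def by blast
  have c: "chart_inv L1 a (chart L1 a a) = a" by (simp add: A.inv_chart A.centre)
  have ln: "((\<lambda>y. ln (\<phi> (chart_inv L1 a y))) has_derivative (\<lambda>u. D u / \<phi> a)) (at (chart L1 a a))"
    using has_derivative_ln[OF _ D] assms(2) by (simp add: c divide_inverse mult.commute)
  then have eq: "dfun L1 (\<lambda>a. ln (\<phi> a)) a = (\<lambda>u. D u / \<phi> a)"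
    unfolding dfun_def o_def by (simp flip: frechet_derivative_at)
  show "((\<lambda>y. ln (\<phi> (chart_inv L1 a y))) has_derivative dfun L1 (\<lambda>a. ln (\<phi> a)) a) (at (chart L1 a a))"
    unfolding eq by (rule ln)
  have "\<phi> a \<noteq> 0" using assms(2)[of a] by simp
  then have "(\<lambda>u. 2 * (\<phi> a)\<^sup>2 * dfun L1 (\<lambda>a. ln (\<phi> a)) a u) = (\<lambda>u. \<phi> a * D u + D u * \<phi> a)"
    unfolding eq by (auto simp: power2_eq_square)
  with has_derivative_mult[OF D D] show "((\<lambda>y. (\<phi> (chart_inv L1 a y))\<^sup>2) has_derivative
      (\<lambda>u. 2 * (\<phi> a)\<^sup>2 * dfun L1 (\<lambda>a. ln (\<phi> a)) a u)) (at (chart L1 a a))"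
    by (simp add: power2_eq_square c)
qed

lemma dln_has_derivative:
  "((\<lambda>y. ln (\<phi>1 (chart_inv L1 a y))) has_derivative dln1 a) (at (chart L1 a a))"
  "((\<lambda>y. ln (\<phi>2 (chart_inv L1 a y))) has_derivative dln2 a) (at (chart L1 a a))"
  unfolding dln1_def dln2_def using warping_has_derivative(1) warping by blast+

lemma linear_dln: "linear (dln1 a)" "linear (dln2 a)"
  using dln_has_derivative has_derivative_linear by blast+

lemma open_box: "open (chart L1 a ` cdom L1 a \<times> chart L2 b ` cdom L2 b \<times> chart L3 c ` cdom L3 c)"
  by (intro open_Times A.open_image B.open_image C.open_image)

lemma centre_box: "(chart L1 a a, chart L2 b b, chart L3 c c) \<in>
    chart L1 a ` cdom L1 a \<times> chart L2 b ` cdom L2 b \<times> chart L3 c ` cdom L3 c"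
  using A.centre B.centre C.centre by auto

lemma compose_component_has_derivative:
  fixes z :: "'x::real_normed_vector \<times> 'y::real_normed_vector \<times> 'z::real_normed_vector"
  shows "(k1 has_derivative k1') (at (fst z)) \<Longrightarrow>
      ((\<lambda>z. k1 (fst z)) has_derivative (\<lambda>u. k1' (fst u))) (at z)"
    and "(k2 has_derivative k2') (at (fst (snd z))) \<Longrightarrow>
      ((\<lambda>z. k2 (fst (snd z))) has_derivative (\<lambda>u. k2' (fst (snd u)))) (at z)"
    and "(k3 has_derivative k3') (at (snd (snd z))) \<Longrightarrow>
      ((\<lambda>z. k3 (snd (snd z))) has_derivative (\<lambda>u. k3' (snd (snd u)))) (at z)"
  by (rule has_derivative_compose, (intro has_derivative_fst has_derivative_snd has_derivative_ident), assumption)+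

lemma dfun_L:
  "dfun L (\<lambda>(a, b, c). ln (\<phi>1 a)) (a, b, c) (u, v, w) = dln1 a u"
  "dfun L (\<lambda>(a, b, c). ln (\<phi>2 a)) (a, b, c) (u, v, w) = dln2 a u"
proof -
  have "dfun L (\<lambda>(a, b, c). k a) (a, b, c) (u, v, w) = k' u"
    if "((\<lambda>y. k (chart_inv L1 a y)) has_derivative k') (at (chart L1 a a))" for k k'
  proof -
    have "((\<lambda>y. k (chart_inv L1 a (fst y))) has_derivative (\<lambda>u. k' (fst u)))
        (at (chart L1 a a, chart L2 b b, chart L3 c c))"
      by (rule compose_component_has_derivative) (simp add: that)
    then have "((\<lambda>(a, b, c). k a) \<circ> chart_inv L (a, b, c) has_derivative (\<lambda>u. k' (fst u)))
        (at (chart L1 a a, chart L2 b b, chart L3 c c))"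
      by (rule has_derivative_transform_within_open[OF _ open_box centre_box])
        (auto simp: chart_inv_L)
    from frechet_derivative_at[OF this, symmetric] show ?thesis
      unfolding dfun_def chart_L by simp
  qed
  from this[OF dln_has_derivative(1)] this[OF dln_has_derivative(2)]
  show "dfun L (\<lambda>(a, b, c). ln (\<phi>1 a)) (a, b, c) (u, v, w) = dln1 a u"
    "dfun L (\<lambda>(a, b, c). ln (\<phi>2 a)) (a, b, c) (u, v, w) = dln2 a u" .
qed

lemma pb_metric_rep:
  assumes "x \<in> chart L1 a ` cdom L1 a" "y \<in> chart L2 b ` cdom L2 b" "z \<in> chart L3 c ` cdom L3 c"
  shows "metric_rep L (a, b, c) pb (v1, v2, v3) (w1, w2, w3) (x, y, z) =
    metric_rep L1 a g1 v1 w1 x + (\<phi>1 (chart_inv L1 a x))\<^sup>2 * metric_rep L2 b g2 v2 w2 y +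
    (\<phi>2 (chart_inv L1 a x))\<^sup>2 * metric_rep L3 c g3 v3 w3 z"
  using assms A.chart_inv_mem B.chart_inv_mem C.chart_inv_mem
  unfolding metric_rep_def Let_def by (simp add: chart_inv_L coord_change_L pb_eq)

definition dpb :: "'a \<times> 'b \<times> 'c \<Rightarrow> 'e1 \<times> 'e2 \<times> 'e3 \<Rightarrow> 'e1 \<times> 'e2 \<times> 'e3 \<Rightarrow> 'e1 \<times> 'e2 \<times> 'e3 \<Rightarrow> real" where
  "dpb x u v w = frechet_derivative (metric_rep L x pb v w) (at (chart L x x)) u"

text \<open>In a product chart each factor metric depends on its own coordinates; only the squared
  warping functions couple them, through the base component \<open>u1\<close>. Inserting axis
  vectors yields the warped product formulas below.\<close>

lemma dpb_eq:
  "dpb (a, b, c) (u1, u2, u3) (v1, v2, v3) (w1, w2, w3) =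
    (g1 a (A.\<Gamma> a u1 v1) w1 + g1 a v1 (A.\<Gamma> a u1 w1)) +
    (\<phi>1 a)\<^sup>2 * (g2 b (B.\<Gamma> b u2 v2) w2 + g2 b v2 (B.\<Gamma> b u2 w2) + 2 * dln1 a u1 * g2 b v2 w2) +
    (\<phi>2 a)\<^sup>2 * (g3 c (C.\<Gamma> c u3 v3) w3 + g3 c v3 (C.\<Gamma> c u3 w3) + 2 * dln2 a u1 * g3 c v3 w3)"
proof -
  let ?x = "(a, b, c)"
  let ?z = "(chart L1 a a, chart L2 b b, chart L3 c c)"
  let ?D1 = "\<lambda>u. g1 a (A.\<Gamma> a u v1) w1 + g1 a v1 (A.\<Gamma> a u w1)"
  let ?D2 = "\<lambda>u. g2 b (B.\<Gamma> b u v2) w2 + g2 b v2 (B.\<Gamma> b u w2)"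
  let ?D3 = "\<lambda>u. g3 c (C.\<Gamma> c u v3) w3 + g3 c v3 (C.\<Gamma> c u w3)"
  note W1 = warping_has_derivative(2)[OF warping(1,3), of a, folded dln1_def]
    and W2 = warping_has_derivative(2)[OF warping(2,4), of a, folded dln2_def]
  have "((\<lambda>y. metric_rep L1 a g1 v1 w1 (fst y) +
      (\<phi>1 (chart_inv L1 a (fst y)))\<^sup>2 * metric_rep L2 b g2 v2 w2 (fst (snd y)) +
      (\<phi>2 (chart_inv L1 a (fst y)))\<^sup>2 * metric_rep L3 c g3 v3 w3 (snd (snd y)))
    has_derivative (\<lambda>u. ?D1 (fst u) +
      ((\<phi>1 (chart_inv L1 a (fst ?z)))\<^sup>2 * ?D2 (fst (snd u)) +
        (2 * (\<phi>1 a)\<^sup>2 * dln1 a (fst u)) * metric_rep L2 b g2 v2 w2 (fst (snd ?z))) +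
      ((\<phi>2 (chart_inv L1 a (fst ?z)))\<^sup>2 * ?D3 (snd (snd u)) +
        (2 * (\<phi>2 a)\<^sup>2 * dln2 a (fst u)) * metric_rep L3 c g3 v3 w3 (snd (snd ?z))))) (at ?z)"
    by (intro has_derivative_add has_derivative_mult
        compose_component_has_derivative(1)[where ?k1.0 = "metric_rep L1 a g1 v1 w1"]
        compose_component_has_derivative(2)[where ?k2.0 = "metric_rep L2 b g2 v2 w2" and k2' = ?D2]
        compose_component_has_derivative(3)[where ?k3.0 = "metric_rep L3 c g3 v3 w3" and k3' = ?D3]
        compose_component_has_derivative(1)[where ?k1.0 = "\<lambda>y. (\<phi>1 (chart_inv L1 a y))\<^sup>2"]
        compose_component_has_derivative(1)[where ?k1.0 = "\<lambda>y. (\<phi>2 (chart_inv L1 a y))\<^sup>2"])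
      (simp_all only: fst_conv snd_conv W1 W2 A.metric_rep_has_derivative B.metric_rep_has_derivative
        C.metric_rep_has_derivative)
  then have "(metric_rep L ?x pb (v1, v2, v3) (w1, w2, w3) has_derivative (\<lambda>u. ?D1 (fst u) +
      ((\<phi>1 (chart_inv L1 a (fst ?z)))\<^sup>2 * ?D2 (fst (snd u)) +
        (2 * (\<phi>1 a)\<^sup>2 * dln1 a (fst u)) * metric_rep L2 b g2 v2 w2 (fst (snd ?z))) +
      ((\<phi>2 (chart_inv L1 a (fst ?z)))\<^sup>2 * ?D3 (snd (snd u)) +
        (2 * (\<phi>2 a)\<^sup>2 * dln2 a (fst u)) * metric_rep L3 c g3 v3 w3 (snd (snd ?z))))) (at ?z)"
    by (rule has_derivative_transform_within_open[OF _ open_box centre_box])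
      (auto simp: pb_metric_rep)
  from frechet_derivative_at[OF this, symmetric] show ?thesis
    unfolding dpb_def chart_L
    by (simp add: A.inv_chart A.centre B.metric_rep_centre C.metric_rep_centre algebra_simps)
qed

lemma hess_cov_df:
  "g (\<psi> x) (hess_cov x u v) (df x w) = (dpb x u v w + dpb x v u w - dpb x w u v) / 2"
  unfolding dpb_def by (rule hess_cov_koszul)

section \<open>Leaves of the product\<close>

lemma
  shows immersed_leaf1: "immersed L1 M g (leaf1 \<psi> b c)"
    and df_leaf1: "dmap L1 M (leaf1 \<psi> b c) a u = df (a, b, c) (u, 0, 0)"
    and hess_cov_leaf1: "immersed.hess_cov L1 M g (leaf1 \<psi> b c) a u v =
      hess_cov (a, b, c) (u, 0, 0) (v, 0, 0)"
proof -
  have "linear (\<lambda>u::'e1. (u, 0::'e2, 0::'e3))" "inj (\<lambda>u::'e1. (u, 0::'e2, 0::'e3))"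
    by (auto intro: linearI injI)
  note S = slice[of L1 "\<lambda>a. (a, b, c)" "\<lambda>u. (u, 0, 0)" "\<lambda>_. (0, chart L2 b b, chart L3 c c)",
      OF A.charted_axioms _ this]
  show "immersed L1 M g (leaf1 \<psi> b c)"
    "dmap L1 M (leaf1 \<psi> b c) a u = df (a, b, c) (u, 0, 0)"
    "immersed.hess_cov L1 M g (leaf1 \<psi> b c) a u v = hess_cov (a, b, c) (u, 0, 0) (v, 0, 0)"
    unfolding leaf1_def
    by (rule S; auto intro!: continuous_intros simp: cdom_L chart_L B.centre C.centre)+
qed

lemma
  shows immersed_leaf2: "immersed L2 M g (leaf2 \<psi> a c)"
    and df_leaf2: "dmap L2 M (leaf2 \<psi> a c) b u = df (a, b, c) (0, u, 0)"
    and hess_cov_leaf2: "immersed.hess_cov L2 M g (leaf2 \<psi> a c) b u v =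
      hess_cov (a, b, c) (0, u, 0) (0, v, 0)"
proof -
  have "linear (\<lambda>u::'e2. (0::'e1, u, 0::'e3))" "inj (\<lambda>u::'e2. (0::'e1, u, 0::'e3))"
    by (auto intro: linearI injI)
  note S = slice[of L2 "\<lambda>b. (a, b, c)" "\<lambda>u. (0, u, 0)" "\<lambda>_. (chart L1 a a, 0, chart L3 c c)",
      OF B.charted_axioms _ this]
  show "immersed L2 M g (leaf2 \<psi> a c)"
    "dmap L2 M (leaf2 \<psi> a c) b u = df (a, b, c) (0, u, 0)"
    "immersed.hess_cov L2 M g (leaf2 \<psi> a c) b u v = hess_cov (a, b, c) (0, u, 0) (0, v, 0)"
    unfolding leaf2_def
    by (rule S; auto intro!: continuous_intros simp: cdom_L chart_L A.centre C.centre)+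
qed

lemma
  shows immersed_leaf3: "immersed L3 M g (leaf3 \<psi> a b)"
    and df_leaf3: "dmap L3 M (leaf3 \<psi> a b) c u = df (a, b, c) (0, 0, u)"
    and hess_cov_leaf3: "immersed.hess_cov L3 M g (leaf3 \<psi> a b) c u v =
      hess_cov (a, b, c) (0, 0, u) (0, 0, v)"
proof -
  have "linear (\<lambda>u::'e3. (0::'e1, 0::'e2, u))" "inj (\<lambda>u::'e3. (0::'e1, 0::'e2, u))"
    by (auto intro: linearI injI)
  note S = slice[of L3 "\<lambda>c. (a, b, c)" "\<lambda>u. (0, 0, u)" "\<lambda>_. (chart L1 a a, chart L2 b b, 0)",
      OF C.charted_axioms _ this]
  show "immersed L3 M g (leaf3 \<psi> a b)"
    "dmap L3 M (leaf3 \<psi> a b) c u = df (a, b, c) (0, 0, u)"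
    "immersed.hess_cov L3 M g (leaf3 \<psi> a b) c u v = hess_cov (a, b, c) (0, 0, u) (0, 0, v)"
    unfolding leaf3_def
    by (rule S; auto intro!: continuous_intros simp: cdom_L chart_L A.centre B.centre)+
qed


lemmas form_zeros = inner_form.zero_left[OF A.inner] inner_form.zero_right[OF A.inner]
  inner_form.zero_left[OF B.inner] inner_form.zero_right[OF B.inner]
  inner_form.zero_left[OF C.inner] inner_form.zero_right[OF C.inner]
  bilinear_lzero[OF A.bilinear_christoffel] bilinear_rzero[OF A.bilinear_christoffel]
  bilinear_lzero[OF B.bilinear_christoffel] bilinear_rzero[OF B.bilinear_christoffel]
  bilinear_lzero[OF C.bilinear_christoffel] bilinear_rzero[OF C.bilinear_christoffel]
  linear_0[OF linear_dln(1)] linear_0[OF linear_dln(2)]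

lemma g_df: "g (\<psi> x) (df x u) (df x v) = pb x u v"
  by (simp add: pullback_metric_def)

lemma df_zero: "df x (0, 0, 0) = 0"
  using linear_0[OF linear_df, of x] by (simp add: zero_prod_def)

text \<open>Changes of product charts are block diagonal. This supplies the orthogonality on a whole
  chart that the Leibniz lemmas require.\<close>

lemma coord_change_L_axis:
  assumes "q \<in> cdom L (a, b, c)"
  shows "\<exists>u'. coord_change L (a, b, c) q q (u, 0, 0) = (u', 0, 0)"
    "\<exists>v'. coord_change L (a, b, c) q q (0, v, 0) = (0, v', 0)"
    "\<exists>w'. coord_change L (a, b, c) q q (0, 0, w) = (0, 0, w')"
  using assms linear_0[OF A.linear_coord_change] linear_0[OF B.linear_coord_change]
    linear_0[OF C.linear_coord_change] A.centre B.centre C.centre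
  by (auto simp: cdom_L coord_change_L)

section \<open>The action of \<Phi> on the three factors\<close>

lemma slant_angle: "0 < \<nu>" "\<nu> < pi / 2"
  using slant unfolding proper_slant_tangent_def by blast+

lemma \<xi>_tangent: "\<exists>k. df (a, b, c) (k, 0, 0) = \<xi> (\<psi> (a, b, c))"
proof -
  have "\<xi> (leaf1 \<psi> b c a) \<in> tangent_image L1 M (leaf1 \<psi> b c) a"
    using slant[of b c] unfolding proper_slant_tangent_def slant_tangent_def by blast
  then obtain k where "\<xi> (leaf1 \<psi> b c a) = dmap L1 M (leaf1 \<psi> b c) a k"
    unfolding tangent_image_def by blast
  then show ?thesis unfolding df_leaf1 by (metis leaf1_def)
qed

text \<open>\<open>v\<close> is the coordinate vector of T U. The base leaf carries the metric
  \<open>g1\<close>, so no warping factor enters its length. The zero vector lies in the span of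
  \<xi>, outside the slant condition, and is treated apart.\<close>

lemma \<Phi>_slant_part:
  assumes "g (\<psi> (a, b, c)) (df (a, b, c) (u, 0, 0)) (\<xi> (\<psi> (a, b, c))) = 0"
  obtains v where
    "\<And>w. g (\<psi> (a, b, c)) (\<Phi> (\<psi> (a, b, c)) (df (a, b, c) (u, 0, 0)) - df (a, b, c) (v, 0, 0))
      (df (a, b, c) (w, 0, 0)) = 0"
    "g1 a v v = (cos \<nu>)\<^sup>2 * g1 a u u"
proof -
  interpret G: inner_form "g (\<psi> (a, b, c))" by (rule inner)
  interpret l: immersed L1 M g "leaf1 \<psi> b c" by (rule immersed_leaf1)
  let ?X = "df (a, b, c) (u, 0, 0)" and ?\<xi> = "\<xi> (\<psi> (a, b, c))"
  show ?thesis
  proof (cases "?X = 0")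
    case True
    then have "u = 0" using injD[OF inj_df, of "(a, b, c)" "(u, 0, 0)" "(0, 0, 0)"] df_zero by simp
    then show ?thesis using linear_0[OF linear_\<Phi>]
      by (intro that[of 0]) (simp_all add: df_zero G.zero_left form_zeros)
  next
    case False
    have "?X \<notin> span {?\<xi>}"
    proof
      assume "?X \<in> span {?\<xi>}"
      then obtain r where "?X = r *\<^sub>R ?\<xi>" by (auto simp: span_singleton)
      then show False using assms False by (simp add: G.scale_left g_\<xi>_\<xi>)
    qed
    moreover have "?X \<in> tangent_image L1 M (leaf1 \<psi> b c) a"
      unfolding tangent_image_def by (auto simp: df_leaf1)
    ultimately have "angle_to_subspace (g (leaf1 \<psi> b c a)) (\<Phi> (leaf1 \<psi> b c a) ?X)
        (tangent_image L1 M (leaf1 \<psi> b c) a) = \<nu>"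
      using slant[of b c] unfolding proper_slant_tangent_def slant_tangent_def by (simp add: leaf1_def)
    then have "angle_to_subspace (g (\<psi> (a, b, c))) (\<Phi> (\<psi> (a, b, c)) ?X) (range (l.df a)) = \<nu>"
      by (simp add: tangent_image_def leaf1_def)
    then obtain v where v: "\<And>w. g (\<psi> (a, b, c)) (\<Phi> (\<psi> (a, b, c)) ?X - l.df a v) (l.df a w) = 0"
      "g (\<psi> (a, b, c)) (l.df a v) (l.df a v) =
        (cos \<nu>)\<^sup>2 * g (\<psi> (a, b, c)) (\<Phi> (\<psi> (a, b, c)) ?X) (\<Phi> (\<psi> (a, b, c)) ?X)"
      by (rule G.angle_to_range[OF l.linear_df l.inj_df]) blast
    have "g1 a v v = (cos \<nu>)\<^sup>2 * g1 a u u"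
      using v(2) assms by (simp add: df_leaf1 g_\<Phi>_\<Phi> \<eta>_eq g_df pb_eq form_zeros)
    with v(1) show ?thesis by (intro that[of v]) (simp_all add: df_leaf1)
  qed
qed

text \<open>Angle zero means that the projection of \<Phi> X to the leaf has full length, so the
  residual has length zero.\<close>

lemma \<Phi>_invariant: "\<exists>w. \<Phi> (\<psi> (a, b, c)) (df (a, b, c) (0, v, 0)) = df (a, b, c) (0, w, 0)"
  and \<xi>_orthogonal2: "g (\<psi> (a, b, c)) (df (a, b, c) (0, v, 0)) (\<xi> (\<psi> (a, b, c))) = 0"
proof -
  interpret G: inner_form "g (\<psi> (a, b, c))" by (rule inner)
  interpret l: immersed L2 M g "leaf2 \<psi> a c" by (rule immersed_leaf2)
  let ?X = "df (a, b, c) (0, v, 0)" and ?p = "\<psi> (a, b, c)"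
  have mem: "?X \<in> tangent_image L2 M (leaf2 \<psi> a c) b"
    unfolding tangent_image_def by (auto simp: df_leaf2)
  note I = invar[of a c, unfolded invariant_orthogonal_def slant_orthogonal_def,
      THEN conjunct2, THEN conjunct2, rule_format, OF mem]
  show perp: "g ?p ?X (\<xi> ?p) = 0" using I by (simp add: leaf2_def)
  show "\<exists>w. \<Phi> ?p ?X = df (a, b, c) (0, w, 0)"
  proof (cases "?X = 0")
    case True
    then show ?thesis by (intro exI[of _ 0]) (simp add: df_zero linear_0[OF linear_\<Phi>])
  next
    case False
    then have "angle_to_subspace (g ?p) (\<Phi> ?p ?X) (range (l.df b)) = 0"
      using I by (simp add: tangent_image_def leaf2_def)
    then obtain w where w: "\<And>w'. g ?p (\<Phi> ?p ?X - l.df b w) (l.df b w') = 0"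
      "g ?p (l.df b w) (l.df b w) = (cos 0)\<^sup>2 * g ?p (\<Phi> ?p ?X) (\<Phi> ?p ?X)"
      by (rule G.angle_to_range[OF l.linear_df l.inj_df]) blast
    have "g ?p (\<Phi> ?p ?X - l.df b w) (\<Phi> ?p ?X - l.df b w) = 0"
      using w(1)[of w] w(2) G.sym[of "\<Phi> ?p ?X" "l.df b w"] by (simp add: G.expand)
    then show ?thesis by (auto simp: G.eq_zero_iff df_leaf2)
  qed
qed

lemma \<xi>_orthogonal3: "g (\<psi> (a, b, c)) (df (a, b, c) (0, 0, w)) (\<xi> (\<psi> (a, b, c))) = 0"
proof -
  have "df (a, b, c) (0, 0, w) \<in> tangent_image L3 M (leaf3 \<psi> a b) c"
    unfolding tangent_image_def by (auto simp: df_leaf3)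
  from anti[of a b, unfolded anti_invariant_orthogonal_def slant_orthogonal_def,
      THEN conjunct2, THEN conjunct2, rule_format, OF this]
  show ?thesis by (simp add: leaf3_def)
qed

text \<open>Anti-invariance speaks about the leaf only; orthogonality to the other two factors comes
  from \<open>normal\<close>.\<close>

lemma \<Phi>_normal: "g (\<psi> x) (\<Phi> (\<psi> x) (df x (0, 0, w))) (df x t) = 0"
  using normal[of "(0, 0, w)" x] unfolding D_perp_def normal_space_at_def tangent_image_def
  by (cases t) auto

lemma mixed_zero:
  assumes "g (\<psi> x) (df x (u, 0, 0)) (\<xi> (\<psi> x)) = 0"
  shows "\<Sigma> x (0, 0, w) (u, 0, 0) = 0"
  using assms by (intro mixed) (auto simp: D_perp_def D_slant_def)

text \<open>For a fibre field X, differentiate g(\<xi>, X) = 0 along X. The derivative of \<xi>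
  contributes \<beta> |X|^2; by Koszul, the derivative of X contributes - |X|^2 times the
  logarithmic derivative of the warping function along \<open>k\<close>.\<close>

lemma dln_\<xi>:
  assumes k: "df (a, b, c) (k, 0, 0) = \<xi> (\<psi> (a, b, c))"
  shows "dln1 a k = \<beta> (\<psi> (a, b, c))" "dln2 a k = \<beta> (\<psi> (a, b, c))"
proof -
  let ?x = "(a, b, c)"
  interpret G: inner_form "g (\<psi> ?x)" by (rule inner)
  have \<xi>: "g (\<psi> ?x) (\<xi> (\<psi> ?x)) (hess_cov ?x s t) = g (\<psi> ?x) (hess_cov ?x s t) (df ?x (k, 0, 0))" for s t
    unfolding k by (rule G.sym)
  \<comment> \<open>Model spaces have positive dimension, so a fibre direction exists.\<close>
  obtain v :: 'e2 where "v \<noteq> 0" using nonzero_Basis nonempty_Basis by blast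
  then have v: "(\<phi>1 a)\<^sup>2 * g2 b v v > 0" using inner_form.pos[OF B.inner] warping(3)[of a] by simp
  have "\<beta> (\<psi> ?x) * g (\<psi> ?x) (df ?x (0, v, 0)) (df ?x (0, v, 0)) +
      g (\<psi> ?x) (\<xi> (\<psi> ?x)) (hess_cov ?x (0, v, 0) (0, v, 0)) = 0"
  proof (rule \<xi>_orthogonal_derivative)
    fix q assume "q \<in> cdom L ?x"
    then show "g (\<psi> q) (\<xi> (\<psi> q)) (df q (coord_change L ?x q q (0, v, 0))) = 0"
      using coord_change_L_axis(2)[of q a b c v] \<xi>_orthogonal2 inner_form.sym[OF inner]
      by (cases q) (metis (no_types, lifting))
  qed
  then have "\<beta> (\<psi> ?x) * ((\<phi>1 a)\<^sup>2 * g2 b v v) = dln1 a k * ((\<phi>1 a)\<^sup>2 * g2 b v v)"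
    unfolding \<xi> hess_cov_df g_df by (simp add: pb_eq dpb_eq form_zeros)
  then show "dln1 a k = \<beta> (\<psi> ?x)" using v by auto
  obtain w :: 'e3 where "w \<noteq> 0" using nonzero_Basis nonempty_Basis by blast
  then have w: "(\<phi>2 a)\<^sup>2 * g3 c w w > 0" using inner_form.pos[OF C.inner] warping(4)[of a] by simp
  have "\<beta> (\<psi> ?x) * g (\<psi> ?x) (df ?x (0, 0, w)) (df ?x (0, 0, w)) +
      g (\<psi> ?x) (\<xi> (\<psi> ?x)) (hess_cov ?x (0, 0, w) (0, 0, w)) = 0"
  proof (rule \<xi>_orthogonal_derivative)
    fix q assume "q \<in> cdom L ?x"
    then show "g (\<psi> q) (\<xi> (\<psi> q)) (df q (coord_change L ?x q q (0, 0, w))) = 0"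
      using coord_change_L_axis(3)[of q a b c w] \<xi>_orthogonal3 inner_form.sym[OF inner]
      by (cases q) (metis (no_types, lifting))
  qed
  then have "\<beta> (\<psi> ?x) * ((\<phi>2 a)\<^sup>2 * g3 c w w) = dln2 a k * ((\<phi>2 a)\<^sup>2 * g3 c w w)"
    unfolding \<xi> hess_cov_df g_df by (simp add: pb_eq dpb_eq form_zeros)
  then show "dln2 a k = \<beta> (\<psi> ?x)" using w by auto
qed

lemma dln1_orthogonal:
  assumes u: "g (\<psi> (a, b, c)) (df (a, b, c) (u, 0, 0)) (\<xi> (\<psi> (a, b, c))) = 0"
  shows "dln1 a u = 0"
proof -
  let ?x = "(a, b, c)" and ?p = "\<psi> (a, b, c)"
  let ?U = "df ?x (u, 0, 0)"
  interpret G: inner_form "g ?p" by (rule inner)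
  have key: "g ?p (hess_cov ?x (0, v, 0) (0, w, 0)) (\<Phi> ?p ?U) = dln1 a u * g ?p (df ?x (0, v, 0)) (\<Phi> ?p (df ?x (0, w, 0)))"
    for v w
  proof -
    obtain w' where w': "\<Phi> ?p (df ?x (0, w, 0)) = df ?x (0, w', 0)" using \<Phi>_invariant by blast
    have "g ?p (\<Phi> ?p (hess_cov ?x (0, v, 0) (0, w, 0)) + \<beta> ?p *\<^sub>R
        (g ?p (\<Phi> ?p (df ?x (0, v, 0))) (df ?x (0, w, 0)) *\<^sub>R \<xi> ?p -
          \<eta> ?p (df ?x (0, w, 0)) *\<^sub>R \<Phi> ?p (df ?x (0, v, 0)))) ?U +
      g ?p (\<Phi> ?p (df ?x (0, w, 0))) (hess_cov ?x (0, v, 0) (u, 0, 0)) = 0"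
    proof (rule \<Phi>_orthogonal_derivative)
      \<comment> \<open>Away from the centre the coordinate field of \<open>u\<close> may cease to
        be orthogonal to \<xi>. It stays tangent to the first factor, which is orthogonal to the
        \<Phi>-invariant second factor.\<close>
      fix q assume q: "q \<in> cdom L ?x"
      obtain a' b' c' where q': "q = (a', b', c')" by (cases q)
      obtain v' u' where "coord_change L ?x q q (0, w, 0) = (0, v', 0)" "coord_change L ?x q q (u, 0, 0) = (u', 0, 0)"
        using coord_change_L_axis[OF q] by blast
      moreover obtain v'' where "\<Phi> (\<psi> q) (df q (0, v', 0)) = df q (0, v'', 0)"
        using \<Phi>_invariant unfolding q' by blast
      ultimately show "g (\<psi> q) (\<Phi> (\<psi> q) (df q (coord_change L ?x q q (0, w, 0))))
          (df q (coord_change L ?x q q (u, 0, 0))) = 0"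
        by (simp add: g_df) (simp add: q' pb_eq form_zeros)
    qed
    \<comment> \<open>Both terms with \<beta> vanish: U is orthogonal to \<xi>, and \<eta> is zero
      on the second factor.\<close>
    then have "g ?p (hess_cov ?x (0, v, 0) (0, w, 0)) (\<Phi> ?p ?U) =
        g ?p (hess_cov ?x (0, v, 0) (u, 0, 0)) (df ?x (0, w', 0))"
      using u by (simp add: G.expand \<Phi>_skew \<eta>_eq \<xi>_orthogonal2 w' G.sym[of "\<xi> ?p"]
          G.sym[of "df ?x (0, w', 0)" "hess_cov _ _ _"])
    also have "\<dots> = dln1 a u * ((\<phi>1 a)\<^sup>2 * g2 b v w')"
      unfolding hess_cov_df by (simp add: dpb_eq form_zeros)
    finally show ?thesis unfolding w' by (simp add: g_df pb_eq form_zeros)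
  qed
  obtain w :: 'e2 where "w \<noteq> 0" using nonzero_Basis nonempty_Basis by blast
  obtain v where v: "\<Phi> ?p (df ?x (0, w, 0)) = df ?x (0, v, 0)" using \<Phi>_invariant by blast
  let ?X = "df ?x (0, w, 0)"
  \<comment> \<open>\<open>v\<close> is the coordinate vector of \<Phi> X. Symmetry of
    \<open>hess_cov\<close> equates the two instances of \<open>key\<close>, and skewness of \<Phi>
    makes their right sides opposite.\<close>
  have "dln1 a u * g ?p (\<Phi> ?p ?X) (\<Phi> ?p ?X) = dln1 a u * g ?p ?X (\<Phi> ?p (\<Phi> ?p ?X))"
    using key[of v w] key[of w v] hess_cov_sym[of ?x "(0, v, 0)"] by (auto simp: v)
  also have "g ?p ?X (\<Phi> ?p (\<Phi> ?p ?X)) = - g ?p (\<Phi> ?p ?X) (\<Phi> ?p ?X)"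
    by (simp add: \<Phi>_skew)
  finally have "dln1 a u * g ?p (\<Phi> ?p ?X) (\<Phi> ?p ?X) = 0" by simp
  moreover have "g ?p (\<Phi> ?p ?X) (\<Phi> ?p ?X) = (\<phi>1 a)\<^sup>2 * g2 b w w"
    by (simp add: g_\<Phi>_\<Phi> \<eta>_eq \<xi>_orthogonal2 g_df pb_eq form_zeros)
  moreover have "\<dots> > 0" using \<open>w \<noteq> 0\<close> inner_form.pos[OF B.inner] warping(3)[of a] by simp
  ultimately show ?thesis by auto
qed

text \<open>\<open>v\<close> is obtained by projecting \<Phi> U to the base leaf alone. Since \<Phi>
  preserves the second factor and makes the third normal, \<Phi> U has no component in these
  factors; the difference is F U, normal to the whole product.\<close>

lemma
  assumes u: "g (\<psi> (a, b, c)) (df (a, b, c) (u, 0, 0)) (\<xi> (\<psi> (a, b, c))) = 0"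
    and v: "\<And>w. g (\<psi> (a, b, c)) (\<Phi> (\<psi> (a, b, c)) (df (a, b, c) (u, 0, 0)) - df (a, b, c) (v, 0, 0))
      (df (a, b, c) (w, 0, 0)) = 0"
  shows \<Phi>_slant_normal: "g (\<psi> (a, b, c))
      (\<Phi> (\<psi> (a, b, c)) (df (a, b, c) (u, 0, 0)) - df (a, b, c) (v, 0, 0)) (df (a, b, c) t) = 0"
    and \<Sigma>_perp: "g (\<psi> (a, b, c)) (\<Sigma> (a, b, c) (0, 0, z) (0, 0, w))
      (\<Phi> (\<psi> (a, b, c)) (df (a, b, c) (u, 0, 0)) - df (a, b, c) (v, 0, 0)) =
      pb (a, b, c) (0, 0, z) (0, 0, w) * dln2 a v"
proof -
  let ?x = "(a, b, c)" and ?p = "\<psi> (a, b, c)"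
  let ?U = "df ?x (u, 0, 0)" and ?V = "df ?x (v, 0, 0)"
  interpret G: inner_form "g ?p" by (rule inner)
  interpret d: linear "df ?x" by (rule linear_df)
  have n: "g ?p (\<Phi> ?p ?U - ?V) (df ?x t) = 0" for t
  proof -
    obtain t1 t2 t3 where t: "t = (t1, t2, t3)" by (cases t)
    have "df ?x t = df ?x (t1, 0, 0) + df ?x (0, t2, 0) + df ?x (0, 0, t3)"
      unfolding t by (simp flip: d.add)
    moreover obtain w2 where "\<Phi> ?p (df ?x (0, t2, 0)) = df ?x (0, w2, 0)" using \<Phi>_invariant by blast
    then have "g ?p (\<Phi> ?p ?U) (df ?x (0, t2, 0)) = 0"
      by (simp add: \<Phi>_skew g_df) (simp add: pb_eq form_zeros)
    moreover have "g ?p (\<Phi> ?p ?U) (df ?x (0, 0, t3)) = 0"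
      using \<Phi>_normal[of ?x t3 "(u, 0, 0)"] by (simp add: \<Phi>_skew G.sym[of ?U])
    moreover have "g ?p ?V (df ?x (0, t2, 0)) = 0" "g ?p ?V (df ?x (0, 0, t3)) = 0"
      by (simp_all add: g_df) (simp_all add: pb_eq form_zeros)
    ultimately show ?thesis using v[of t1] by (simp add: G.add_right G.diff_left)
  qed
  then show "g ?p (\<Phi> ?p ?U - ?V) (df ?x t) = 0" .
  let ?Z = "(0, 0, z)" and ?W = "(0, 0, w)"
  have "g ?p (\<Phi> ?p (hess_cov ?x ?Z ?W) + \<beta> ?p *\<^sub>R
      (g ?p (\<Phi> ?p (df ?x ?Z)) (df ?x ?W) *\<^sub>R \<xi> ?p - \<eta> ?p (df ?x ?W) *\<^sub>R \<Phi> ?p (df ?x ?Z))) ?U +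
    g ?p (\<Phi> ?p (df ?x ?W)) (hess_cov ?x ?Z (u, 0, 0)) = 0"
  proof (rule \<Phi>_orthogonal_derivative)
    fix q assume q: "q \<in> cdom L ?x"
    then obtain w' where "coord_change L ?x q q ?W = (0, 0, w')"
      using coord_change_L_axis by blast
    then show "g (\<psi> q) (\<Phi> (\<psi> q) (df q (coord_change L ?x q q ?W)))
        (df q (coord_change L ?x q q (u, 0, 0))) = 0"
      by (simp add: \<Phi>_normal)
  qed
  \<comment> \<open>Mixed total geodesy makes the derivative of U along Z tangent to the product,
    hence orthogonal to \<Phi> W.\<close>
  moreover have "hess_cov ?x ?Z (u, 0, 0) = df ?x (christoffel L pb ?x ?Z (u, 0, 0))"
    using \<Sigma>_eq[of ?x ?Z "(u, 0, 0)"] mixed_zero[OF u] by simp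
  then have "g ?p (\<Phi> ?p (df ?x ?W)) (hess_cov ?x ?Z (u, 0, 0)) = 0"
    by (simp add: \<Phi>_normal)
  ultimately have "g ?p (\<Phi> ?p (hess_cov ?x ?Z ?W)) ?U = 0"
    using u by (simp add: G.expand \<Phi>_normal \<eta>_eq \<xi>_orthogonal3 G.sym[of "\<xi> ?p"])
  then have "g ?p (hess_cov ?x ?Z ?W) (\<Phi> ?p ?U) = 0"
    by (simp add: \<Phi>_skew)
  \<comment> \<open>This tangential term comes from the derivative of the squared warping function.
    As the product with \<Phi> U = T U + F U is zero, it reappears with opposite sign along F
    U.\<close>
  moreover have "g ?p (hess_cov ?x ?Z ?W) ?V = - pb ?x ?Z ?W * dln2 a v"
    unfolding hess_cov_df by (simp add: dpb_eq pb_eq form_zeros)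
  moreover have "g ?p (df ?x (christoffel L pb ?x ?Z ?W)) (\<Phi> ?p ?U - ?V) = 0"
    using n G.sym by metis
  ultimately show "g ?p (\<Sigma> ?x ?Z ?W) (\<Phi> ?p ?U - ?V) = pb ?x ?Z ?W * dln2 a v"
    unfolding \<Sigma>_eq G.diff_left[of _ "df ?x _"] by (simp add: G.diff_right)
qed

end

text \<open>The trace over an orthonormal basis consists of \<open>DIM('f)\<close> copies of
  \<open>c\<close>, which forces \<open>c\<close> to be the mean curvature.\<close>

lemma (in immersed) totally_umbilicalI:
  assumes "\<And>x. \<exists>c. \<forall>u v. \<Sigma> x u v = pb x u v *\<^sub>R c"
  shows "totally_umbilical N M g f"
proof -
  have "mean_curvature N M g f x = c" if c: "\<And>u v. \<Sigma> x u v = pb x u v *\<^sub>R c" for x c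
  proof -
    interpret p: inner_form "pb x" by (rule inner_pb)
    let ?B = "some_onb (pb x)"
    have "(\<Sum>e\<in>?B. \<Sigma> x e e) = (\<Sum>e\<in>?B. c)"
      using p.some_onb unfolding orthonormal_basis_def by (intro sum.cong refl) (auto simp: c)
    also have "\<dots> = real (card ?B) *\<^sub>R c" by (rule sum_constant_scaleR)
    finally show ?thesis unfolding mean_curvature_def using p.onb_card[OF p.some_onb] by simp
  qed
  then show ?thesis unfolding totally_umbilical_def using assms by metis
qed

lemma bilinear_eq_0_span:
  assumes D: "bilinear D" and B: "span B = UNIV" and zero: "\<And>u v. u \<in> B \<Longrightarrow> v \<in> B \<Longrightarrow> D u v = 0"
  shows "D u v = 0"
proof -
  have 1: "D u v = 0" if "v \<in> B" for v
    using linear_eq_0_on_span[of "\<lambda>u. D u v" B u] D B zero[OF _ that] by (auto simp: bilinear_def)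
  show ?thesis
    using linear_eq_0_on_span[of "D u" B v] D B 1 by (auto simp: bilinear_def)
qed

section \<open>Gradients and the estimate of the norm\<close>

context biwarped_slant
begin

lemma grad_norm_sq_eq:
  assumes "\<And>v. dfun L k x v = pb x n v"
  shows "grad_norm_sq L pb k x = pb x n n"
proof -
  interpret p: inner_form "pb x" by (rule inner_pb)
  show ?thesis
    unfolding grad_norm_sq_def assms using p.onb_parseval[OF p.some_onb, of n n]
    by (simp add: power2_eq_square)
qed

lemma g_\<xi>_leaf1:
  assumes "df (a, b, c) (k, 0, 0) = \<xi> (\<psi> (a, b, c))"
  shows "g (\<psi> (a, b, c)) (df (a, b, c) (u, 0, 0)) (\<xi> (\<psi> (a, b, c))) = g1 a u k"
  unfolding assms[symmetric] by (simp add: g_df) (simp add: pb_eq form_zeros)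

text \<open>\<open>dln1\<close> vanishes on the part of \<open>u\<close> orthogonal to
  \<open>k\<close> and is determined by its value at \<open>k\<close>. The vector \<open>m\<close>
  is the gradient of ln \<phi>2; it is horizontal because the warped metric restricts to
  \<open>g1\<close> on the base.\<close>

lemma ex_gradients:
  assumes k: "df (a, b, c) (k, 0, 0) = \<xi> (\<psi> (a, b, c))"
  obtains m where "\<And>u. dln1 a u = g1 a (\<beta> (\<psi> (a, b, c)) *\<^sub>R k) u" "\<And>u. dln2 a u = g1 a m u"
    "g1 a k k = 1" "g1 a m k = \<beta> (\<psi> (a, b, c))"
proof -
  interpret h: inner_form "g1 a" by (rule A.inner)
  let ?\<beta> = "\<beta> (\<psi> (a, b, c))"
  have kk: "g1 a k k = 1" using g_\<xi>_leaf1[OF k, of k] g_\<xi>_\<xi> by (simp add: k)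
  have "dln1 a u = g1 a (?\<beta> *\<^sub>R k) u" for u
  proof -
    interpret l: linear "dln1 a" by (rule linear_dln)
    have "dln1 a (u - g1 a u k *\<^sub>R k) = 0"
      by (rule dln1_orthogonal[of a b c]) (simp add: g_\<xi>_leaf1[OF k] h.expand kk)
    then show ?thesis using dln_\<xi>(1)[OF k] by (simp add: l.diff l.scaleR h.scale_left h.sym[of k])
  qed
  moreover obtain m where m: "\<And>u. g1 a m u = dln2 a u" using h.riesz[OF linear_dln(2)] by blast
  moreover have "g1 a m k = ?\<beta>" using m dln_\<xi>(2)[OF k] by simp
  ultimately show ?thesis using kk by (intro that[of m]) simp_all
qed

text \<open>\<open>n\<close> is \<open>- csc\<^sup>2 \<nu> F T G\<close> for the component \<open>G\<close> of \<open>grad (ln \<phi>2)\<close> orthogonal to \<open>\<xi>\<close>.\<close>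

lemma \<Sigma>_perp_norm:
  obtains n where "\<And>t. g (\<psi> (a, b, c)) n (df (a, b, c) t) = 0"
    "\<And>z w. g (\<psi> (a, b, c)) (\<Sigma> (a, b, c) (0, 0, z) (0, 0, w)) (\<Sigma> (a, b, c) (0, 0, z) (0, 0, w)) =
      g (\<psi> (a, b, c))
        (\<Sigma> (a, b, c) (0, 0, z) (0, 0, w) - pb (a, b, c) (0, 0, z) (0, 0, w) *\<^sub>R n)
        (\<Sigma> (a, b, c) (0, 0, z) (0, 0, w) - pb (a, b, c) (0, 0, z) (0, 0, w) *\<^sub>R n) +
      (pb (a, b, c) (0, 0, z) (0, 0, w))\<^sup>2 * (((1 / sin \<nu>)\<^sup>2 - 1) *
        (grad_norm_sq L pb (\<lambda>(a, b, c). ln (\<phi>2 a)) (a, b, c) - (\<beta> (\<psi> (a, b, c)))\<^sup>2))"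
proof -
  let ?x = "(a, b, c)" and ?p = "\<psi> (a, b, c)"
  interpret h: inner_form "g1 a" by (rule A.inner)
  interpret G: inner_form "g ?p" by (rule inner)
  obtain k where k: "df ?x (k, 0, 0) = \<xi> ?p" using \<xi>_tangent by blast
  obtain m where m: "\<And>u. dln2 a u = g1 a m u" "g1 a k k = 1" "g1 a m k = \<beta> ?p"
    by (rule ex_gradients[OF k]) blast
  \<comment> \<open>The part of the gradient orthogonal to \<xi>. Below, \<open>u\<close> stands for
    T applied to it and \<open>v\<close> for T applied to \<open>u\<close>.\<close>
  define q where "q = m - \<beta> ?p *\<^sub>R k"
  define Q where "Q = g1 a q q"
  have qk: "g1 a q k = 0" by (simp add: q_def h.expand m)
  have "grad_norm_sq L pb (\<lambda>(a, b, c). ln (\<phi>2 a)) ?x = pb ?x (m, 0, 0) (m, 0, 0)"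
    by (rule grad_norm_sq_eq) (auto simp: dfun_L pb_eq form_zeros m(1))
  also have "\<dots> = Q + (\<beta> ?p)\<^sup>2"
    using m(2,3) by (simp add: pb_eq form_zeros Q_def q_def h.expand h.sym[of k m] power2_eq_square)
  finally have grad: "grad_norm_sq L pb (\<lambda>(a, b, c). ln (\<phi>2 a)) ?x - (\<beta> ?p)\<^sup>2 = Q" by simp
  have df1: "g ?p (df ?x (u, 0, 0)) (df ?x (v, 0, 0)) = g1 a u v" for u v
    by (simp add: g_df) (simp add: pb_eq form_zeros)
  have tangent_perp: "g1 a v k = 0"
    if "\<And>w. g ?p (\<Phi> ?p (df ?x (u, 0, 0)) - df ?x (v, 0, 0)) (df ?x (w, 0, 0)) = 0" for u v
    using that[of k] \<eta>_\<Phi>[of ?p "df ?x (u, 0, 0)"] g_\<xi>_leaf1[OF k, of v]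
    by (simp add: k G.diff_left \<eta>_eq)
  obtain u where u: "\<And>w. g ?p (\<Phi> ?p (df ?x (q, 0, 0)) - df ?x (u, 0, 0)) (df ?x (w, 0, 0)) = 0"
    "g1 a u u = (cos \<nu>)\<^sup>2 * Q"
    unfolding Q_def by (rule \<Phi>_slant_part[of a b c q]) (auto simp: g_\<xi>_leaf1[OF k] qk)
  have uk: "g ?p (df ?x (u, 0, 0)) (\<xi> ?p) = 0"
    using tangent_perp[OF u(1)] by (simp add: g_\<xi>_leaf1[OF k])
  obtain v where v: "\<And>w. g ?p (\<Phi> ?p (df ?x (u, 0, 0)) - df ?x (v, 0, 0)) (df ?x (w, 0, 0)) = 0"
    "g1 a v v = (cos \<nu>)\<^sup>2 * g1 a u u"
    by (rule \<Phi>_slant_part[OF uk]) blast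
  let ?F = "\<Phi> ?p (df ?x (u, 0, 0)) - df ?x (v, 0, 0)"
  \<comment> \<open>The factor makes \<open>g ?p n n\<close> equal to cot^2 \<nu> times
    \<open>Q\<close>, matching the coefficient of \<open>?r\<close> in \<open>g ?p ?S n\<close>.
    Nothing is divided by \<open>Q\<close>, so a gradient along \<xi> is included.\<close>
  define n where "n = - ((1 / sin \<nu>)\<^sup>2) *\<^sub>R ?F"
  have F_normal: "g ?p ?F (df ?x t) = 0" for t by (rule \<Phi>_slant_normal[OF uk v(1)])
  \<comment> \<open>T is skew, so pairing \<open>q\<close> with T T q gives minus the squared length
    of T q.\<close>
  have "dln2 a v = g1 a q v"
    using tangent_perp[OF v(1)] by (simp add: m(1) q_def h.expand h.sym[of k v])
  also have "\<dots> = g ?p (\<Phi> ?p (df ?x (u, 0, 0))) (df ?x (q, 0, 0))"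
    using v(1)[of q] h.sym[of q v] by (simp add: G.diff_left df1)
  also have "\<dots> = - g ?p (df ?x (u, 0, 0)) (df ?x (u, 0, 0))"
    using u(1)[of u] G.sym[of "df ?x (u, 0, 0)" "\<Phi> ?p (df ?x (q, 0, 0))"]
    by (simp add: \<Phi>_skew[of ?p "df ?x (u, 0, 0)"] G.diff_left)
  finally have dv: "dln2 a v = - ((cos \<nu>)\<^sup>2 * Q)" by (simp add: df1 u(2))
  have FF: "g ?p ?F ?F = (sin \<nu>)\<^sup>2 * (cos \<nu>)\<^sup>2 * Q"
  proof -
    have "g ?p ?F ?F = g ?p (\<Phi> ?p (df ?x (u, 0, 0))) (\<Phi> ?p (df ?x (u, 0, 0))) - g1 a v v"
      using F_normal[of "(v, 0, 0)"] G.sym[of "df ?x (v, 0, 0)" "\<Phi> ?p (df ?x (u, 0, 0))"]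
      by (simp add: G.diff_right G.diff_left df1)
    also have "\<dots> = g1 a u u - (cos \<nu>)\<^sup>2 * g1 a u u"
      using uk by (simp add: g_\<Phi>_\<Phi> \<eta>_eq df1 v(2))
    also have "\<dots> = (1 - (cos \<nu>)\<^sup>2) * g1 a u u" by (simp add: algebra_simps)
    finally show ?thesis by (simp add: u(2) sin_squared_eq)
  qed
  have "sin \<nu> \<noteq> 0" using slant_angle sin_gt_zero[of \<nu>] pi_gt_zero by fastforce
  then have cot: "(1 / sin \<nu>)\<^sup>2 - 1 = (cos \<nu>)\<^sup>2 * (1 / sin \<nu>)\<^sup>2"
    using sin_cos_squared_add[of \<nu>] by (simp add: power_divide field_simps)
  have nn: "g ?p n n = ((1 / sin \<nu>)\<^sup>2 - 1) * Q"
    unfolding n_def G.scale_left G.scale_right FF cot using \<open>sin \<nu> \<noteq> 0\<close>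
    by (simp add: power_divide field_simps)
  show ?thesis
  proof (rule that[of n])
    show "g ?p n (df ?x t) = 0" for t unfolding n_def G.scale_left F_normal by simp
    fix z w
    let ?S = "\<Sigma> ?x (0, 0, z) (0, 0, w)" and ?r = "pb ?x (0, 0, z) (0, 0, w)"
    \<comment> \<open>Thus \<open>?S - ?r *\<^sub>R n\<close> is orthogonal to \<open>n\<close>, and
      the norm identity is Pythagoras.\<close>
    have Sn: "g ?p ?S n = ?r * (((1 / sin \<nu>)\<^sup>2 - 1) * Q)"
      unfolding n_def G.scale_right \<Sigma>_perp[OF uk v(1)] dv cot by simp
    show "g ?p ?S ?S = g ?p (?S - ?r *\<^sub>R n) (?S - ?r *\<^sub>R n) + ?r\<^sup>2 * (((1 / sin \<nu>)\<^sup>2 - 1) *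
        (grad_norm_sq L pb (\<lambda>(a, b, c). ln (\<phi>2 a)) ?x - (\<beta> ?p)\<^sup>2))"
      unfolding grad G.diff_left G.diff_right G.scale_left G.scale_right nn G.sym[of n ?S] Sn
      by (simp add: algebra_simps power2_eq_square)
  qed
qed

lemma grad_norm_sq_ln1:
  "grad_norm_sq L pb (\<lambda>(a, b, c). ln (\<phi>1 a)) (a, b, c) = (\<beta> (\<psi> (a, b, c)))\<^sup>2"
proof -
  obtain k where k: "df (a, b, c) (k, 0, 0) = \<xi> (\<psi> (a, b, c))" using \<xi>_tangent by blast
  let ?n = "\<beta> (\<psi> (a, b, c)) *\<^sub>R k"
  obtain "\<And>u. dln1 a u = g1 a ?n u" "g1 a k k = 1" by (rule ex_gradients[OF k]) blast
  moreover from this have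
    "grad_norm_sq L pb (\<lambda>(a, b, c). ln (\<phi>1 a)) (a, b, c) = pb (a, b, c) (?n, 0, 0) (?n, 0, 0)"
    by (intro grad_norm_sq_eq) (auto simp: dfun_L pb_eq form_zeros)
  ultimately show ?thesis
    by (simp add: pb_eq form_zeros inner_form.scale_left[OF A.inner] inner_form.scale_right[OF A.inner]
        power2_eq_square)
qed

text \<open>Bases of the factors are joined, those of the fibres rescaled by the inverse warping
  functions. The vectors of the third factor are kept apart so that they can be counted.\<close>

lemma ex_adapted_onb:
  obtains B where "orthonormal_basis (pb (a, b, c)) B"
    "\<And>u. u \<in> B \<Longrightarrow> snd (snd u) = 0 \<or> (\<exists>w. u = (0, 0, w))"
    "card {u \<in> B. snd (snd u) \<noteq> 0} = DIM('e3)"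
proof -
  interpret h1: inner_form "g1 a" by (rule A.inner)
  interpret h2: inner_form "g2 b" by (rule B.inner)
  interpret h3: inner_form "g3 c" by (rule C.inner)
  obtain B1 where B1: "orthonormal_basis (g1 a) B1" using h1.ex_orthonormal_basis by blast
  obtain B2 where B2: "orthonormal_basis (g2 b) B2" using h2.ex_orthonormal_basis by blast
  obtain B3 where B3: "orthonormal_basis (g3 c) B3" using h3.ex_orthonormal_basis by blast
  define i1 :: "'e1 \<Rightarrow> 'e1 \<times> 'e2 \<times> 'e3" where "i1 u = (u, 0, 0)" for u
  define i2 :: "'e2 \<Rightarrow> 'e1 \<times> 'e2 \<times> 'e3" where "i2 v = (0, (1 / \<phi>1 a) *\<^sub>R v, 0)" for v
  define i3 :: "'e3 \<Rightarrow> 'e1 \<times> 'e2 \<times> 'e3" where "i3 w = (0, 0, (1 / \<phi>2 a) *\<^sub>R w)" for w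
  let ?B = "i1 ` B1 \<union> i2 ` B2 \<union> i3 ` B3"
  have pos: "\<phi>1 a > 0" "\<phi>2 a > 0" by (rule warping)+
  have lin: "linear i1" "linear i2" "linear i3"
    by (auto intro!: linearI simp: i1_def i2_def i3_def scaleR_add_right)
  note onb = B1[unfolded orthonormal_basis_def] B2[unfolded orthonormal_basis_def]
    B3[unfolded orthonormal_basis_def]
  have "u \<in> span ?B" for u
  proof -
    obtain u1 u2 u3 where u: "u = (u1, u2, u3)" by (cases u)
    have "i1 u1 \<in> span (i1 ` B1)" "i2 (\<phi>1 a *\<^sub>R u2) \<in> span (i2 ` B2)" "i3 (\<phi>2 a *\<^sub>R u3) \<in> span (i3 ` B3)"
      using onb lin by (simp_all add: linear_span_image)
    moreover have "span (i1 ` B1) \<subseteq> span ?B" "span (i2 ` B2) \<subseteq> span ?B" "span (i3 ` B3) \<subseteq> span ?B"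
      by (auto intro!: span_mono)
    ultimately have "i1 u1 + i2 (\<phi>1 a *\<^sub>R u2) + i3 (\<phi>2 a *\<^sub>R u3) \<in> span ?B"
      by (intro span_add) auto
    then show ?thesis using pos by (simp add: u i1_def i2_def i3_def)
  qed
  then have "span ?B = UNIV" by blast
  moreover have ortho: "pb (a, b, c) (i1 u) (i1 u') = g1 a u u'" "pb (a, b, c) (i2 v) (i2 v') = g2 b v v'"
    "pb (a, b, c) (i3 w) (i3 w') = g3 c w w'" "pb (a, b, c) (i1 u) (i2 v) = 0" "pb (a, b, c) (i2 v) (i1 u) = 0"
    "pb (a, b, c) (i1 u) (i3 w) = 0" "pb (a, b, c) (i3 w) (i1 u) = 0"
    "pb (a, b, c) (i2 v) (i3 w) = 0" "pb (a, b, c) (i3 w) (i2 v) = 0" for u u' v v' w w'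
    using pos by (simp_all add: i1_def i2_def i3_def pb_eq form_zeros h2.scale_left h2.scale_right
        h3.scale_left h3.scale_right power2_eq_square)
  have inj: "inj i1" "inj i2" "inj i3"
    using pos by (auto intro!: injI simp: i1_def i2_def i3_def)
  \<comment> \<open>The zero vector has the same image under all three embeddings; its absence keeps
    the images disjoint.\<close>
  have nz: "0 \<notin> B1" "0 \<notin> B2" "0 \<notin> B3"
    using onb h1.zero_left h2.zero_left h3.zero_left by (metis zero_neq_one)+
  then have disj: "i1 u \<noteq> i2 v" "i1 u \<noteq> i3 w" "i2 v \<noteq> i3 w" if "u \<in> B1" "v \<in> B2" "w \<in> B3" for u v w
    using that pos by (auto simp: i1_def i2_def i3_def)
  then have "pb (a, b, c) s t = (if s = t then 1 else 0)" if "s \<in> ?B" "t \<in> ?B" for s t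
  proof -
    have "(\<exists>u\<in>B1. s = i1 u) \<or> (\<exists>u\<in>B2. s = i2 u) \<or> (\<exists>u\<in>B3. s = i3 u)"
      "(\<exists>u\<in>B1. t = i1 u) \<or> (\<exists>u\<in>B2. t = i2 u) \<or> (\<exists>u\<in>B3. t = i3 u)" using that by blast+
    moreover have "i1 u = i1 u' \<longleftrightarrow> u = u'" "i2 v = i2 v' \<longleftrightarrow> v = v'" "i3 w = i3 w' \<longleftrightarrow> w = w'"
      for u u' v v' w w' using inj by (auto dest: injD)
    moreover have "i1 u \<noteq> i2 v" "i2 v \<noteq> i1 u" if "u \<in> B1" "v \<in> B2" for u v
      using that nz pos by (auto simp: i1_def i2_def)
    moreover have "i1 u \<noteq> i3 v" "i3 v \<noteq> i1 u" if "u \<in> B1" "v \<in> B3" for u v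
      using that nz pos by (auto simp: i1_def i3_def)
    moreover have "i2 u \<noteq> i3 v" "i3 v \<noteq> i2 u" if "u \<in> B2" "v \<in> B3" for u v
      using that nz pos by (auto simp: i2_def i3_def)
    ultimately show ?thesis using onb by (elim disjE bexE) (simp_all add: ortho)
  qed
  moreover have "finite ?B" using onb by blast
  ultimately have "orthonormal_basis (pb (a, b, c)) ?B" unfolding orthonormal_basis_def by blast
  moreover have "snd (snd u) = 0 \<or> (\<exists>w. u = (0, 0, w))" if "u \<in> ?B" for u
    using that by (auto simp: i1_def i2_def i3_def)
  moreover have "{u \<in> ?B. snd (snd u) \<noteq> 0} = i3 ` B3"
    using nz pos by (auto simp: i1_def i2_def i3_def)
  then have "card {u \<in> ?B. snd (snd u) \<noteq> 0} = DIM('e3)"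
    using card_image[of i3 B3] inj(3) h3.onb_card[OF B3] by (simp add: inj_on_subset)
  ultimately show ?thesis by (rule that)
qed

text \<open>\<open>D\<close> removes the known component along \<open>n\<close>. The subtracted
  coefficient is the projection to the third factor as a form, and its squared entries in an adapted
  basis sum to the dimension of that factor. What remains is a sum of squares; in the equality case
  it vanishes on the basis, hence everywhere by bilinearity.\<close>

lemma second_ff_norm_sq_eq:
  assumes n: "\<And>z w. g (\<psi> (a, b, c)) (\<Sigma> (a, b, c) (0, 0, z) (0, 0, w)) (\<Sigma> (a, b, c) (0, 0, z) (0, 0, w)) =
      g (\<psi> (a, b, c))
        (\<Sigma> (a, b, c) (0, 0, z) (0, 0, w) - pb (a, b, c) (0, 0, z) (0, 0, w) *\<^sub>R n)
        (\<Sigma> (a, b, c) (0, 0, z) (0, 0, w) - pb (a, b, c) (0, 0, z) (0, 0, w) *\<^sub>R n) +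
      (pb (a, b, c) (0, 0, z) (0, 0, w))\<^sup>2 * R"
  defines "D \<equiv> \<lambda>u v. \<Sigma> (a, b, c) u v - pb (a, b, c) (0, 0, snd (snd u)) (0, 0, snd (snd v)) *\<^sub>R n"
  shows "second_ff_norm_sq L M g \<psi> (a, b, c) \<ge> real DIM('e3) * R"
    and "second_ff_norm_sq L M g \<psi> (a, b, c) = real DIM('e3) * R \<Longrightarrow> D u v = 0"
proof -
  let ?x = "(a, b, c)" and ?p = "\<psi> (a, b, c)"
  interpret G: inner_form "g ?p" by (rule inner)
  interpret P: inner_form "pb ?x" by (rule inner_pb)
  let ?h = "\<lambda>u v. pb ?x (0, 0, snd (snd u)) (0, 0, snd (snd v))"
  obtain B where B: "orthonormal_basis (pb ?x) B"
    "\<And>u. u \<in> B \<Longrightarrow> snd (snd u) = 0 \<or> (\<exists>w. u = (0, 0, w))"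
    "card {u \<in> B. snd (snd u) \<noteq> 0} = DIM('e3)" by (rule ex_adapted_onb[of a b c]) blast
  have fin: "finite B" and span: "span B = UNIV" and
    ortho: "\<And>u v. u \<in> B \<Longrightarrow> v \<in> B \<Longrightarrow> pb ?x u v = (if u = v then 1 else 0)"
    using B(1) unfolding orthonormal_basis_def by auto
  have zero: "?h u v = 0" if "snd (snd u) = 0 \<or> snd (snd v) = 0" for u v
    using that by (auto simp: pb_eq form_zeros)
  have term_eq: "g ?p (\<Sigma> ?x u v) (\<Sigma> ?x u v) = g ?p (D u v) (D u v) + (?h u v)\<^sup>2 * R"
    if "u \<in> B" "v \<in> B" for u v
  proof (cases "snd (snd u) = 0 \<or> snd (snd v) = 0")
    case True
    then show ?thesis unfolding D_def zero[OF True] by simp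
  next
    case False
    with B(2) that obtain z w where "u = (0, 0, z)" "v = (0, 0, w)" by blast
    then show ?thesis using n[of z w] by (simp add: D_def)
  qed
  have h_eq: "(?h u v)\<^sup>2 = (if v = u then if snd (snd u) \<noteq> 0 then 1 else 0 else 0)"
    if "u \<in> B" "v \<in> B" for u v
  proof (cases "snd (snd u) = 0 \<or> snd (snd v) = 0")
    case True
    then show ?thesis unfolding zero[OF True] by auto
  next
    case False
    with B(2) that obtain z w where "u = (0, 0, z)" "v = (0, 0, w)" by blast
    then show ?thesis using ortho[OF that] False by auto
  qed
  have "(\<Sum>u\<in>B. \<Sum>v\<in>B. (?h u v)\<^sup>2) = (\<Sum>u\<in>B. \<Sum>v\<in>B. if v = u then if snd (snd u) \<noteq> 0 then 1 else 0 else 0)"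
    by (intro sum.cong refl h_eq)
  also have "\<dots> = (\<Sum>u\<in>B. if snd (snd u) \<noteq> 0 then 1 else 0)"
    using fin by (intro sum.cong refl) simp
  also have "\<dots> = real DIM('e3)"
    using fin B(3) by (simp add: sum.If_cases Int_def Collect_conj_eq[symmetric] conj_commute)
  finally have h_sum: "(\<Sum>u\<in>B. \<Sum>v\<in>B. (?h u v)\<^sup>2) = real DIM('e3)" .
  have "second_ff_norm_sq L M g \<psi> ?x = (\<Sum>u\<in>B. \<Sum>v\<in>B. g ?p (\<Sigma> ?x u v) (\<Sigma> ?x u v))"
    unfolding second_ff_norm_sq_def
    by (rule onb_norm_sq_unique[OF inner_pb G.bilin bilinear_\<Sigma> P.some_onb B(1)])
  also have "\<dots> = (\<Sum>u\<in>B. \<Sum>v\<in>B. g ?p (D u v) (D u v) + (?h u v)\<^sup>2 * R)"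
    by (intro sum.cong refl term_eq)
  also have "\<dots> = (\<Sum>u\<in>B. \<Sum>v\<in>B. g ?p (D u v) (D u v)) + real DIM('e3) * R"
    unfolding sum.distrib h_sum[symmetric] sum_distrib_right ..
  finally have norm: "second_ff_norm_sq L M g \<psi> ?x =
      (\<Sum>u\<in>B. \<Sum>v\<in>B. g ?p (D u v) (D u v)) + real DIM('e3) * R" .
  then show "second_ff_norm_sq L M g \<psi> ?x \<ge> real DIM('e3) * R"
    by (simp add: sum_nonneg G.nonneg)
  assume "second_ff_norm_sq L M g \<psi> ?x = real DIM('e3) * R"
  then have "(\<Sum>u\<in>B. \<Sum>v\<in>B. g ?p (D u v) (D u v)) = 0" using norm by simp
  then have "D u v = 0" if "u \<in> B" "v \<in> B" for u v
    using that fin by (simp add: sum_nonneg_eq_0_iff sum_nonneg G.nonneg G.eq_zero_iff)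
  moreover have "bilinear D"
  proof -
    interpret h3: inner_form "g3 c" by (rule C.inner)
    show ?thesis
      unfolding D_def bilinear_def
      by (intro conjI allI linearI) (simp_all add: bilinear_ladd[OF bilinear_\<Sigma>] bilinear_radd[OF bilinear_\<Sigma>]
        bilinear_lmul[OF bilinear_\<Sigma>] bilinear_rmul[OF bilinear_\<Sigma>] pb_eq form_zeros h3.expand algebra_simps)
  qed
  ultimately show "D u v = 0" using bilinear_eq_0_span[OF _ span] by blast
qed


section \<open>Second fundamental forms of the leaves\<close>

lemma christoffel_L:
  "pb x (christoffel L pb x u v) w = (dpb x u v w + dpb x v u w - dpb x w u v) / 2"
  unfolding christoffel_pb hess_cov_df ..

text \<open>The base of a warped product is totally geodesic in it, as Koszul gives no fibre
  components. The ambient derivative is then tangent to the leaf once \<open>\<Sigma>\<close>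
  vanishes.\<close>

lemma leaf1_second_ff:
  assumes "\<Sigma> (a, b, c) (u, 0, 0) (v, 0, 0) = 0"
  shows "second_ff L1 M g (leaf1 \<psi> b c) a u v = 0"
proof -
  let ?x = "(a, b, c)"
  interpret l: immersed L1 M g "leaf1 \<psi> b c" by (rule immersed_leaf1)
  interpret g2: inner_form "g2 b" by (rule B.inner)
  interpret g3: inner_form "g3 c" by (rule C.inner)
  obtain t1 t2 t3 where t: "christoffel L pb ?x (u, 0, 0) (v, 0, 0) = (t1, t2, t3)" by (metis prod_cases3)
  have "g2 b t2 w = 0" for w
    using christoffel_L[of ?x "(u, 0, 0)" "(v, 0, 0)" "(0, w, 0)"] warping(3)[of a]
    by (simp add: t pb_eq dpb_eq form_zeros)
  then have "t2 = 0" using g2.eqI[of t2 0] by (simp add: g2.zero_left)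
  moreover have "g3 c t3 w = 0" for w
    using christoffel_L[of ?x "(u, 0, 0)" "(v, 0, 0)" "(0, 0, w)"] warping(4)[of a]
    by (simp add: t pb_eq dpb_eq form_zeros)
  then have "t3 = 0" using g3.eqI[of t3 0] by (simp add: g3.zero_left)
  ultimately have "hess_cov ?x (u, 0, 0) (v, 0, 0) = df ?x (t1, 0, 0)"
    using \<Sigma>_eq[of ?x "(u, 0, 0)" "(v, 0, 0)"] assms by (simp add: t)
  then show ?thesis
    by (intro l.\<Sigma>_unique[of _ _ _ _ t1])
      (simp_all add: hess_cov_leaf1 df_leaf1 inner_form.zero_left[OF inner])
qed

text \<open>The horizontal part for a fibre of a warped product is minus the metric times the
  gradient of ln \<phi>1, and this gradient is \<beta> \<xi>.\<close>

lemma christoffel_L_fibre2: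
  assumes k: "df (a, b, c) (k, 0, 0) = \<xi> (\<psi> (a, b, c))"
  obtains t where "christoffel L pb (a, b, c) (0, u, 0) (0, v, 0) =
    (- (pb (a, b, c) (0, u, 0) (0, v, 0) * \<beta> (\<psi> (a, b, c))) *\<^sub>R k, t, 0)"
proof -
  let ?x = "(a, b, c)"
  interpret g1: inner_form "g1 a" by (rule A.inner)
  interpret g3: inner_form "g3 c" by (rule C.inner)
  have m: "dln1 a w = g1 a (\<beta> (\<psi> ?x) *\<^sub>R k) w" for w by (rule ex_gradients[OF k]) blast
  obtain t1 t2 t3 where t: "christoffel L pb ?x (0, u, 0) (0, v, 0) = (t1, t2, t3)" by (metis prod_cases3)
  have "g3 c t3 w = 0" for w
    using christoffel_L[of ?x "(0, u, 0)" "(0, v, 0)" "(0, 0, w)"] warping(4)[of a]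
    by (simp add: t pb_eq dpb_eq form_zeros)
  then have "t3 = 0" using g3.eqI[of t3 0] by (simp add: g3.zero_left)
  moreover have "t1 = - (pb ?x (0, u, 0) (0, v, 0) * \<beta> (\<psi> ?x)) *\<^sub>R k"
  proof (rule g1.eqI)
    fix w
    show "g1 a t1 w = g1 a (- (pb ?x (0, u, 0) (0, v, 0) * \<beta> (\<psi> ?x)) *\<^sub>R k) w"
      using christoffel_L[of ?x "(0, u, 0)" "(0, v, 0)" "(w, 0, 0)"]
      by (simp add: t pb_eq dpb_eq form_zeros m g1.expand)
  qed
  ultimately show thesis using t by (intro that) simp
qed

lemma leaf2_umbilical:
  assumes "\<And>x u v. \<Sigma> x (0, u, 0) (0, v, 0) = 0"
  shows "totally_umbilical L2 M g (leaf2 \<psi> a c)"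
proof -
  interpret l: immersed L2 M g "leaf2 \<psi> a c" by (rule immersed_leaf2)
  show ?thesis
  proof (rule l.totally_umbilicalI)
    fix b :: 'b
    let ?x = "(a, b, c)"
    interpret G: inner_form "g (\<psi> ?x)" by (rule inner)
    interpret d: linear "df ?x" by (rule linear_df)
    obtain k where k: "df ?x (k, 0, 0) = \<xi> (\<psi> ?x)" using \<xi>_tangent by blast
    \<comment> \<open>With \<open>\<Sigma>\<close> zero on this factor, curvature comes only from
      the fibre inside the product: minus the gradient of ln \<phi>1.\<close>
    define H where "H = - \<beta> (\<psi> ?x) *\<^sub>R \<xi> (\<psi> ?x)"
    have at: "leaf2 \<psi> a c b = \<psi> ?x" by (simp add: leaf2_def)
    have pb2: "l.pb b u v = pb ?x (0, u, 0) (0, v, 0)" for u v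
      unfolding pullback_metric_def df_leaf2 at ..
    have "l.\<Sigma> b u v = l.pb b u v *\<^sub>R H" for u v
    proof -
      obtain t where t: "christoffel L pb ?x (0, u, 0) (0, v, 0) =
          (- (pb ?x (0, u, 0) (0, v, 0) * \<beta> (\<psi> ?x)) *\<^sub>R k, t, 0)"
        by (rule christoffel_L_fibre2[OF k])
      have "hess_cov ?x (0, u, 0) (0, v, 0) = df ?x (christoffel L pb ?x (0, u, 0) (0, v, 0))"
        using \<Sigma>_eq[of ?x "(0, u, 0)" "(0, v, 0)"] assms by simp
      also have "\<dots> = df ?x (- (pb ?x (0, u, 0) (0, v, 0) * \<beta> (\<psi> ?x)) *\<^sub>R (k, 0, 0) + (0, t, 0))"
        unfolding t by simp
      also have "\<dots> = pb ?x (0, u, 0) (0, v, 0) *\<^sub>R H + df ?x (0, t, 0)"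
        unfolding d.add d.scaleR k H_def by simp
      finally show ?thesis
        by (intro l.\<Sigma>_unique[of _ _ _ _ t])
          (simp_all add: hess_cov_leaf2 df_leaf2 pb2 H_def at G.expand \<xi>_orthogonal2
            G.sym[of "\<xi> _"])
    qed
    then show "\<exists>H. \<forall>u v. l.\<Sigma> b u v = l.pb b u v *\<^sub>R H" by blast
  qed
qed

lemma leaf3_umbilical:
  assumes "\<And>a b c. \<exists>n. (\<forall>t. g (\<psi> (a, b, c)) n (df (a, b, c) t) = 0) \<and>
    (\<forall>u v. \<Sigma> (a, b, c) (0, 0, u) (0, 0, v) = pb (a, b, c) (0, 0, u) (0, 0, v) *\<^sub>R n)"
  shows "totally_umbilical L3 M g (leaf3 \<psi> a b)"
proof -
  interpret l: immersed L3 M g "leaf3 \<psi> a b" by (rule immersed_leaf3)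
  show ?thesis
  proof (rule l.totally_umbilicalI)
    fix c :: 'c
    let ?x = "(a, b, c)"
    interpret G: inner_form "g (\<psi> ?x)" by (rule inner)
    interpret d: linear "df ?x" by (rule linear_df)
    interpret g1: inner_form "g1 a" by (rule A.inner)
    interpret g2: inner_form "g2 b" by (rule B.inner)
    obtain n where n: "\<And>t. g (\<psi> ?x) n (df ?x t) = 0"
      "\<And>u v. \<Sigma> ?x (0, 0, u) (0, 0, v) = pb ?x (0, 0, u) (0, 0, v) *\<^sub>R n"
      using assms by blast
    obtain m where m: "\<And>u. g1 a m u = dln2 a u" using g1.riesz[OF linear_dln(2)] by blast
    \<comment> \<open>Two sources add up: \<open>n\<close> from the product in the ambient manifold,
      and minus the gradient of ln \<phi>2 from the fibre in the product.\<close>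
    define H where "H = n - df ?x (m, 0, 0)"
    have at: "leaf3 \<psi> a b c = \<psi> ?x" by (simp add: leaf3_def)
    have pb3: "l.pb c u v = pb ?x (0, 0, u) (0, 0, v)" for u v
      unfolding pullback_metric_def df_leaf3 at ..
    have "l.\<Sigma> c u v = l.pb c u v *\<^sub>R H" for u v
    proof -
      let ?r = "pb ?x (0, 0, u) (0, 0, v)"
      obtain t1 t2 t3 where t: "christoffel L pb ?x (0, 0, u) (0, 0, v) = (t1, t2, t3)"
        by (metis prod_cases3)
      have "g2 b t2 w = 0" for w
        using christoffel_L[of ?x "(0, 0, u)" "(0, 0, v)" "(0, w, 0)"] warping(3)[of a]
        by (simp add: t pb_eq dpb_eq form_zeros)
      then have "t2 = 0" using g2.eqI[of t2 0] by (simp add: g2.zero_left)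
      moreover have "t1 = - ?r *\<^sub>R m"
      proof (rule g1.eqI)
        fix w
        show "g1 a t1 w = g1 a (- ?r *\<^sub>R m) w"
          using christoffel_L[of ?x "(0, 0, u)" "(0, 0, v)" "(w, 0, 0)"]
          by (simp add: t pb_eq dpb_eq form_zeros m g1.expand)
      qed
      ultimately have "hess_cov ?x (0, 0, u) (0, 0, v) = ?r *\<^sub>R n + df ?x (- ?r *\<^sub>R (m, 0, 0) + (0, 0, t3))"
        using \<Sigma>_eq[of ?x "(0, 0, u)" "(0, 0, v)"] n(2)[of u v] by (simp add: t algebra_simps)
      also have "\<dots> = ?r *\<^sub>R H + df ?x (0, 0, t3)"
        unfolding d.add d.scaleR H_def by (simp add: algebra_simps)
      finally have hess: "hess_cov ?x (0, 0, u) (0, 0, v) = ?r *\<^sub>R H + df ?x (0, 0, t3)" .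
      have "g (\<psi> ?x) (df ?x (m, 0, 0)) (df ?x (0, 0, w)) = 0" for w
        by (simp add: g_df) (simp add: pb_eq form_zeros)
      then have H: "g (\<psi> ?x) H (df ?x (0, 0, w)) = 0" for w by (simp add: H_def G.diff_left n(1))
      show ?thesis
        by (rule l.\<Sigma>_unique[of _ _ _ _ t3])
          (simp_all add: hess_cov_leaf3 df_leaf3 pb3 G.scale_left hess at H)
    qed
    then show "\<exists>H. \<forall>u v. l.\<Sigma> c u v = l.pb c u v *\<^sub>R H" by blast
  qed
qed

lemma norm_bound:
  defines "bound \<equiv> \<lambda>x.
      real DIM('e2) * (1 + (cot \<nu>)\<^sup>2) * (1 + (cos \<nu>)\<^sup>2) *
        (grad_norm_sq L pb (\<lambda>(a, b, c). ln (\<phi>1 a)) x - (\<beta> (\<psi> x))\<^sup>2) +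
      real DIM('e3) * ((1 / sin \<nu>)\<^sup>2 - 1) *
        (grad_norm_sq L pb (\<lambda>(a, b, c). ln (\<phi>2 a)) x - (\<beta> (\<psi> x))\<^sup>2)"
  shows "second_ff_norm_sq L M g \<psi> x \<ge> bound x"
    and "second_ff_norm_sq L M g \<psi> (a, b, c) = bound (a, b, c) \<Longrightarrow>
      \<exists>n. (\<forall>t. g (\<psi> (a, b, c)) n (df (a, b, c) t) = 0) \<and>
        (\<forall>u v. \<Sigma> (a, b, c) u v = pb (a, b, c) (0, 0, snd (snd u)) (0, 0, snd (snd v)) *\<^sub>R n)"
proof -
  have main: "second_ff_norm_sq L M g \<psi> (a, b, c) \<ge> bound (a, b, c) \<and>
    (second_ff_norm_sq L M g \<psi> (a, b, c) = bound (a, b, c) \<longrightarrow>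
      (\<exists>n. (\<forall>t. g (\<psi> (a, b, c)) n (df (a, b, c) t) = 0) \<and>
        (\<forall>u v. \<Sigma> (a, b, c) u v = pb (a, b, c) (0, 0, snd (snd u)) (0, 0, snd (snd v)) *\<^sub>R n)))"
    for a b c
  proof -
    let ?x = "(a, b, c)"
    let ?R = "((1 / sin \<nu>)\<^sup>2 - 1) *
        (grad_norm_sq L pb (\<lambda>(a, b, c). ln (\<phi>2 a)) ?x - (\<beta> (\<psi> ?x))\<^sup>2)"
    have bound: "bound ?x = real DIM('e3) * ?R"
      unfolding bound_def grad_norm_sq_ln1 by simp
    show ?thesis
    proof (rule \<Sigma>_perp_norm[of a b c], intro conjI impI)
      fix n
      assume n: "\<And>t. g (\<psi> ?x) n (df ?x t) = 0"
        "\<And>z w. g (\<psi> ?x) (\<Sigma> ?x (0, 0, z) (0, 0, w)) (\<Sigma> ?x (0, 0, z) (0, 0, w)) =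
          g (\<psi> ?x) (\<Sigma> ?x (0, 0, z) (0, 0, w) - pb ?x (0, 0, z) (0, 0, w) *\<^sub>R n)
            (\<Sigma> ?x (0, 0, z) (0, 0, w) - pb ?x (0, 0, z) (0, 0, w) *\<^sub>R n) +
          (pb ?x (0, 0, z) (0, 0, w))\<^sup>2 * ?R"
      show "bound ?x \<le> second_ff_norm_sq L M g \<psi> ?x"
        unfolding bound by (rule second_ff_norm_sq_eq(1)[OF n(2)])
      assume "second_ff_norm_sq L M g \<psi> ?x = bound ?x"
      then have "\<Sigma> ?x u v - pb ?x (0, 0, snd (snd u)) (0, 0, snd (snd v)) *\<^sub>R n = 0" for u v
        unfolding bound by (rule second_ff_norm_sq_eq(2)[OF n(2)])
      then show "\<exists>n. (\<forall>t. g (\<psi> ?x) n (df ?x t) = 0) \<and>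
          (\<forall>u v. \<Sigma> ?x u v = pb ?x (0, 0, snd (snd u)) (0, 0, snd (snd v)) *\<^sub>R n)"
        using n(1) by (intro exI[of _ n]) simp
    qed
  qed
  show "second_ff_norm_sq L M g \<psi> x \<ge> bound x"
    using main[of "fst x" "fst (snd x)" "snd (snd x)"] by simp
  show "second_ff_norm_sq L M g \<psi> (a, b, c) = bound (a, b, c) \<Longrightarrow>
      \<exists>n. (\<forall>t. g (\<psi> (a, b, c)) n (df (a, b, c) t) = 0) \<and>
        (\<forall>u v. \<Sigma> (a, b, c) u v = pb (a, b, c) (0, 0, snd (snd u)) (0, 0, snd (snd v)) *\<^sub>R n)"
    using main by blast
qed

end

theorem theorem4p1:
  fixes Lt :: "('m::{t2_space, second_countable_topology}, 'e::euclidean_space) manifold"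
    and \<Phi> :: "'m \<Rightarrow> 'e \<Rightarrow> 'e" and \<xi> :: "'m \<Rightarrow> 'e" and \<eta> :: "'m \<Rightarrow> 'e \<Rightarrow> real"
    and g :: "'m \<Rightarrow> 'e \<Rightarrow> 'e \<Rightarrow> real" and \<beta> :: "'m \<Rightarrow> real"
    and L\<nu> :: "('a::{t2_space, second_countable_topology}, 'e1::euclidean_space) manifold"
    and LT :: "('b::{t2_space, second_countable_topology}, 'e2::euclidean_space) manifold"
    and Lp :: "('c::{t2_space, second_countable_topology}, 'e3::euclidean_space) manifold"
    and g\<nu> :: "'a \<Rightarrow> 'e1 \<Rightarrow> 'e1 \<Rightarrow> real"
    and gT :: "'b \<Rightarrow> 'e2 \<Rightarrow> 'e2 \<Rightarrow> real"
    and gp :: "'c \<Rightarrow> 'e3 \<Rightarrow> 'e3 \<Rightarrow> real"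
    and \<phi>1 \<phi>2 :: "'a \<Rightarrow> real" and \<psi> :: "'a \<times> 'b \<times> 'c \<Rightarrow> 'm" and \<nu> :: real
    and L :: "('a \<times> 'b \<times> 'c, 'e1 \<times> 'e2 \<times> 'e3) manifold"
    and h :: "'a \<times> 'b \<times> 'c \<Rightarrow> 'e1 \<times> 'e2 \<times> 'e3 \<Rightarrow> 'e1 \<times> 'e2 \<times> 'e3 \<Rightarrow> real"
    and n1 n2 :: nat and bound :: "'a \<times> 'b \<times> 'c \<Rightarrow> real"
  assumes ambient: "locally_conformal_almost_cosymplectic Lt \<Phi> \<xi> \<eta> g \<beta>"
    and biwarped: "biwarped_product_submanifold L\<nu> g\<nu> LT gT Lp gp \<phi>1 \<phi>2 Lt g \<psi>"
    and slant: "\<And>b c. proper_slant_tangent L\<nu> Lt \<Phi> \<xi> g (leaf1 \<psi> b c) \<nu>"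
    and invar: "\<And>a c. invariant_orthogonal LT Lt \<Phi> \<xi> g (leaf2 \<psi> a c)"
    and anti: "\<And>a b. anti_invariant_orthogonal Lp Lt \<Phi> \<xi> g (leaf3 \<psi> a b)"
    and L: "L = prod_manifold3 L\<nu> LT Lp"
    and h: "h = biwarped_metric g\<nu> gT gp \<phi>1 \<phi>2"
    and n1: "n1 = DIM('e2)" and n2: "n2 = DIM('e3)"
    and normal: "\<And>x Z. Z \<in> D_perp \<Longrightarrow> \<Phi> (\<psi> x) (dmap L Lt \<psi> x Z) \<in> normal_space_at L Lt g \<psi> x"
    and mixed: "\<And>x Z U. Z \<in> D_perp \<Longrightarrow> U \<in> D_slant L Lt \<xi> g \<psi> x \<Longrightarrow>
                  second_ff L Lt g \<psi> x Z U = 0"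
    and bound: "\<And>x. bound x =
      real n1 * (1 + (cot \<nu>)\<^sup>2) * (1 + (cos \<nu>)\<^sup>2) *
        (grad_norm_sq L h (\<lambda>(a, b, c). ln (\<phi>1 a)) x - (\<beta> (\<psi> x))\<^sup>2) +
      real n2 * ((1 / sin \<nu>)\<^sup>2 - 1) *
        (grad_norm_sq L h (\<lambda>(a, b, c). ln (\<phi>2 a)) x - (\<beta> (\<psi> x))\<^sup>2)"
  shows "(\<forall>x. second_ff_norm_sq L Lt g \<psi> x \<ge> bound x) \<and>
    ((\<forall>x. second_ff_norm_sq L Lt g \<psi> x = bound x) \<longrightarrow>
      (\<forall>b c. totally_geodesic L\<nu> Lt g (leaf1 \<psi> b c)) \<and>
      (\<forall>a c. totally_umbilical LT Lt g (leaf2 \<psi> a c)) \<and>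
      (\<forall>a b. totally_umbilical Lp Lt g (leaf3 \<psi> a b)) \<and>
      (\<forall>x. \<forall>U\<in>D_slant L Lt \<xi> g \<psi> x. \<forall>V\<in>D_slant L Lt \<xi> g \<psi> x.
         second_ff L Lt g \<psi> x U V = 0))"
proof -
  interpret biwarped_slant Lt \<Phi> \<xi> \<eta> g \<beta> L\<nu> LT Lp g\<nu> gT gp \<phi>1 \<phi>2 \<psi> \<nu>
    using ambient biwarped slant invar anti normal[unfolded L] mixed[unfolded L]
    by unfold_locales
  \<comment> \<open>The immersion is isometric, so gradients for \<open>h\<close> are gradients for
    the pulled back metric.\<close>
  have h_pb: "h = pb"
    using biwarped unfolding biwarped_product_submanifold_def isometric_immersion_def h by simp
  note bound' = bound[unfolded h_pb L n1 n2]
  have ge: "second_ff_norm_sq (prod_manifold3 L\<nu> LT Lp) Lt g \<psi> x \<ge> bound x" for x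
    unfolding bound' by (rule norm_bound(1))
  moreover have "(\<forall>b c. totally_geodesic L\<nu> Lt g (leaf1 \<psi> b c)) \<and>
      (\<forall>a c. totally_umbilical LT Lt g (leaf2 \<psi> a c)) \<and>
      (\<forall>a b. totally_umbilical Lp Lt g (leaf3 \<psi> a b)) \<and>
      (\<forall>x. \<forall>U\<in>D_slant L Lt \<xi> g \<psi> x. \<forall>V\<in>D_slant L Lt \<xi> g \<psi> x.
         second_ff L Lt g \<psi> x U V = 0)"
    if eq: "\<forall>x. second_ff_norm_sq L Lt g \<psi> x = bound x"
  proof -
    have n: "\<exists>n. (\<forall>t. g (\<psi> (a, b, c)) n (df (a, b, c) t) = 0) \<and>
        (\<forall>u v. \<Sigma> (a, b, c) u v = pb (a, b, c) (0, 0, snd (snd u)) (0, 0, snd (snd v)) *\<^sub>R n)" for a b c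
      by (rule norm_bound(2)) (use eq in \<open>simp only: bound' L\<close>)
    \<comment> \<open>Equality leaves only the third-factor block of \<open>\<Sigma>\<close>. This
      one vanishing statement serves the base leaves, the invariant leaves and the slant
      distribution.\<close>
    have zero: "\<Sigma> x u v = 0" if "snd (snd u) = 0" for x u v
    proof -
      obtain a b c where x: "x = (a, b, c)" by (cases x)
      obtain n where "\<Sigma> x u v = pb x (0, 0, snd (snd u)) (0, 0, snd (snd v)) *\<^sub>R n"
        using n[of a b c] unfolding x by blast
      then show ?thesis using that by (simp add: x pb_eq form_zeros)
    qed
    show ?thesis
    proof (intro conjI allI ballI)
      show "totally_geodesic L\<nu> Lt g (leaf1 \<psi> b c)" for b c
        unfolding totally_geodesic_def by (intro allI leaf1_second_ff zero) simp
      show "totally_umbilical LT Lt g (leaf2 \<psi> a c)" for a c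
        by (intro leaf2_umbilical zero) simp
      show "totally_umbilical Lp Lt g (leaf3 \<psi> a b)" for a b
        using n by (intro leaf3_umbilical) (metis snd_conv)
      show "second_ff L Lt g \<psi> x U V = 0" if "U \<in> D_slant L Lt \<xi> g \<psi> x" for x U V
        unfolding L by (rule zero) (use that in \<open>auto simp: D_slant_def\<close>)
    qed
  qed
  ultimately show ?thesis unfolding L by blast
qed

end
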